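(* Assume $\sup_{1\le i\le p}E(\rho^X_i)^{1/2}(X_{(i)},0_{d_i})<\infty$ and $\sup_{1\le j\le q}E(\rho^Y_j)^{1/2}(Y_{(j)},0_{g_j})<\infty$. Then $\mathcal D(X,Y)=0$ if and only if $X$ and $Y$ are independent.
   Context: $X=(X_{(1)},\dots,X_{(p)})\in\mathbb R^{\tilde p}$ and $Y=(Y_{(1)},\dots,Y_{(q)})\in\mathbb R^{\tilde q}$ are random vectors with groups $X_{(i)}\in\mathbb R^{d_i}$, $Y_{(j)}\in\mathbb R^{g_j}$, $\tilde p=\sum d_i$, $\tilde q=\sum g_j$; $(X',Y'),(X'',Y'')$ are independent copies of $(X,Y)$; $0_d$ is the origin of $\mathbb R^d$. Distances: $K(x,x')=\sqrt{\sum_{i=1}^p\rho^X_i(x_{(i)},x'_{(i)})}$ on $\mathbb R^{\tilde p}$ and $K(y,y')=\sqrt{\sum_{j=1}^q\rho^Y_j(y_{(j)},y'_{(j)})}$ on $\mathbb R^{\tilde q}$ (same letter $K$), where each distance falls in Case S1 (every $\rho_i$ is a metric of strong negative type on its Euclidean space) or Case S2 (every $\rho_i$ is the squared Euclidean distance, so $K$ is the Euclidean distance). A metric $\rho$ on $\mathbb R^d$ has negative type if $\sum_{k,l}\alpha_k\alpha_l\rho(x_k,x_l)\le0$ whenever $\sum_k\alpha_k=0$; strong negative type if moreover, for Borel probability measures $\mu,\nu$ with finite first $\rho$-moment, $2\iint\rho\,d\mu\,d\nu-\iint\rho\,d\mu\,d\mu-\iint\rho\,d\nu\,d\nu=0$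 only if $\mu=\nu$. $\mathcal D(X,Y)$ is the nonnegative square root of $\mathcal D^2(X,Y)=E K(X,X')K(Y,Y')+E K(X,X')\,E K(Y,Y')-2E K(X,X')K(Y,Y'')$. *)

theory Defs
  imports "HOL-Probability.Probability"
begin

text \<open>
  The block dimensions vary with the block index, so R^d is modelled by the functions
  that are extensional on \<^term>\<open>{..<d::nat}\<close>, with the product of the real Borel sets, which
  is the Borel sigma-algebra of the Euclidean topology.
\<close>

definition borel_Rn :: "nat \<Rightarrow> (nat \<Rightarrow> real) measure" where
  "borel_Rn d = PiM {..<d} (\<lambda>_. borel)"

abbreviation Rn :: "nat \<Rightarrow> (nat \<Rightarrow> real) set" where
  "Rn d \<equiv> space (borel_Rn d)"

definition origin :: "nat \<Rightarrow> (nat \<Rightarrow> real)" where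
  "origin d = (\<lambda>k\<in>{..<d}. 0)"

text \<open>
  A vector of n groups, the i-th one in R^(d i) for i = 1, ..., n; this identifies
  R^(d 1 + ... + d n) with the product of the R^(d i).
\<close>

definition borel_groups :: "nat \<Rightarrow> (nat \<Rightarrow> nat) \<Rightarrow> (nat \<Rightarrow> nat \<Rightarrow> real) measure" where
  "borel_groups n d = PiM {1..n} (\<lambda>i. borel_Rn (d i))"

definition negative_type :: "'a set \<Rightarrow> ('a \<Rightarrow> 'a \<Rightarrow> real) \<Rightarrow> bool" where
  "negative_type S \<rho> \<longleftrightarrow>
     (\<forall>(n::nat) (x :: nat \<Rightarrow> 'a) (\<alpha> :: nat \<Rightarrow> real).
        (\<forall>k<n. x k \<in> S) \<longrightarrow> (\<Sum>k<n. \<alpha> k) = 0 \<longrightarrow>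
        (\<Sum>k<n. \<Sum>l<n. \<alpha> k * \<alpha> l * \<rho> (x k) (x l)) \<le> 0)"

definition finite_first_moment :: "('a \<Rightarrow> 'a \<Rightarrow> real) \<Rightarrow> 'a measure \<Rightarrow> bool" where
  "finite_first_moment \<rho> \<mu> \<longleftrightarrow> (\<exists>z\<in>space \<mu>. (\<integral>\<^sup>+ x. ennreal (\<rho> z x) \<partial>\<mu>) < \<infinity>)"

text \<open>The measurable space B carries the point set (its space) and the Borel sets.\<close>

definition strong_negative_type :: "'a measure \<Rightarrow> ('a \<Rightarrow> 'a \<Rightarrow> real) \<Rightarrow> bool" where
  "strong_negative_type B \<rho> \<longleftrightarrow>
     negative_type (space B) \<rho> \<and>
     (\<forall>\<mu> \<nu>. sets \<mu> = sets B \<longrightarrow> sets \<nu> = sets B \<longrightarrow>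
        prob_space \<mu> \<longrightarrow> prob_space \<nu> \<longrightarrow>
        finite_first_moment \<rho> \<mu> \<longrightarrow> finite_first_moment \<rho> \<nu> \<longrightarrow>
        2 * (\<integral>x. (\<integral>y. \<rho> x y \<partial>\<nu>) \<partial>\<mu>) - (\<integral>x. (\<integral>y. \<rho> x y \<partial>\<mu>) \<partial>\<mu>)
          - (\<integral>x. (\<integral>y. \<rho> x y \<partial>\<nu>) \<partial>\<nu>) = 0 \<longrightarrow>
        \<mu> = \<nu>)"

text \<open>
  Joint Borel measurability of the metrics is the standing requirement that makes the
  distances between random vectors random variables.  It is the only compatibility with the
  Euclidean topology that is imposed.
\<close>

definition case_S1 :: "nat \<Rightarrow> (nat \<Rightarrow> nat) \<Rightarrow> (nat \<Rightarrow> (nat \<Rightarrow> real) \<Rightarrow> (nat \<Rightarrow> real) \<Rightarrow> real) \<Rightarrow> bool" where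
  "case_S1 n d \<rho> \<longleftrightarrow>
     (\<forall>i\<in>{1..n}. Metric_space (Rn (d i)) (\<rho> i) \<and>
        case_prod (\<rho> i) \<in> borel_measurable (borel_Rn (d i) \<Otimes>\<^sub>M borel_Rn (d i)) \<and>
        strong_negative_type (borel_Rn (d i)) (\<rho> i))"

definition case_S2 :: "nat \<Rightarrow> (nat \<Rightarrow> nat) \<Rightarrow> (nat \<Rightarrow> (nat \<Rightarrow> real) \<Rightarrow> (nat \<Rightarrow> real) \<Rightarrow> real) \<Rightarrow> bool" where
  "case_S2 n d \<rho> \<longleftrightarrow>
     (\<forall>i\<in>{1..n}. \<forall>x\<in>Rn (d i). \<forall>y\<in>Rn (d i). \<rho> i x y = (\<Sum>k<d i. (x k - y k)\<^sup>2))"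

definition group_dist ::
  "nat \<Rightarrow> (nat \<Rightarrow> (nat \<Rightarrow> real) \<Rightarrow> (nat \<Rightarrow> real) \<Rightarrow> real) \<Rightarrow>
   (nat \<Rightarrow> nat \<Rightarrow> real) \<Rightarrow> (nat \<Rightarrow> nat \<Rightarrow> real) \<Rightarrow> real" where
  "group_dist n \<rho> x x' = sqrt (\<Sum>i=1..n. \<rho> i (x i) (x' i))"

text \<open>
  Independent copies of (X, Y) are realised as the coordinates of the product of M with
  itself: (X, Y), (X', Y'), (X'', Y'') are (X, Y) evaluated at w, w', w''.
  When K and L are metrics with first moments only, the first and the last expectation may be
  infinite (always both or neither); they then get the value 0, and what remains,
  E K(X,X') E L(Y,Y'), is positive, as X and Y cannot be independent or constant in that case.
\<close>

definition dcov_sq ::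
  "'w measure \<Rightarrow> ('a \<Rightarrow> 'a \<Rightarrow> real) \<Rightarrow> ('b \<Rightarrow> 'b \<Rightarrow> real) \<Rightarrow> ('w \<Rightarrow> 'a) \<Rightarrow> ('w \<Rightarrow> 'b) \<Rightarrow> real" where
  "dcov_sq M K L X Y =
     (\<integral>(w, w'). K (X w) (X w') * L (Y w) (Y w') \<partial>(M \<Otimes>\<^sub>M M))
     + (\<integral>(w, w'). K (X w) (X w') \<partial>(M \<Otimes>\<^sub>M M)) * (\<integral>(w, w'). L (Y w) (Y w') \<partial>(M \<Otimes>\<^sub>M M))
     - 2 * (\<integral>(w, w', w''). K (X w) (X w') * L (Y w) (Y w'') \<partial>(M \<Otimes>\<^sub>M (M \<Otimes>\<^sub>M M)))"

definition dcov ::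
  "'w measure \<Rightarrow> ('a \<Rightarrow> 'a \<Rightarrow> real) \<Rightarrow> ('b \<Rightarrow> 'b \<Rightarrow> real) \<Rightarrow> ('w \<Rightarrow> 'a) \<Rightarrow> ('w \<Rightarrow> 'b) \<Rightarrow> real" where
  "dcov M K L X Y = sqrt (dcov_sq M K L X Y)"

end

theory Submission
  imports Defs
begin

text \<open>
  Write \<rho>X, \<rho>Y for the sums of the block distances, so that K and L are their square roots. They are
  of negative type, so exp(- \<rho>) is positive definite. Since sqrt r is, up to a constant, the
  integral over u > 0 of (1 - exp(- u^2 r)) / u^2, the squared distance covariance is a mixture over
  u, v > 0 of the quadratic forms of the kernels exp(- u^2 \<rho>X - v^2 \<rho>Y) at the signed measure
  \<theta> = law(X,Y) - law(X) \<otimes> law(Y). Each form is nonnegative, so if the mixture vanishes then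
  one of them does. By Schur's theorem the kernel minus a rank one kernel e^(- f(z)) e^(- f(z')) is
  still positive definite whenever f is the squared distance to an affine combination of points in
  the Hilbert space picture; hence the integral of exp(- f) against \<theta> vanishes for all these f.
  Such f may be chosen separately for each block, so the blocks can be treated one at a time.
  For the squared distance on the real line, Fourier inversion of the Gaussians gives \<theta> = 0.
  For a metric of strong negative type, differentiating along f + h (\<rho>(u,-) - \<rho>(z,-)) at h = 0 shows
  that the potentials of the positive and the negative part, weighted by exp(- \<rho>(z,-)), differ by
  a constant, so their energy distance vanishes.
\<close>

section \<open>Positive definite kernels\<close>

text \<open>The energy distance of a sum of block distances sees only the laws of the single blocks,
  and squared Euclidean distance sees only means. Passing to \<open>exp (- \<rho>)\<close> turns
  sums over blocks into products, whose factors can be peeled off one at a time. The two cases meet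
  in one interface, \<open>admissible\<close>.

  The obstacle is integrability. Only the first moments of K and of L separately are finite, so E
  K(X,X') L(Y,Y') may be infinite, and a Bochner integral then silently has the value 0. Therefore
  energies live in \<open>ennreal\<close> and inequalities between them are stated additively.
  Signed quantities are expanded only at fixed scales u, v, where the Gaussian kernels are bounded
  by 1. As law(X,Y) and the product law have the same marginals, everything but the joint Gaussian
  terms cancels there. That a vanishing covariance excludes infinite energies is a separate argument
  at the end.

  Positive definiteness is handled by finite quadratic forms and by averaging over random samples,
  in place of a Hilbert space embedding and its mean elements.\<close>

definition psd :: "'a set \<Rightarrow> ('a \<Rightarrow> 'a \<Rightarrow> real) \<Rightarrow> bool" where
  "psd S k \<longleftrightarrow> (\<forall>x\<in>S. \<forall>y\<in>S. k x y = k y x) \<and>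
     (\<forall>(n::nat) x b. (\<forall>i<n. x i \<in> S) \<longrightarrow> 0 \<le> (\<Sum>i<n. \<Sum>j<n. b i * b j * k (x i) (x j)))"

lemma psdD:
  fixes n :: nat
  assumes "psd S k" "\<And>i. i < n \<Longrightarrow> x i \<in> S"
  shows "0 \<le> (\<Sum>i<n. \<Sum>j<n. b i * b j * k (x i) (x j))"
  using assms unfolding psd_def by blast

lemma psd_sym: "psd S k \<Longrightarrow> x \<in> S \<Longrightarrow> y \<in> S \<Longrightarrow> k x y = k y x"
  by (auto simp: psd_def)

lemma psd_cong:
  assumes "\<And>x y. x \<in> S \<Longrightarrow> y \<in> S \<Longrightarrow> k x y = k' x y"
  shows "psd S k \<longleftrightarrow> psd S k'"
proof -
  have "(\<Sum>i<n. \<Sum>j<n. b i * b j * k (x i) (x j)) = (\<Sum>i<n. \<Sum>j<n. b i * b j * k' (x i) (x j))"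
    if "\<forall>i<n. x i \<in> S" for n :: nat and x b
    using that assms by (intro sum.cong refl) simp
  then show ?thesis using assms unfolding psd_def by (auto cong: conj_cong)
qed

lemma psd_add:
  assumes "psd S k" "psd S l"
  shows "psd S (\<lambda>x y. k x y + l x y)"
  using assms unfolding psd_def
  by (auto simp: distrib_left sum.distrib intro!: add_nonneg_nonneg)

lemma psd_scale:
  assumes "psd S k" "0 \<le> c"
  shows "psd S (\<lambda>x y. c * k x y)"
proof -
  have "(\<Sum>i<n. \<Sum>j<n. b i * b j * (c * k (x i) (x j))) = c * (\<Sum>i<n. \<Sum>j<n. b i * b j * k (x i) (x j))"
    for n :: nat and x b
    by (simp add: sum_distrib_left mult_ac)
  then show ?thesis using assms unfolding psd_def by auto
qed

lemma psd_zero: "psd S (\<lambda>x y. 0)"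
  by (auto simp: psd_def)

lemma psd_sum:
  assumes "\<And>i. i \<in> I \<Longrightarrow> psd S (k i)"
  shows "psd S (\<lambda>x y. \<Sum>i\<in>I. k i x y)"
proof (cases "finite I")
  case True
  then show ?thesis using assms
    by (induction I) (auto intro: psd_zero psd_add)
qed (auto intro: psd_zero)

lemma psd_vimage:
  assumes "psd T k" "\<And>x. x \<in> S \<Longrightarrow> h x \<in> T"
  shows "psd S (\<lambda>x y. k (h x) (h y))"
  unfolding psd_def
proof (intro conjI ballI allI impI)
  fix n :: nat and x and b :: "nat \<Rightarrow> real" assume "\<forall>i<n. x i \<in> S"
  then show "0 \<le> (\<Sum>i<n. \<Sum>j<n. b i * b j * k (h (x i)) (h (x j)))"
    using assms(2) by (intro psdD[OF assms(1), of n "\<lambda>i. h (x i)"]) auto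
qed (intro psd_sym[OF assms(1)] assms(2))

lemma psd_congruence:
  assumes "psd S k"
  shows "psd S (\<lambda>x y. g x * g y * k x y)"
  unfolding psd_def
proof (intro conjI ballI allI impI)
  fix x y assume "x \<in> S" "y \<in> S"
  then show "g x * g y * k x y = g y * g x * k y x"
    using psd_sym[OF assms] by simp
next
  fix n :: nat and x and b :: "nat \<Rightarrow> real" assume "\<forall>i<n. x i \<in> S"
  then show "0 \<le> (\<Sum>i<n. \<Sum>j<n. b i * b j * (g (x i) * g (x j) * k (x i) (x j)))"
    using psdD[OF assms, of n x "\<lambda>i. b i * g (x i)"] by (simp add: mult_ac)
qed

text \<open>Gaussian elimination on \<open>A\<close> instead of a spectral decomposition. If the
  pivot \<open>A m m\<close> is zero, positivity forces its whole row to vanish. Otherwise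
  \<open>A\<close> is the rank one matrix \<open>A m i * A m j / A m m\<close> plus a Schur
  complement living on \<open>J\<close>; the rank one part contributes the form of \<open>B\<close>
  at the vector \<open>A m\<close>, the complement is covered by induction.\<close>

lemma schur_product_matrix:
  fixes A B :: "'i \<Rightarrow> 'i \<Rightarrow> real"
  assumes "finite I"
    and "\<And>i j. i \<in> I \<Longrightarrow> j \<in> I \<Longrightarrow> A i j = A j i"
    and "\<And>b. 0 \<le> (\<Sum>i\<in>I. \<Sum>j\<in>I. b i * b j * A i j)"
    and "\<And>b. 0 \<le> (\<Sum>i\<in>I. \<Sum>j\<in>I. b i * b j * B i j)"
  shows "0 \<le> (\<Sum>i\<in>I. \<Sum>j\<in>I. A i j * B i j)"
  using assms
proof (induction I arbitrary: A rule: finite_induct)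
  case empty
  then show ?case by simp
next
  case (insert m J)
  have split: "(\<Sum>i\<in>insert m J. \<Sum>j\<in>insert m J. F i j)
      = F m m + (\<Sum>j\<in>J. F m j) + (\<Sum>j\<in>J. F j m) + (\<Sum>i\<in>J. \<Sum>j\<in>J. F i j)"
    for F :: "'i \<Rightarrow> 'i \<Rightarrow> real"
    using insert.hyps by (simp add: sum.distrib)
  have sym: "A j m = A m j" if "j \<in> J" for j
    using insert.prems(1) that by auto
  \<comment> \<open>The form of \<open>A\<close> at the vector with entry \<open>c\<close> at
    \<open>m\<close> and entries \<open>b\<close> on \<open>J\<close>. The free \<open>c\<close>
    serves both cases below.\<close>
  have quad: "0 \<le> c * c * A m m + 2 * c * (\<Sum>j\<in>J. b j * A m j) + (\<Sum>i\<in>J. \<Sum>j\<in>J. b i * b j * A i j)"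
    for c b
  proof -
    have "(\<Sum>j\<in>J. (b(m := c)) m * (b(m := c)) j * A m j) = c * (\<Sum>j\<in>J. b j * A m j)"
      using insert.hyps by (auto simp: sum_distrib_left mult_ac intro!: sum.cong)
    moreover have "(\<Sum>j\<in>J. (b(m := c)) j * (b(m := c)) m * A j m) = c * (\<Sum>j\<in>J. b j * A m j)"
      using insert.hyps sym by (auto simp: sum_distrib_left mult_ac intro!: sum.cong)
    moreover have "(\<Sum>i\<in>J. \<Sum>j\<in>J. (b(m := c)) i * (b(m := c)) j * A i j)
        = (\<Sum>i\<in>J. \<Sum>j\<in>J. b i * b j * A i j)"
      using insert.hyps by (intro sum.cong refl) auto
    ultimately show ?thesis
      using insert.prems(2)[of "b(m := c)"] unfolding split by simp
  qed
  have BJ: "0 \<le> (\<Sum>i\<in>J. \<Sum>j\<in>J. b i * b j * B i j)" for b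
  proof -
    have e: "(\<Sum>j\<in>J. (b(m := 0)) j * u j) = (\<Sum>j\<in>J. b j * u j)" for u
      using insert.hyps by (intro sum.cong refl) auto
    have "(\<Sum>i\<in>J. \<Sum>j\<in>J. (b(m := 0)) i * (b(m := 0)) j * B i j) = (\<Sum>i\<in>J. \<Sum>j\<in>J. b i * b j * B i j)"
      using insert.hyps by (intro sum.cong refl) auto
    then show ?thesis
      using insert.prems(3)[of "b(m := 0)"] unfolding split by simp
  qed
  show ?case
  proof (cases "A m m = 0")
    case True
    have row: "A m j = 0" if "j \<in> J" for j
    proof -
      have *: "(\<Sum>k\<in>J. (if k = j then 1 else 0) * A m k) = A m j"
        using that insert.hyps by (simp add: if_distrib[of "\<lambda>x. x * _"] cong: if_cong)
      have "(\<Sum>i\<in>J. \<Sum>k\<in>J. (if i = j then 1 else 0) * (if k = j then 1 else 0) * A i k)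
          = (\<Sum>i\<in>J. if i = j then A j j else 0)"
        using that insert.hyps by (intro sum.cong refl) (auto simp: if_distrib[of "\<lambda>x. x * _"] cong: if_cong)
      also have "\<dots> = A j j" using that insert.hyps by simp
      finally have "0 \<le> 2 * c * A m j + A j j" for c
        using quad[of c "\<lambda>k. if k = j then 1 else 0"] * True by simp
      \<comment> \<open>For \<open>A m j\<close> nonzero this \<open>c\<close> makes the right-hand
        side equal to -1.\<close>
      from this[of "- (A j j + 1) / (2 * A m j)"] show ?thesis
        by (cases "A m j = 0") (auto simp: field_simps)
    qed
    have "0 \<le> (\<Sum>i\<in>J. \<Sum>j\<in>J. A i j * B i j)"
    proof (rule insert.IH)
      show "0 \<le> (\<Sum>i\<in>J. \<Sum>j\<in>J. b i * b j * A i j)" for b using quad[of 0 b] by simp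
    qed (use insert.prems BJ in auto)
    then show ?thesis unfolding split using True row sym by simp
  next
    case False
    then have pos: "0 < A m m" using quad[of 1 "\<lambda>_. 0"] by simp
    define A' where "A' i j = A i j - A m i * A m j / A m m" for i j
    have "0 \<le> (\<Sum>i\<in>J. \<Sum>j\<in>J. A' i j * B i j)"
    proof (rule insert.IH)
      show "A' i j = A' j i" if "i \<in> J" "j \<in> J" for i j
        using that insert.prems(1)[of i j] by (simp add: A'_def mult.commute)
      show "0 \<le> (\<Sum>i\<in>J. \<Sum>j\<in>J. b i * b j * A' i j)" for b
      proof -
        define s where "s = (\<Sum>j\<in>J. b j * A m j)"
        have "(\<Sum>i\<in>J. \<Sum>j\<in>J. b i * b j * A' i j) = (\<Sum>i\<in>J. \<Sum>j\<in>J. b i * b j * A i j) - s * s / A m m"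
          unfolding A'_def s_def
          by (simp add: sum_product sum_divide_distrib right_diff_distrib sum_subtractf mult_ac)
        \<comment> \<open>The value \<open>c = - s / A m m\<close> minimises the quadratic
          polynomial in \<open>c\<close> given by \<open>quad\<close>, and the minimum is exactly
          this expression.\<close>
        also have "\<dots> \<ge> 0"
          using quad[of "- s / A m m" b] pos by (simp add: s_def[symmetric] field_simps)
        finally show ?thesis .
      qed
    qed (use BJ in auto)
    moreover have "0 \<le> (\<Sum>i\<in>insert m J. \<Sum>j\<in>insert m J. A m i * A m j * B i j) / A m m"
      using insert.prems(3)[of "A m"] pos by simp
    moreover have "(\<Sum>i\<in>insert m J. \<Sum>j\<in>insert m J. A i j * B i j)
        = (\<Sum>i\<in>insert m J. \<Sum>j\<in>insert m J. A m i * A m j * B i j) / A m m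
          + (\<Sum>i\<in>J. \<Sum>j\<in>J. A' i j * B i j)"
      unfolding split A'_def using pos sym
      by (simp add: add_divide_distrib sum_divide_distrib sum_subtractf left_diff_distrib algebra_simps)
    ultimately show ?thesis by simp
  qed
qed

lemma psd_mult:
  assumes "psd S k" "psd S l"
  shows "psd S (\<lambda>x y. k x y * l x y)"
  unfolding psd_def
proof (intro conjI ballI allI impI)
  fix x y assume "x \<in> S" "y \<in> S"
  then show "k x y * l x y = k y x * l y x"
    using psd_sym[OF assms(1)] psd_sym[OF assms(2)] by simp
next
  fix n :: nat and x and b :: "nat \<Rightarrow> real" assume S: "\<forall>i<n. x i \<in> S"
  \<comment> \<open>\<open>schur_product_matrix\<close> has no coefficients in its conclusion, so
    they are absorbed into the first factor.\<close>
  have "0 \<le> (\<Sum>i<n. \<Sum>j<n. (b i * b j * k (x i) (x j)) * l (x i) (x j))"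
  proof (rule schur_product_matrix)
    show "0 \<le> (\<Sum>i<n. \<Sum>j<n. c i * c j * (b i * b j * k (x i) (x j)))" for c
      using psdD[OF assms(1), of n x "\<lambda>i. c i * b i"] S by (simp add: mult_ac)
    show "b i * b j * k (x i) (x j) = b j * b i * k (x j) (x i)" if "i \<in> {..<n}" "j \<in> {..<n}" for i j
      using psd_sym[OF assms(1)] S that by simp
  qed (use psdD[OF assms(2)] S in auto)
  then show "0 \<le> (\<Sum>i<n. \<Sum>j<n. b i * b j * (k (x i) (x j) * l (x i) (x j)))"
    by (simp add: mult_ac)
qed

text \<open>The power series of exp without its constant term: powers are positive definite by
  Schur, the coefficients are positive, and the property passes to pointwise limits. Dropping the
  constant term is what later leaves room to subtract a rank one kernel.\<close>

lemma psd_exp_minus_one: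
  assumes "psd S k"
  shows "psd S (\<lambda>x y. exp (k x y) - 1)"
proof -
  have pow: "psd S (\<lambda>x y. k x y ^ Suc m)" for m
    by (induction m) (use assms psd_mult[OF assms] in auto)
  define T where "T N = (\<lambda>x y. \<Sum>m<N. k x y ^ Suc m /\<^sub>R fact (Suc m))" for N
  have psdT: "psd S (T N)" for N
    unfolding T_def using psd_scale[OF pow] by (intro psd_sum) simp
  have lim: "(\<lambda>N. T N x y) \<longlonglongrightarrow> exp (k x y) - 1" for x y
  proof -
    have "(\<lambda>m. k x y ^ m /\<^sub>R fact m) sums exp (k x y)"
      by (rule exp_converges)
    then have "(\<lambda>m. k x y ^ Suc m /\<^sub>R fact (Suc m)) sums (exp (k x y) - 1)"
      by (subst sums_Suc_iff) simp
    then show ?thesis by (simp add: sums_def T_def)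
  qed
  show ?thesis unfolding psd_def
  proof (intro conjI ballI allI impI)
    fix x y assume "x \<in> S" "y \<in> S"
    then show "exp (k x y) - 1 = exp (k y x) - 1" using psd_sym[OF assms] by simp
  next
    fix n :: nat and x and b :: "nat \<Rightarrow> real" assume "\<forall>i<n. x i \<in> S"
    then have "0 \<le> (\<Sum>i<n. \<Sum>j<n. b i * b j * T N (x i) (x j))" for N
      by (intro psdD[OF psdT]) auto
    moreover have "(\<lambda>N. \<Sum>i<n. \<Sum>j<n. b i * b j * T N (x i) (x j))
        \<longlonglongrightarrow> (\<Sum>i<n. \<Sum>j<n. b i * b j * (exp (k (x i) (x j)) - 1))"
      by (intro tendsto_sum tendsto_mult tendsto_const lim)
    ultimately show "0 \<le> (\<Sum>i<n. \<Sum>j<n. b i * b j * (exp (k (x i) (x j)) - 1))"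
      by (intro LIMSEQ_le_const) auto
  qed
qed

text \<open>
  If R x y = |x - y|^2 in a Hilbert space, then f(x) = |x - a|^2 + const satisfies this
  for every point a: the kernel is the Gram kernel of the vectors x - a.
\<close>

definition centre :: "'a set \<Rightarrow> ('a \<Rightarrow> 'a \<Rightarrow> real) \<Rightarrow> ('a \<Rightarrow> real) \<Rightarrow> bool" where
  "centre S R f \<longleftrightarrow> (\<exists>\<kappa>. psd S (\<lambda>x y. f x + f y - \<kappa> - R x y))"

text \<open>With G the Gram kernel of the hypothesis, \<open>exp (- R x y)\<close> is
  \<open>exp (\<kappa> / 2 - f x) * exp (\<kappa> / 2 - f y) * exp G\<close>. The constant term 1 of
  \<open>exp G\<close> accounts for precisely the rank one kernel that is subtracted.\<close>

lemma centre_exp_psd: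
  assumes "psd S (\<lambda>x y. f x + f y - \<kappa> - R x y)"
  shows "psd S (\<lambda>x y. exp (- R x y) - exp \<kappa> * (exp (- f x) * exp (- f y)))"
proof -
  have eq: "exp (- R x y) - exp \<kappa> * (exp (- f x) * exp (- f y))
      = exp (\<kappa> / 2 - f x) * exp (\<kappa> / 2 - f y) * (exp (f x + f y - \<kappa> - R x y) - 1)" for x y
    unfolding right_diff_distrib mult_exp_exp by (simp add: algebra_simps)
  show ?thesis unfolding eq by (intro psd_congruence psd_exp_minus_one assms)
qed

text \<open>The form at a single point gives \<open>2 * f x - \<kappa> \<ge> 0\<close>. Hence
  \<open>exp (- f)\<close> is bounded and integrable for every finite measure, even if
  \<open>f\<close> is unbounded above.\<close>

lemma centre_lower_bound:
  assumes "centre S R f" "\<And>x. x \<in> S \<Longrightarrow> R x x = 0"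
  obtains c where "\<And>x. x \<in> S \<Longrightarrow> c \<le> f x"
proof -
  from assms(1) obtain \<kappa> where \<kappa>: "psd S (\<lambda>x y. f x + f y - \<kappa> - R x y)"
    by (auto simp: centre_def)
  have "\<kappa> / 2 \<le> f x" if "x \<in> S" for x
    using psdD[OF \<kappa>, of "Suc 0" "\<lambda>_. x" "\<lambda>_. 1"] that assms(2) by (simp add: lessThan_Suc)
  then show ?thesis using that by blast
qed

lemma centre_cong:
  assumes "\<And>x y. x \<in> S \<Longrightarrow> y \<in> S \<Longrightarrow> R x y = R' x y"
  shows "centre S R f \<longleftrightarrow> centre S R' f"
  unfolding centre_def using assms by (intro ex_cong1 psd_cong) simp

text \<open>Orthogonal sum of the Hilbert spaces of the blocks: squared distances and the constants
  \<open>\<kappa>\<close> add up, so a centre may be chosen in each block independently.\<close>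

lemma centre_sum:
  assumes "\<And>i. i \<in> I \<Longrightarrow> centre (T i) (R i) (f i)" "\<And>i x. i \<in> I \<Longrightarrow> x \<in> S \<Longrightarrow> h i x \<in> T i"
  shows "centre S (\<lambda>x y. \<Sum>i\<in>I. R i (h i x) (h i y)) (\<lambda>x. \<Sum>i\<in>I. f i (h i x))"
proof -
  have "\<forall>i\<in>I. \<exists>k. psd (T i) (\<lambda>x y. f i x + f i y - k - R i x y)"
    using assms(1) unfolding centre_def by (rule ballI)
  from bchoice[OF this] obtain \<kappa>
    where \<kappa>: "\<forall>i\<in>I. psd (T i) (\<lambda>x y. f i x + f i y - \<kappa> i - R i x y)"
    by (rule exE)
  have "psd S (\<lambda>x y. \<Sum>i\<in>I. f i (h i x) + f i (h i y) - \<kappa> i - R i (h i x) (h i y))"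
  proof (rule psd_sum)
    fix i assume i: "i \<in> I"
    show "psd S (\<lambda>x y. f i (h i x) + f i (h i y) - \<kappa> i - R i (h i x) (h i y))"
      using psd_vimage[OF bspec[OF \<kappa> i], of S "h i"] assms(2)[OF i] by simp
  qed
  then have "psd S (\<lambda>x y. (\<Sum>i\<in>I. f i (h i x)) + (\<Sum>i\<in>I. f i (h i y)) - (\<Sum>i\<in>I. \<kappa> i)
      - (\<Sum>i\<in>I. R i (h i x) (h i y)))"
    by (simp add: sum.distrib sum_subtractf)
  then show ?thesis unfolding centre_def by (rule exI)
qed

lemma centre_add:
  assumes "centre S R f" "centre T R' g"
  shows "centre (S \<times> T) (\<lambda>x y. R (fst x) (fst y) + R' (snd x) (snd y)) (\<lambda>x. f (fst x) + g (snd x))"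
proof -
  from assms(1) obtain \<kappa> where \<kappa>: "psd S (\<lambda>x y. f x + f y - \<kappa> - R x y)"
    unfolding centre_def by (rule exE)
  from assms(2) obtain \<kappa>' where \<kappa>': "psd T (\<lambda>x y. g x + g y - \<kappa>' - R' x y)"
    unfolding centre_def by (rule exE)
  have "psd (S \<times> T) (\<lambda>x y. (f (fst x) + f (fst y) - \<kappa> - R (fst x) (fst y))
      + (g (snd x) + g (snd y) - \<kappa>' - R' (snd x) (snd y)))"
    by (rule psd_add[OF psd_vimage[OF \<kappa>, where h = fst] psd_vimage[OF \<kappa>', where h = snd]]) auto
  moreover have "(f (fst x) + f (fst y) - \<kappa> - R (fst x) (fst y))
      + (g (snd x) + g (snd y) - \<kappa>' - R' (snd x) (snd y))
      = (f (fst x) + g (snd x)) + (f (fst y) + g (snd y)) - (\<kappa> + \<kappa>')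
      - (R (fst x) (fst y) + R' (snd x) (snd y))" for x y
    by linarith
  ultimately show ?thesis unfolding centre_def by (intro exI[of _ "\<kappa> + \<kappa>'"]) (simp only:)
qed

lemma centre_scale:
  assumes "centre S R f" "0 \<le> t"
  shows "centre S (\<lambda>x y. t * R x y) (\<lambda>x. t * f x)"
proof -
  from assms(1) obtain \<kappa> where \<kappa>: "psd S (\<lambda>x y. f x + f y - \<kappa> - R x y)"
    unfolding centre_def by (rule exE)
  have "psd S (\<lambda>x y. t * f x + t * f y - t * \<kappa> - t * R x y)"
    using psd_scale[OF \<kappa> assms(2)] by (simp add: distrib_left right_diff_distrib)
  then show ?thesis unfolding centre_def by (rule exI)
qed

text \<open>The affine combination of points with weights 1, h, -h at o', u, v.\<close>

lemma negative_type_centre: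
  assumes nt: "negative_type S \<rho>" and sym: "\<And>x y. x \<in> S \<Longrightarrow> y \<in> S \<Longrightarrow> \<rho> x y = \<rho> y x"
    and zero: "\<And>x. x \<in> S \<Longrightarrow> \<rho> x x = 0"
    and mem: "o' \<in> S" "u \<in> S" "v \<in> S"
  shows "centre S \<rho> (\<lambda>x. \<rho> o' x + h * (\<rho> u x - \<rho> v x))"
proof -
  define f where "f x = \<rho> o' x + h * (\<rho> u x - \<rho> v x)" for x
  \<comment> \<open>In the Hilbert space picture, with a the affine combination, \<open>f x\<close>
    is |x - a|^2 plus a constant and \<open>\<kappa>\<close> is twice that constant. It equals the
    double sum of w w' \<open>\<rho>\<close> over the points \<open>o'\<close>, \<open>u\<close>,
    \<open>v\<close> with weights 1, \<open>h\<close>, \<open>-h\<close>.\<close>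
  define \<kappa> where "\<kappa> = 2 * h * (\<rho> o' u - \<rho> o' v) - 2 * h * h * \<rho> u v"
  have "psd S (\<lambda>x y. f x + f y - \<kappa> - \<rho> x y)"
    unfolding psd_def
  proof (intro conjI ballI allI impI)
    fix x y assume "x \<in> S" "y \<in> S"
    then show "f x + f y - \<kappa> - \<rho> x y = f y + f x - \<kappa> - \<rho> y x" using sym by simp
  next
    fix n :: nat and x and b :: "nat \<Rightarrow> real" assume S: "\<forall>i<n. x i \<in> S"
    define s where "s = (\<Sum>i<n. b i)"
    define x' where "x' i = (if i < n then x i else if i = n then o' else if i = Suc n then u else v)" for i
    \<comment> \<open>Negative type needs coefficients of sum zero. The three points of the affine
      combination are appended with its weights times \<open>- s\<close>, which compensates the
      total weight \<open>s\<close> of \<open>b\<close>.\<close>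
    define b' where "b' i = (if i < n then b i else if i = n then - s
       else if i = Suc n then - (h * s) else h * s)" for i
    have x'S: "\<forall>i<Suc (Suc (Suc n)). x' i \<in> S" using S mem by (auto simp: x'_def)
    have low: "(\<Sum>i<n. G (x' i) (b' i)) = (\<Sum>i<n. G (x i) (b i))" for G :: "'a \<Rightarrow> real \<Rightarrow> real"
      by (intro sum.cong) (auto simp: x'_def b'_def)
    have top: "x' n = o'" "x' (Suc n) = u" "x' (Suc (Suc n)) = v"
      "b' n = - s" "b' (Suc n) = - (h * s)" "b' (Suc (Suc n)) = h * s"
      by (auto simp: x'_def b'_def)
    have F: "(\<Sum>i<n. b i * \<rho> (x i) z) = (\<Sum>i<n. b i * \<rho> z (x i))" if "z \<in> S" for z
      using S sym that by (intro sum.cong) auto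
    define D where "D = (\<Sum>i<n. \<Sum>j<n. b i * b j * \<rho> (x i) (x j))"
    define Q where "Q z = (\<Sum>i<n. b i * \<rho> z (x i))" for z
    define W where "W z = (\<Sum>j<n. b j * \<rho> z (x j)) - s * \<rho> z o' - h * s * \<rho> z u + h * s * \<rho> z v" for z
    have inner: "(\<Sum>j<Suc (Suc (Suc n)). b' j * \<rho> z (x' j)) = W z" for z
      using low[of "\<lambda>x b. b * \<rho> z x"] top by (simp add: W_def)
    have "(\<Sum>i<Suc (Suc (Suc n)). b' i) = 0"
      using low[of "\<lambda>_ y. y"] top by (simp add: s_def)
    then have "(\<Sum>i<Suc (Suc (Suc n)). \<Sum>j<Suc (Suc (Suc n)). b' i * b' j * \<rho> (x' i) (x' j)) \<le> 0"
      using nt x'S unfolding negative_type_def by blast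
    also have "(\<Sum>i<Suc (Suc (Suc n)). \<Sum>j<Suc (Suc (Suc n)). b' i * b' j * \<rho> (x' i) (x' j))
        = (\<Sum>i<Suc (Suc (Suc n)). b' i * W (x' i))"
      by (simp only: mult.assoc sum_distrib_left[symmetric] inner)
    also have "\<dots> = (\<Sum>i<n. b i * W (x i)) - s * W o' - h * s * W u + h * s * W v"
      using low[of "\<lambda>x b. b * W x"] top by simp
    also have "(\<Sum>i<n. b i * W (x i)) = (\<Sum>i<n. b i * (\<Sum>j<n. b j * \<rho> (x i) (x j)))
        - s * (\<Sum>i<n. b i * \<rho> (x i) o') - h * s * (\<Sum>i<n. b i * \<rho> (x i) u)
        + h * s * (\<Sum>i<n. b i * \<rho> (x i) v)"
      unfolding W_def
      by (simp add: distrib_left right_diff_distrib sum.distrib sum_subtractf sum_distrib_left mult_ac)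
    also have "\<dots> = D - s * Q o' - h * s * Q u + h * s * Q v"
      unfolding Q_def D_def F[OF mem(1)] F[OF mem(2)] F[OF mem(3)]
      by (simp only: sum_distrib_left mult.assoc)
    also have "W o' = Q o' - h * s * \<rho> o' u + h * s * \<rho> o' v"
      using zero mem by (simp add: W_def Q_def)
    also have "W u = Q u - s * \<rho> o' u + h * s * \<rho> u v"
      using zero mem sym[OF mem(1,2)] by (simp add: W_def Q_def)
    also have "W v = Q v - s * \<rho> o' v - h * s * \<rho> u v"
      using zero mem sym[OF mem(1,3)] sym[OF mem(2,3)] by (simp add: W_def Q_def)
    also have "D - s * Q o' - h * s * Q u + h * s * Q v
        - s * (Q o' - h * s * \<rho> o' u + h * s * \<rho> o' v)
        - h * s * (Q u - s * \<rho> o' u + h * s * \<rho> u v)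
        + h * s * (Q v - s * \<rho> o' v - h * s * \<rho> u v)
        = D - 2 * s * (Q o' + h * (Q u - Q v)) + s * s * \<kappa>"
      unfolding \<kappa>_def by algebra
    finally have neg: "D - 2 * s * (Q o' + h * (Q u - Q v)) + s * s * \<kappa> \<le> 0" .
    have L: "(\<Sum>i<n. b i * f (x i)) = Q o' + h * (Q u - Q v)"
      by (simp add: f_def Q_def algebra_simps sum.distrib sum_subtractf sum_distrib_left)
    have "(\<Sum>i<n. \<Sum>j<n. b i * b j * (f (x i) + f (x j) - \<kappa> - \<rho> (x i) (x j)))
        = (\<Sum>i<n. b i * f (x i)) * s + s * (\<Sum>j<n. b j * f (x j)) - s * s * \<kappa> - D"
      unfolding s_def D_def sum_product
      by (simp add: algebra_simps sum.distrib sum_subtractf sum_distrib_left)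
    then show "0 \<le> (\<Sum>i<n. \<Sum>j<n. b i * b j * (f (x i) + f (x j) - \<kappa> - \<rho> (x i) (x j)))"
      using neg by (simp add: L mult_ac)
  qed
  then show ?thesis unfolding centre_def f_def by (rule exI)
qed

section \<open>Gaussians that determine measures\<close>

text \<open>Finite measures rather than probability measures, because weighting by the factors of
  other blocks and projecting to one block produces measures of uncontrolled mass. Measurability of
  \<open>f\<close> is demanded separately, as \<open>centre\<close> is a purely algebraic
  condition.\<close>

definition gauss_determining :: "'a measure \<Rightarrow> ('a \<Rightarrow> 'a \<Rightarrow> real) \<Rightarrow> bool" where
  "gauss_determining B R \<longleftrightarrow> (\<forall>\<mu> \<nu>. sets \<mu> = sets B \<longrightarrow> sets \<nu> = sets B \<longrightarrow>
     finite_measure \<mu> \<longrightarrow> finite_measure \<nu> \<longrightarrow>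
     (\<forall>f\<in>borel_measurable B. centre (space B) R f \<longrightarrow>
        (\<integral>\<^sup>+x. ennreal (exp (- f x)) \<partial>\<mu>) = (\<integral>\<^sup>+x. ennreal (exp (- f x)) \<partial>\<nu>)) \<longrightarrow>
     \<mu> = \<nu>)"

lemma gauss_determining_cong:
  assumes "\<And>x y. x \<in> space B \<Longrightarrow> y \<in> space B \<Longrightarrow> R x y = R' x y"
  shows "gauss_determining B R \<longleftrightarrow> gauss_determining B R'"
proof -
  have "centre (space B) R f \<longleftrightarrow> centre (space B) R' f" for f
    using assms by (rule centre_cong)
  then show ?thesis unfolding gauss_determining_def by simp
qed

lemma gauss_determiningD:
  assumes "gauss_determining B R" "sets \<mu> = sets B" "sets \<nu> = sets B" "finite_measure \<mu>" "finite_measure \<nu>"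
    and "\<And>f. f \<in> borel_measurable B \<Longrightarrow> centre (space B) R f \<Longrightarrow>
        (\<integral>\<^sup>+x. ennreal (exp (- f x)) \<partial>\<mu>) = (\<integral>\<^sup>+x. ennreal (exp (- f x)) \<partial>\<nu>)"
  shows "\<mu> = \<nu>"
  using assms unfolding gauss_determining_def by blast

text \<open>The exchange step of the block by block reduction. The bounded \<open>\<phi>\<close>
  collects the factors of the other coordinates; the measures weighted by \<open>\<phi>\<close> and
  pushed forward under \<open>h\<close> agree on all exponentials, hence coincide, and the
  exponential may be replaced by an indicator.\<close>

lemma gauss_determining_transfer:
  fixes \<phi> :: "'z \<Rightarrow> ennreal"
  assumes det: "gauss_determining B R" and h: "h \<in> measurable Z B"
    and Z: "sets \<mu> = sets Z" "sets \<nu> = sets Z" and fin: "finite_measure \<mu>" "finite_measure \<nu>"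
    and \<phi>: "\<phi> \<in> borel_measurable Z" "\<And>z. z \<in> space Z \<Longrightarrow> \<phi> z \<le> c" "c < \<infinity>"
    and eq: "\<And>f. f \<in> borel_measurable B \<Longrightarrow> centre (space B) R f \<Longrightarrow>
        (\<integral>\<^sup>+z. \<phi> z * ennreal (exp (- f (h z))) \<partial>\<mu>) = (\<integral>\<^sup>+z. \<phi> z * ennreal (exp (- f (h z))) \<partial>\<nu>)"
    and A: "A \<in> sets B"
  shows "(\<integral>\<^sup>+z. \<phi> z * indicator A (h z) \<partial>\<mu>) = (\<integral>\<^sup>+z. \<phi> z * indicator A (h z) \<partial>\<nu>)"
proof -
  define push where "push m = distr (density m \<phi>) B h" for m
  have nn: "(\<integral>\<^sup>+x. G x \<partial>push m) = (\<integral>\<^sup>+z. \<phi> z * G (h z) \<partial>m)"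
    if "sets m = sets Z" "G \<in> borel_measurable B" for m G
  proof -
    have [measurable]: "\<phi> \<in> borel_measurable m" "h \<in> measurable m B" "G \<in> borel_measurable B"
      using that \<phi>(1) h by (simp_all cong: measurable_cong_sets)
    show ?thesis unfolding push_def by (simp add: nn_integral_distr nn_integral_density)
  qed
  have fp: "finite_measure (push m)" if "sets m = sets Z" "finite_measure m" for m
  proof
    interpret finite_measure m by fact
    have "emeasure (push m) (space (push m)) = (\<integral>\<^sup>+x. 1 \<partial>push m)" by simp
    also have "\<dots> = (\<integral>\<^sup>+z. \<phi> z * 1 \<partial>m)" using that by (intro nn) auto
    also have "\<dots> \<le> (\<integral>\<^sup>+z. c \<partial>m)"
      using \<phi>(2) sets_eq_imp_space_eq[OF that(1)] by (intro nn_integral_mono) auto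
    also have "\<dots> < \<infinity>" using \<phi>(3) emeasure_finite by (auto simp: ennreal_mult_eq_top_iff less_top[symmetric])
    finally show "emeasure (push m) (space (push m)) \<noteq> \<infinity>" by simp
  qed
  have "push \<mu> = push \<nu>"
    by (rule gauss_determiningD[OF det]) (use Z fin eq in \<open>simp_all add: fp nn push_def[THEN arg_cong[where f = sets]]\<close>)
  then show ?thesis using nn[OF Z(1), of "indicator A"] nn[OF Z(2), of "indicator A"] A by simp
qed

lemma exp_minus_centre_bounded:
  assumes "centre (space B) R f" "\<And>x. x \<in> space B \<Longrightarrow> R x x = 0"
  obtains c :: ennreal where "c < \<infinity>" "\<And>x. x \<in> space B \<Longrightarrow> ennreal (exp (- f x)) \<le> c"
proof -
  obtain c where "\<And>x. x \<in> space B \<Longrightarrow> c \<le> f x"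
    using centre_lower_bound[OF assms] by blast
  then show ?thesis using that[of "ennreal (exp (- c))"] by (auto intro!: ennreal_leI)
qed

text \<open>A centre in each component gives a centre of the pair, so products of two exponentials
  are available as tests. One exchange replaces the first exponential by an indicator, a second one
  replaces the other; rectangles then determine the measure.\<close>

lemma gauss_determining_pair:
  assumes det: "gauss_determining B R" "gauss_determining C R'"
    and zero: "\<And>x. x \<in> space B \<Longrightarrow> R x x = 0" "\<And>x. x \<in> space C \<Longrightarrow> R' x x = 0"
  shows "gauss_determining (B \<Otimes>\<^sub>M C) (\<lambda>x y. R (fst x) (fst y) + R' (snd x) (snd y))"
  unfolding gauss_determining_def
proof (intro allI impI)
  fix \<mu> \<nu> assume S: "sets \<mu> = sets (B \<Otimes>\<^sub>M C)" "sets \<nu> = sets (B \<Otimes>\<^sub>M C)"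
    and fin: "finite_measure \<mu>" "finite_measure \<nu>"
    and eq: "\<forall>f\<in>borel_measurable (B \<Otimes>\<^sub>M C).
      centre (space (B \<Otimes>\<^sub>M C)) (\<lambda>x y. R (fst x) (fst y) + R' (snd x) (snd y)) f \<longrightarrow>
      (\<integral>\<^sup>+x. ennreal (exp (- f x)) \<partial>\<mu>) = (\<integral>\<^sup>+x. ennreal (exp (- f x)) \<partial>\<nu>)"
  have fg: "(\<integral>\<^sup>+z. ennreal (exp (- g (snd z))) * ennreal (exp (- f (fst z))) \<partial>\<mu>)
      = (\<integral>\<^sup>+z. ennreal (exp (- g (snd z))) * ennreal (exp (- f (fst z))) \<partial>\<nu>)"
    if [measurable]: "f \<in> borel_measurable B" "g \<in> borel_measurable C"
      and c: "centre (space B) R f" "centre (space C) R' g" for f g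
  proof -
    have "(\<integral>\<^sup>+z. ennreal (exp (- g (snd z) + - f (fst z))) \<partial>\<mu>)
        = (\<integral>\<^sup>+z. ennreal (exp (- g (snd z) + - f (fst z))) \<partial>\<nu>)"
      using eq[rule_format, of "\<lambda>z. f (fst z) + g (snd z)"] centre_add[OF c]
      by (simp add: space_pair_measure minus_diff_commute)
    then show ?thesis by (simp only: exp_add ennreal_mult'[OF exp_ge_zero])
  qed
  have Ag: "(\<integral>\<^sup>+z. ennreal (exp (- g (snd z))) * indicator A (fst z) \<partial>\<mu>)
      = (\<integral>\<^sup>+z. ennreal (exp (- g (snd z))) * indicator A (fst z) \<partial>\<nu>)"
    if g: "g \<in> borel_measurable C" "centre (space C) R' g" and A: "A \<in> sets B" for g A
  proof -
    obtain c where c: "c < \<infinity>" "\<And>x. x \<in> space C \<Longrightarrow> ennreal (exp (- g x)) \<le> c"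
      using exp_minus_centre_bounded[OF g(2) zero(2)] by blast
    show ?thesis
      by (rule gauss_determining_transfer[OF det(1) measurable_fst S fin, where c = c])
         (use g c A fg in \<open>auto simp: space_pair_measure\<close>)
  qed
  have AC: "emeasure \<mu> (A \<times> D) = emeasure \<nu> (A \<times> D)" if A: "A \<in> sets B" and D: "D \<in> sets C" for A D
  proof -
    have "(\<integral>\<^sup>+z. indicator A (fst z) * indicator D (snd z) \<partial>\<mu>)
        = (\<integral>\<^sup>+z. indicator A (fst z) * indicator D (snd z) \<partial>\<nu>)"
      by (rule gauss_determining_transfer[OF det(2) measurable_snd S fin, where c = 1])
         (use A D Ag in \<open>auto simp: mult.commute indicator_def\<close>)
    moreover have "(\<integral>\<^sup>+z. indicator A (fst z) * indicator D (snd z) \<partial>m) = emeasure m (A \<times> D)"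
      if "sets m = sets (B \<Otimes>\<^sub>M C)" for m
    proof -
      have "(\<lambda>z. indicator A (fst z) * indicator D (snd z) :: ennreal) = indicator (A \<times> D)"
        by (auto simp: indicator_def fun_eq_iff)
      then show ?thesis using A D that by simp
    qed
    ultimately show ?thesis using S by simp
  qed
  show "\<mu> = \<nu>"
  proof (rule measure_eqI_generator_eq[where A = "\<lambda>_. space B \<times> space C" and \<Omega> = "space B \<times> space C"])
    show "Int_stable {a \<times> b |a b. a \<in> sets B \<and> b \<in> sets C}" by (rule Int_stable_pair_measure_generator)
    show "{a \<times> b |a b. a \<in> sets B \<and> b \<in> sets C} \<subseteq> Pow (space B \<times> space C)"
      using sets.space_closed[of B] sets.space_closed[of C] by blast
    show "emeasure \<mu> X = emeasure \<nu> X" if "X \<in> {a \<times> b |a b. a \<in> sets B \<and> b \<in> sets C}" for X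
      using that AC by auto
    show "sets \<mu> = sigma_sets (space B \<times> space C) {a \<times> b |a b. a \<in> sets B \<and> b \<in> sets C}"
      "sets \<nu> = sigma_sets (space B \<times> space C) {a \<times> b |a b. a \<in> sets B \<and> b \<in> sets C}"
      using S by (simp_all add: sets_pair_measure)
    show "emeasure \<mu> (space B \<times> space C) \<noteq> \<infinity>"
      using finite_measure.emeasure_finite[OF fin(1)] by simp
  qed auto
qed

lemma prod_less_infinity:
  fixes c :: "'i \<Rightarrow> ennreal"
  assumes "\<And>i. i \<in> I \<Longrightarrow> c i < \<infinity>"
  shows "(\<Prod>i\<in>I. c i) < \<infinity>"
  using assms by (induction I rule: infinite_finite_induct) (auto simp: ennreal_mult_less_top)

text \<open>As for pairs, by induction over the set \<open>J\<close> of coordinates that already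
  carry indicators while the remaining ones still carry exponentials.\<close>

lemma gauss_determining_PiM:
  assumes I: "finite I" and det: "\<And>i. i \<in> I \<Longrightarrow> gauss_determining (B i) (R i)"
    and zero: "\<And>i x. i \<in> I \<Longrightarrow> x \<in> space (B i) \<Longrightarrow> R i x x = 0"
  shows "gauss_determining (PiM I B) (\<lambda>x y. \<Sum>i\<in>I. R i (x i) (y i))"
  unfolding gauss_determining_def
proof (intro allI impI)
  fix \<mu> \<nu> assume S: "sets \<mu> = sets (PiM I B)" "sets \<nu> = sets (PiM I B)"
    and fin: "finite_measure \<mu>" "finite_measure \<nu>"
    and eq: "\<forall>f\<in>borel_measurable (PiM I B).
      centre (space (PiM I B)) (\<lambda>x y. \<Sum>i\<in>I. R i (x i) (y i)) f \<longrightarrow>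
      (\<integral>\<^sup>+x. ennreal (exp (- f x)) \<partial>\<mu>) = (\<integral>\<^sup>+x. ennreal (exp (- f x)) \<partial>\<nu>)"
  define tst where "tst i = {(\<lambda>x. ennreal (exp (- f x))) |f. f \<in> borel_measurable (B i) \<and> centre (space (B i)) (R i) f}" for i
  define ind where "ind i = {indicator A :: 'b \<Rightarrow> ennreal |A. A \<in> sets (B i)}" for i
  have mb: "\<phi> \<in> borel_measurable (B i)" if "\<phi> \<in> ind i \<union> tst i" for \<phi> i
    using that by (auto simp: tst_def ind_def)
  have bd: "\<exists>c<\<infinity>. \<forall>x\<in>space (B i). \<phi> x \<le> c" if i: "i \<in> I" and "\<phi> \<in> ind i \<union> tst i" for \<phi> i
    using that(2)
  proof
    assume "\<phi> \<in> ind i"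
    then show ?thesis by (intro exI[of _ 1]) (auto simp: ind_def indicator_def)
  next
    assume "\<phi> \<in> tst i"
    then show ?thesis using exp_minus_centre_bounded[of "B i" "R i", OF _ zero[OF i]] unfolding tst_def
      by (smt (verit, ccfv_threshold) mem_Collect_eq)
  qed
  have main: "(\<integral>\<^sup>+x. (\<Prod>i\<in>I. \<phi> i (x i)) \<partial>\<mu>) = (\<integral>\<^sup>+x. (\<Prod>i\<in>I. \<phi> i (x i)) \<partial>\<nu>)"
    if "J \<subseteq> I" "\<And>i. i \<in> J \<Longrightarrow> \<phi> i \<in> ind i" "\<And>i. i \<in> I - J \<Longrightarrow> \<phi> i \<in> tst i" for J \<phi>
    using finite_subset[OF that(1) I] that
  proof (induction J arbitrary: \<phi> rule: finite_induct)
    \<comment> \<open>Only exponentials: their product is the exponential of a sum of centres,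
      itself a centre for the summed distance.\<close>
    case empty
    then have "\<forall>i\<in>I. \<exists>f. \<phi> i = (\<lambda>x. ennreal (exp (- f x))) \<and> f \<in> borel_measurable (B i) \<and> centre (space (B i)) (R i) f"
      unfolding tst_def by blast
    from bchoice[OF this] obtain f where f: "\<And>i. i \<in> I \<Longrightarrow> \<phi> i = (\<lambda>x. ennreal (exp (- f i x)))"
      "\<And>i. i \<in> I \<Longrightarrow> f i \<in> borel_measurable (B i)" "\<And>i. i \<in> I \<Longrightarrow> centre (space (B i)) (R i) (f i)"
      by blast
    have "(\<Prod>i\<in>I. \<phi> i (x i)) = ennreal (exp (- (\<Sum>i\<in>I. f i (x i))))" for x
      using I by (simp add: f prod_ennreal exp_sum flip: sum_negf)
    moreover have "(\<lambda>x. \<Sum>i\<in>I. f i (x i)) \<in> borel_measurable (PiM I B)"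
      using f(2) by (intro borel_measurable_sum measurable_compose[OF measurable_component_singleton]) auto
    moreover have "centre (space (PiM I B)) (\<lambda>x y. \<Sum>i\<in>I. R i (x i) (y i)) (\<lambda>x. \<Sum>i\<in>I. f i (x i))"
      by (rule centre_sum[where h = "\<lambda>i x. x i" and T = "\<lambda>i. space (B i)"])
         (use f(3) in \<open>auto simp: space_PiM\<close>)
    ultimately show ?case using eq by simp
  next
    case (insert j J)
    then have j: "j \<in> I" "\<phi> j \<in> ind j" by auto
    then obtain A where A: "\<phi> j = indicator A" "A \<in> sets (B j)" by (auto simp: ind_def)
    have in_union: "\<phi> i \<in> ind i \<union> tst i" if "i \<in> I - {j}" for i
      using that insert.prems(2)[of i] insert.prems(3)[of i] by blast
    then have "\<forall>i\<in>I - {j}. \<exists>c<\<infinity>. \<forall>x\<in>space (B i). \<phi> i x \<le> c"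
      using bd by blast
    from bchoice[OF this] obtain c where c: "\<And>i. i \<in> I - {j} \<Longrightarrow> c i < \<infinity>"
      "\<And>i x. i \<in> I - {j} \<Longrightarrow> x \<in> space (B i) \<Longrightarrow> \<phi> i x \<le> c i" by blast
    define \<Phi> where "\<Phi> x = (\<Prod>i\<in>I - {j}. \<phi> i (x i))" for x
    have split: "(\<Prod>i\<in>I. \<psi> i (x i)) = (\<Prod>i\<in>I - {j}. \<psi> i (x i)) * \<psi> j (x j)" for x and \<psi> :: "'a \<Rightarrow> 'b \<Rightarrow> ennreal"
      using I j by (simp add: prod.remove mult.commute)
    have "(\<integral>\<^sup>+x. \<Phi> x * indicator A (x j) \<partial>\<mu>) = (\<integral>\<^sup>+x. \<Phi> x * indicator A (x j) \<partial>\<nu>)"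
    proof (rule gauss_determining_transfer[OF det[OF j(1)] measurable_component_singleton[OF j(1)] S fin])
      show "\<Phi> \<in> borel_measurable (PiM I B)"
        unfolding \<Phi>_def using mb[OF in_union]
        by (intro borel_measurable_prod_ennreal measurable_compose[OF measurable_component_singleton]) auto
      show "\<Phi> x \<le> (\<Prod>i\<in>I - {j}. c i)" if "x \<in> space (PiM I B)" for x
        unfolding \<Phi>_def using that c(2) by (intro prod_mono_ennreal) (auto simp: space_PiM)
      show "(\<Prod>i\<in>I - {j}. c i) < \<infinity>"
        using c(1) by (rule prod_less_infinity)
      show "A \<in> sets (B j)" by fact
      \<comment> \<open>The induction hypothesis is applied with the indicator at \<open>j\<close>
        put back to an exponential; the transfer lemma then restores the indicator.\<close>
      fix f assume f: "f \<in> borel_measurable (B j)" "centre (space (B j)) (R j) f"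
      have "(\<integral>\<^sup>+x. (\<Prod>i\<in>I. (\<phi>(j := \<lambda>x. ennreal (exp (- f x)))) i (x i)) \<partial>\<mu>)
          = (\<integral>\<^sup>+x. (\<Prod>i\<in>I. (\<phi>(j := \<lambda>x. ennreal (exp (- f x)))) i (x i)) \<partial>\<nu>)"
        using insert.prems insert.hyps f by (intro insert.IH) (auto simp: tst_def)
      moreover have "(\<Prod>i\<in>I. (\<phi>(j := \<lambda>x. ennreal (exp (- f x)))) i (x i)) = \<Phi> x * ennreal (exp (- f (x j)))" for x
      proof -
        have "(\<Prod>i\<in>I - {j}. (\<phi>(j := \<lambda>x. ennreal (exp (- f x)))) i (x i)) = \<Phi> x"
          unfolding \<Phi>_def by (intro prod.cong) auto
        then show ?thesis unfolding split by simp
      qed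
      ultimately show "(\<integral>\<^sup>+x. \<Phi> x * ennreal (exp (- f (x j))) \<partial>\<mu>) = (\<integral>\<^sup>+x. \<Phi> x * ennreal (exp (- f (x j))) \<partial>\<nu>)"
        by simp
    qed
    then show ?case unfolding split \<Phi>_def A(1) .
  qed
  show "\<mu> = \<nu>"
  proof (rule measure_eqI_PiM_finite[OF I S])
    show "emeasure \<mu> (Pi\<^sub>E I A) = emeasure \<nu> (Pi\<^sub>E I A)" if A: "\<And>i. i \<in> I \<Longrightarrow> A i \<in> sets (B i)" for A
    proof -
      have "(\<integral>\<^sup>+x. (\<Prod>i\<in>I. indicator (A i) (x i)) \<partial>m) = emeasure m (Pi\<^sub>E I A)" if m: "sets m = sets (PiM I B)" for m
      proof -
        have "(\<integral>\<^sup>+x. (\<Prod>i\<in>I. indicator (A i) (x i)) \<partial>m) = (\<integral>\<^sup>+x. indicator (Pi\<^sub>E I A) x \<partial>m)"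
          using I sets_eq_imp_space_eq[OF m]
          by (intro nn_integral_cong) (auto simp: indicator_def space_PiM PiE_def Pi_def prod_eq_1_iff intro!: prod_zero)
        then show ?thesis using A m sets_PiM_I_finite[OF I, of A B] by simp
      qed
      moreover have "(\<integral>\<^sup>+x. (\<Prod>i\<in>I. indicator (A i) (x i)) \<partial>\<mu>) = (\<integral>\<^sup>+x. (\<Prod>i\<in>I. indicator (A i) (x i)) \<partial>\<nu>)"
        by (rule main[of I]) (use A in \<open>auto simp: ind_def\<close>)
      ultimately show ?thesis using S by simp
    qed
    show "range (\<lambda>_::nat. space (PiM I B)) \<subseteq> prod_algebra I B"
      by (simp add: space_PiM space_in_prod_algebra image_constant_conv)
    show "(\<Union>i::nat. space (PiM I B)) = space (PiM I B)" by simp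
    show "emeasure \<mu> (space (PiM I B)) \<noteq> \<infinity>"
      using finite_measure.emeasure_finite[OF fin(1)] by simp
  qed
qed

section \<open>Squared distance on the real line\<close>

lemma sets_null_measure_eqI:
  assumes "sets \<mu> = sets \<nu>" "emeasure \<mu> (space \<mu>) = 0" "emeasure \<nu> (space \<nu>) = 0"
  shows "\<mu> = \<nu>"
proof (rule measure_eqI)
  fix A
  show "emeasure \<mu> A = emeasure \<nu> A"
    using emeasure_space[of \<mu> A] emeasure_space[of \<nu> A] assms by simp
qed fact

text \<open>Convolving a character with a Gaussian multiplies it by the Fourier transform of the
  Gaussian, which has no zeros. The substitution \<open>c = x + \<sigma> * y\<close>, with
  \<open>\<sigma>\<close> chosen so that \<open>t * (\<sigma> * y)^2 = y^2 / 2\<close>, reduces this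
  to the characteristic function of the standard normal law.\<close>

lemma gaussian_fourier:
  assumes "0 < t"
  obtains C :: complex where "C \<noteq> 0"
    "\<And>x::real. (CLINT c|lborel. iexp (s * c) * exp (- (t * (x - c)\<^sup>2))) = iexp (s * x) * C"
proof -
  define \<sigma> where "\<sigma> = 1 / sqrt (2 * t)"
  have \<sigma>: "0 < \<sigma>" "\<sigma>\<^sup>2 = 1 / (2 * t)" using assms by (simp_all add: \<sigma>_def power_divide)
  have std: "(CLINT y|lborel. std_normal_density y * iexp (s * \<sigma> * y)) = exp (- (s * \<sigma>)\<^sup>2 / 2)"
  proof -
    have "char std_normal_distribution (s * \<sigma>) = (CLINT y|lborel. std_normal_density y *\<^sub>R iexp (s * \<sigma> * y))"
      unfolding char_def by (subst integral_density) auto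
    then show ?thesis by (simp add: char_std_normal_distribution scaleR_conv_of_real)
  qed
  define C :: complex where "C = \<sigma> * sqrt (2 * pi) * exp (- (s * \<sigma>)\<^sup>2 / 2)"
  have "(CLINT c|lborel. iexp (s * c) * exp (- (t * (x - c)\<^sup>2))) = iexp (s * x) * C" for x :: real
  proof -
    have eq: "iexp (s * (x + \<sigma> * y)) * exp (- (t * (x - (x + \<sigma> * y))\<^sup>2))
        = (iexp (s * x) * sqrt (2 * pi)) * (std_normal_density y * iexp (s * \<sigma> * y))" for y
    proof -
      have "t * (x - (x + \<sigma> * y))\<^sup>2 = y\<^sup>2 / 2"
        using assms by (simp add: power_mult_distrib \<sigma>(2))
      then have "exp (- (t * (x - (x + \<sigma> * y))\<^sup>2)) = sqrt (2 * pi) * std_normal_density y"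
        by (simp add: std_normal_density_def)
      moreover have "iexp (s * (x + \<sigma> * y)) = iexp (s * x) * iexp (s * \<sigma> * y)"
        by (simp add: exp_add[symmetric] algebra_simps)
      ultimately show ?thesis by (simp only: of_real_mult) (simp add: mult_ac)
    qed
    have "(CLINT c|lborel. iexp (s * c) * exp (- (t * (x - c)\<^sup>2)))
        = \<bar>\<sigma>\<bar> *\<^sub>R (CLINT y|lborel. iexp (s * (x + \<sigma> * y)) * exp (- (t * (x - (x + \<sigma> * y))\<^sup>2)))"
      using \<sigma> by (intro lborel_integral_real_affine) simp
    also have "\<dots> = \<sigma> *\<^sub>R (iexp (s * x) * sqrt (2 * pi) * exp (- (s * \<sigma>)\<^sup>2 / 2))"
      unfolding eq using \<sigma> std by simp
    also have "\<dots> = iexp (s * x) * C"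
      by (simp add: C_def scaleR_conv_of_real mult_ac)
    finally show ?thesis .
  qed
  moreover have "C \<noteq> 0" using \<sigma> by (simp add: C_def)
  ultimately show ?thesis using that by blast
qed

text \<open>Levy's theorem concerns probability measures. The value at \<open>s = 0\<close> shows
  that both masses are the same \<open>m\<close>; for \<open>m > 0\<close> one divides by it and
  multiplies back afterwards.\<close>

lemma finite_measure_eqI_iexp:
  fixes \<mu> \<nu> :: "real measure"
  assumes S: "sets \<mu> = sets borel" "sets \<nu> = sets borel" and fin: "finite_measure \<mu>" "finite_measure \<nu>"
    and eq: "\<And>s. (CLINT x|\<mu>. iexp (s * x)) = (CLINT x|\<nu>. iexp (s * x))"
  shows "\<mu> = \<nu>"
proof -
  interpret \<mu>: finite_measure \<mu> by fact
  interpret \<nu>: finite_measure \<nu> by fact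
  define m where "m = measure \<mu> (space \<mu>)"
  have m\<nu>: "measure \<nu> (space \<nu>) = m" using eq[of 0] by (simp add: m_def)
  show ?thesis
  proof (cases "m = 0")
    case True
    then show ?thesis using S m\<nu>
      by (intro sets_null_measure_eqI) (auto simp: \<mu>.emeasure_eq_measure \<nu>.emeasure_eq_measure m_def)
  next
    case False
    then have m: "0 < m" by (simp add: m_def zero_less_measure_iff)
    define N where "N n = density n (\<lambda>x::real. ennreal (1 / m))" for n
    have rd: "real_distribution (N n)" if "sets n = sets borel" "finite_measure n" "measure n (space n) = m" for n
    proof -
      interpret finite_measure n by fact
      have "emeasure (N n) (space (N n)) = ennreal (1 / m) * ennreal m"
        unfolding N_def space_density that(3)[symmetric] emeasure_eq_measure[symmetric]
        by (rule emeasure_density_const) (rule sets.top)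
      also have "\<dots> = 1" using m by (simp flip: ennreal_mult)
      finally have "prob_space (N n)" by (rule prob_spaceI)
      then show ?thesis using that
        by (intro real_distribution.intro real_distribution_axioms.intro) (simp_all add: N_def)
    qed
    have ch: "char (N n) s = (1 / m) *\<^sub>R (CLINT x|n. iexp (s * x))" if "sets n = sets borel" for n s
    proof -
      have [measurable_cong]: "sets n = sets borel" by fact
      show ?thesis unfolding N_def char_def using m by (subst integral_density) auto
    qed
    have "char (N \<mu>) = char (N \<nu>)"
      by (rule ext) (simp only: ch[OF S(1)] ch[OF S(2)] eq)
    then have "N \<mu> = N \<nu>"
      using S fin m\<nu> by (intro Levy_uniqueness rd) (simp_all add: m_def)
    then have "density (N \<mu>) (\<lambda>_. ennreal m) = density (N \<nu>) (\<lambda>_. ennreal m)" by simp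
    moreover have "density (N n) (\<lambda>_. ennreal m) = n" if "sets n = sets borel" for n
    proof -
      have "ennreal (1 / m) * ennreal m = 1" using m by (simp flip: ennreal_mult)
      then show ?thesis unfolding N_def by (subst density_density_eq) (auto simp: density_1)
    qed
    ultimately show ?thesis using S by simp
  qed
qed

lemma psd_rank_one: "psd S (\<lambda>x y. g x * g y)"
proof -
  have "(\<Sum>i<n. \<Sum>j<n. b i * b j * (g (x i) * g (x j))) = (\<Sum>i<n. b i * g (x i))\<^sup>2"
    for n :: nat and x and b :: "nat \<Rightarrow> real"
    by (simp add: power2_eq_square sum_product mult_ac)
  then show ?thesis by (simp add: psd_def mult.commute)
qed

lemma gauss_determining_real:
  assumes "0 < t"
  shows "gauss_determining borel (\<lambda>x y :: real. t * (x - y)\<^sup>2)"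
  unfolding gauss_determining_def
proof (intro allI impI)
  fix \<mu> \<nu> :: "real measure"
  assume S: "sets \<mu> = sets borel" "sets \<nu> = sets borel" and fin: "finite_measure \<mu>" "finite_measure \<nu>"
    and eq: "\<forall>f\<in>borel_measurable borel. centre (space borel) (\<lambda>x y. t * (x - y)\<^sup>2) f \<longrightarrow>
      (\<integral>\<^sup>+x. ennreal (exp (- f x)) \<partial>\<mu>) = (\<integral>\<^sup>+x. ennreal (exp (- f x)) \<partial>\<nu>)"
  have nn: "(\<integral>\<^sup>+x. ennreal (exp (- (t * (x - c)\<^sup>2))) \<partial>\<mu>) = (\<integral>\<^sup>+x. ennreal (exp (- (t * (x - c)\<^sup>2))) \<partial>\<nu>)" for c
  proof -
    \<comment> \<open>The point \<open>c\<close> as centre: the Gram kernel of the vectors x - c,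
      with \<open>\<kappa> = 0\<close>.\<close>
    have "psd UNIV (\<lambda>x y. (2 * t) * ((x - c) * (y - c)))"
      using assms by (intro psd_scale psd_rank_one) simp
    then have "psd UNIV (\<lambda>x y. t * (x - c)\<^sup>2 + t * (y - c)\<^sup>2 - 0 - t * (x - y)\<^sup>2)"
      by (rule psd_cong[THEN iffD1, rotated]) (simp add: power2_eq_square algebra_simps)
    then have "centre (space borel) (\<lambda>x y. t * (x - y)\<^sup>2) (\<lambda>x. t * (x - c)\<^sup>2)"
      unfolding centre_def space_borel by (rule exI)
    then show ?thesis by (intro eq[rule_format]) auto
  qed
  \<comment> \<open>Integrating the Gaussian averages, which depend only on the centre
    \<open>c\<close>, against a character in \<open>c\<close> and exchanging the integrals recovers
    the Fourier transform of the measure up to the nonzero factor \<open>C\<close>.\<close>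
  have gauss: "(CLINT c|lborel. iexp (s * c) * (LINT x|n. exp (- (t * (x - c)\<^sup>2)))) = (CLINT x|n. iexp (s * x)) * C"
    if S: "sets n = sets borel" and "finite_measure n"
      and C: "\<And>x::real. (CLINT c|lborel. iexp (s * c) * exp (- (t * (x - c)\<^sup>2))) = iexp (s * x) * C" for n s C
  proof -
    interpret finite_measure n by fact
    interpret pair_sigma_finite n lborel ..
    note S[measurable_cong]
    have gi: "integrable lborel (\<lambda>c. exp (- (t * (x - c)\<^sup>2)))" for x :: real
    proof -
      have "integrable lborel (normal_density x (1 / sqrt (2 * t)))"
        using assms by (intro integrable_normal_density) simp
      moreover have "normal_density x (1 / sqrt (2 * t)) = (\<lambda>c. sqrt (t / pi) * exp (- (t * (x - c)\<^sup>2)))"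
        using assms by (auto simp: normal_density_def fun_eq_iff power_divide real_sqrt_divide power2_commute mult_ac)
      ultimately show ?thesis using assms by simp
    qed
    \<comment> \<open>By translation invariance the inner integral of the norm is constant in
      \<open>x\<close>, so finiteness of the measure is enough for Fubini.\<close>
    have gv: "(LINT c|lborel. exp (- (t * (x - c)\<^sup>2))) = (LINT c|lborel. exp (- (t * (0 - c)\<^sup>2)))" for x :: real
      using lborel_integral_real_affine[of 1 "\<lambda>c. exp (- (t * (x - c)\<^sup>2))" x] by simp
    have "integrable (n \<Otimes>\<^sub>M lborel) (\<lambda>(x, c). iexp (s * c) * exp (- (t * (x - c)\<^sup>2)))"
    proof (rule Fubini_integrable)
      show "integrable n (\<lambda>x. LINT c|lborel. norm (case (x, c) of (x, c) \<Rightarrow> iexp (s * c) * exp (- (t * (x - c)\<^sup>2))))"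
        by (simp add: norm_mult gv)
      show "AE x in n. integrable lborel (\<lambda>c. case (x, c) of (x, c) \<Rightarrow> iexp (s * c) * exp (- (t * (x - c)\<^sup>2)))"
        by (rule AE_I2, rule Bochner_Integration.integrable_bound[OF gi]) (auto simp: norm_mult)
    qed measurable
    from Fubini_integral[OF this]
    have "(CLINT c|lborel. CLINT x|n. iexp (s * c) * exp (- (t * (x - c)\<^sup>2)))
        = (CLINT x|n. CLINT c|lborel. iexp (s * c) * exp (- (t * (x - c)\<^sup>2)))" .
    then show ?thesis unfolding C by simp
  qed
  have real: "(LINT x|\<mu>. exp (- (t * (x - c)\<^sup>2))) = (LINT x|\<nu>. exp (- (t * (x - c)\<^sup>2)))" for c
    using nn[of c] S by (simp add: integral_eq_nn_integral cong: measurable_cong_sets)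
  show "\<mu> = \<nu>"
  proof (rule finite_measure_eqI_iexp[OF S fin])
    fix s
    obtain C where C: "C \<noteq> 0"
      "\<And>x::real. (CLINT c|lborel. iexp (s * c) * exp (- (t * (x - c)\<^sup>2))) = iexp (s * x) * C"
      using gaussian_fourier[OF assms] by metis
    show "(CLINT x|\<mu>. iexp (s * x)) = (CLINT x|\<nu>. iexp (s * x))"
      using gauss[OF S(1) fin(1) C(2)] gauss[OF S(2) fin(2) C(2)] C(1) by (simp add: real)
  qed
qed

section \<open>Metrics of strong negative type\<close>

lemma abs_one_minus_exp_le: "\<bar>1 - exp (- y)\<bar> \<le> \<bar>y\<bar> * exp \<bar>y\<bar>" for y :: real
proof (cases "0 \<le> y")
  case True
  have "1 - exp (- y) \<le> y" using exp_ge_add_one_self[of "- y"] by simp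
  also have "y \<le> y * exp y" using True by (simp add: mult_le_cancel_left1)
  finally show ?thesis using True by simp
next
  case False
  have "exp (- y) * (1 + y) \<le> exp (- y) * exp y"
    using exp_ge_add_one_self[of y] by (intro mult_left_mono) auto
  moreover have "exp (- y) * exp y = 1" by (simp add: exp_minus)
  moreover have "1 \<le> exp (- y)" "\<bar>y\<bar> = - y" "exp \<bar>y\<bar> = exp (- y)" using False by auto
  ultimately show ?thesis by (simp add: algebra_simps)
qed

text \<open>Derivative at 0 of the Laplace transform, taken along the steps 1 / (n + 1). Boundedness
  of \<open>b\<close> allows dominated convergence: the difference quotient is at most |b| exp |b|,
  hence at most \<open>c * exp c\<close>.\<close>

lemma (in prob_space) laplace_scaled_tendsto_expectation:
  fixes b :: "'a \<Rightarrow> real"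
  assumes b: "b \<in> borel_measurable M" "\<And>x. x \<in> space M \<Longrightarrow> \<bar>b x\<bar> \<le> c"
  shows "(\<lambda>n. real (Suc n) * (1 - (\<integral>x. exp (- (b x / real (Suc n))) \<partial>M))) \<longlonglongrightarrow> (\<integral>x. b x \<partial>M)"
proof -
  have int: "integrable M (\<lambda>x. exp (- (b x / real (Suc n))))" for n
  proof (rule integrable_const_bound[where B = "exp c"])
    show "AE x in M. norm (exp (- (b x / real (Suc n)))) \<le> exp c"
    proof (rule AE_I2)
      fix x assume "x \<in> space M"
      then have "\<bar>b x\<bar> \<le> c" by (rule b(2))
      moreover have "\<bar>b x / real (Suc n)\<bar> \<le> \<bar>b x\<bar> / 1"
        unfolding abs_divide by (intro divide_left_mono) auto
      ultimately have "- (b x / real (Suc n)) \<le> c" by linarith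
      then show "norm (exp (- (b x / real (Suc n)))) \<le> exp c" by (simp del: of_nat_Suc)
    qed
  qed (use b(1) in measurable)
  have "(\<lambda>n. \<integral>x. real (Suc n) * (1 - exp (- (b x / real (Suc n)))) \<partial>M) \<longlonglongrightarrow> (\<integral>x. b x \<partial>M)"
  proof (rule integral_dominated_convergence[where w = "\<lambda>_. c * exp c"])
    show "AE x in M. (\<lambda>n. real (Suc n) * (1 - exp (- (b x / real (Suc n))))) \<longlonglongrightarrow> b x"
    proof (rule AE_I2)
      fix x
      have "((\<lambda>h. - exp (- (b x * h))) has_real_derivative b x) (at 0)"
        by (auto intro!: derivative_eq_intros)
      then have "((\<lambda>h. (- exp (- (b x * (0 + h))) - - exp (- (b x * 0))) / h) \<longlongrightarrow> b x) (at 0)"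
        unfolding DERIV_def .
      then have "((\<lambda>n. (- exp (- (b x * (0 + inverse (real (Suc n))))) - - exp (- (b x * 0))) / inverse (real (Suc n)))
          \<longlongrightarrow> b x) sequentially"
        by (rule filterlim_compose[OF _ filterlim_atI]) (use LIMSEQ_inverse_real_of_nat in auto)
      then show "(\<lambda>n. real (Suc n) * (1 - exp (- (b x / real (Suc n))))) \<longlonglongrightarrow> b x"
        by (simp add: divide_inverse mult.commute del: of_nat_Suc)
    qed
    show "AE x in M. norm (real (Suc n) * (1 - exp (- (b x / real (Suc n))))) \<le> c * exp c" for n
    proof (rule AE_I2)
      fix x assume "x \<in> space M"
      then have c: "\<bar>b x\<bar> \<le> c" by (rule b(2))
      define y where "y = b x / real (Suc n)"
      have y: "\<bar>y\<bar> \<le> \<bar>b x\<bar> / 1" "real (Suc n) * \<bar>y\<bar> = \<bar>b x\<bar>"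
        unfolding y_def abs_divide by (intro divide_left_mono) (auto simp del: of_nat_Suc)
      have "norm (real (Suc n) * (1 - exp (- y))) \<le> real (Suc n) * (\<bar>y\<bar> * exp \<bar>y\<bar>)"
        unfolding norm_mult using abs_one_minus_exp_le[of y] by (intro mult_mono) auto
      also have "\<dots> = \<bar>b x\<bar> * exp \<bar>y\<bar>" using y(2) by (simp add: mult.assoc[symmetric] del: of_nat_Suc)
      also have "\<dots> \<le> c * exp c" using c y(1) by (intro mult_mono) auto
      finally show "norm (real (Suc n) * (1 - exp (- (b x / real (Suc n))))) \<le> c * exp c"
        by (simp only: y_def)
    qed
  qed (use b(1) in auto)
  moreover have "(\<integral>x. real (Suc n) * (1 - exp (- (b x / real (Suc n)))) \<partial>M)
      = real (Suc n) * (1 - (\<integral>x. exp (- (b x / real (Suc n))) \<partial>M))" for n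
    using int[of n] by (simp add: prob_space del: of_nat_Suc)
  ultimately show ?thesis by (simp del: of_nat_Suc)
qed

lemma expectation_eqI_laplace:
  fixes b :: "'a \<Rightarrow> real"
  assumes S: "sets \<mu> = sets B" "sets \<nu> = sets B" and P: "prob_space \<mu>" "prob_space \<nu>"
    and b: "b \<in> borel_measurable B" "\<And>x. x \<in> space B \<Longrightarrow> \<bar>b x\<bar> \<le> c"
    and eq: "\<And>h. (\<integral>x. exp (- (h * b x)) \<partial>\<mu>) = (\<integral>x. exp (- (h * b x)) \<partial>\<nu>)"
  shows "(\<integral>x. b x \<partial>\<mu>) = (\<integral>x. b x \<partial>\<nu>)"
proof -
  have lim: "(\<lambda>n. real (Suc n) * (1 - (\<integral>x. exp (- (b x / real (Suc n))) \<partial>m))) \<longlonglongrightarrow> (\<integral>x. b x \<partial>m)"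
    if "sets m = sets B" "prob_space m" for m
    using that b sets_eq_imp_space_eq[OF that(1)]
    by (intro prob_space.laplace_scaled_tendsto_expectation) (auto cong: measurable_cong_sets)
  have "(\<integral>x. exp (- (b x / real (Suc n))) \<partial>\<mu>) = (\<integral>x. exp (- (b x / real (Suc n))) \<partial>\<nu>)" for n
    using eq[of "inverse (real (Suc n))"] by (simp add: divide_inverse mult.commute del: of_nat_Suc)
  then show ?thesis using LIMSEQ_unique[OF lim[OF S(1) P(1)]] lim[OF S(2) P(2)] by simp
qed

text \<open>If the potentials of two probability measures differ by a constant, their energy distance vanishes.\<close>

lemma strong_negative_type_eqI:
  assumes met: "Metric_space (space B) \<rho>" and meas: "case_prod \<rho> \<in> borel_measurable (B \<Otimes>\<^sub>M B)"
    and snt: "strong_negative_type B \<rho>"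
    and S: "sets \<mu> = sets B" "sets \<nu> = sets B" and P: "prob_space \<mu>" "prob_space \<nu>"
    and z: "z \<in> space B" and int: "integrable \<mu> (\<rho> z)" "integrable \<nu> (\<rho> z)"
    and pot: "\<And>u. u \<in> space B \<Longrightarrow> (\<integral>x. \<rho> u x - \<rho> z x \<partial>\<mu>) = (\<integral>x. \<rho> u x - \<rho> z x \<partial>\<nu>)"
  shows "\<mu> = \<nu>"
proof -
  interpret Metric_space "space B" \<rho> by fact
  have int': "integrable m (\<rho> u)" if m: "sets m = sets B" "prob_space m" "integrable m (\<rho> z)" and u: "u \<in> space B" for m u
  proof (rule Bochner_Integration.integrable_bound)
    interpret prob_space m by fact
    show "integrable m (\<lambda>x. \<rho> u z + \<rho> z x)" using m by simp
    show "\<rho> u \<in> borel_measurable m"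
      using measurable_compose[OF measurable_Pair1'[OF u] meas] m(1)
      by (simp cong: measurable_cong_sets)
    show "AE x in m. norm (\<rho> u x) \<le> norm (\<rho> u z + \<rho> z x)"
      using triangle[OF u z] sets_eq_imp_space_eq[OF m(1)] by (intro AE_I2) simp
  qed
  define U where "U m u = (\<integral>x. \<rho> u x \<partial>m)" for m u
  have UB: "integrable m (U m')"
    if m: "sets m = sets B" "prob_space m" "integrable m (\<rho> z)"
      and m': "sets m' = sets B" "prob_space m'" "integrable m' (\<rho> z)" for m m'
  proof (rule Bochner_Integration.integrable_bound)
    interpret prob_space m by fact
    interpret m': prob_space m' by fact
    show "integrable m (\<lambda>x. \<rho> z x + U m' z)" using m by simp
    have [measurable]: "case_prod \<rho> \<in> borel_measurable (m \<Otimes>\<^sub>M m')"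
      using meas sets_pair_measure_cong[OF m(1) m'(1)] by (simp cong: measurable_cong_sets)
    show "U m' \<in> borel_measurable m" unfolding U_def by measurable
    show "AE x in m. norm (U m' x) \<le> norm (\<rho> z x + U m' z)"
    proof (rule AE_I2)
      fix x assume "x \<in> space m"
      then have x: "x \<in> space B" using sets_eq_imp_space_eq[OF m(1)] by simp
      have "U m' x \<le> (\<integral>y. \<rho> z x + \<rho> z y \<partial>m')"
        unfolding U_def using int'[OF m' x] m'(3) triangle[OF x z] commute[of x z] sets_eq_imp_space_eq[OF m'(1)]
        by (intro integral_mono) auto
      also have "\<dots> = \<rho> z x + U m' z" using m'(3) by (simp add: U_def m'.prob_space)
      finally have "U m' x \<le> \<rho> z x + U m' z" .
      moreover have "0 \<le> U m' x" unfolding U_def by simp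
      ultimately show "norm (U m' x) \<le> norm (\<rho> z x + U m' z)" by simp
    qed
  qed
  define \<delta> where "\<delta> = U \<mu> z - U \<nu> z"
  \<comment> \<open>\<open>pot\<close> speaks of integrals of bounded differences; with first
    moments available they split, and the two potentials differ by one constant for all
    \<open>u\<close>.\<close>
  have d: "U \<mu> u = U \<nu> u + \<delta>" if u: "u \<in> space B" for u
    using pot[OF u] int'[OF S(1) P(1) int(1) u] int'[OF S(2) P(2) int(2) u] int
    by (simp add: U_def \<delta>_def)
  interpret \<mu>: prob_space \<mu> by fact
  interpret \<nu>: prob_space \<nu> by fact
  interpret pair_sigma_finite \<mu> \<nu> ..
  have "integrable (\<mu> \<Otimes>\<^sub>M \<nu>) (case_prod \<rho>)"
  proof (rule Fubini_integrable)
    show "case_prod \<rho> \<in> borel_measurable (\<mu> \<Otimes>\<^sub>M \<nu>)"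
      using meas sets_pair_measure_cong[OF S] by (simp cong: measurable_cong_sets)
    show "integrable \<mu> (\<lambda>x. \<integral>y. norm (case (x, y) of (x, y) \<Rightarrow> \<rho> x y) \<partial>\<nu>)"
      using UB[OF S(1) P(1) int(1) S(2) P(2) int(2)] by (simp add: U_def[abs_def])
    show "AE x in \<mu>. integrable \<nu> (\<lambda>y. case (x, y) of (x, y) \<Rightarrow> \<rho> x y)"
      using int'[OF S(2) P(2) int(2)] sets_eq_imp_space_eq[OF S(1)] by (intro AE_I2) simp
  qed
  \<comment> \<open>Both mixed integrals agree by symmetry. Integrating the relation
    \<open>d\<close> against \<open>\<mu>\<close> and against \<open>\<nu>\<close> produces
    \<open>\<delta>\<close> with opposite signs in the energy distance, so it cancels.\<close>
  from Fubini_integral[OF this] have "(\<integral>y. U \<mu> y \<partial>\<nu>) = (\<integral>x. U \<nu> x \<partial>\<mu>)"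
    unfolding U_def by (simp add: commute)
  moreover have "(\<integral>y. U \<mu> y \<partial>\<nu>) = (\<integral>y. U \<nu> y + \<delta> \<partial>\<nu>)"
    using d sets_eq_imp_space_eq[OF S(2)] by (intro Bochner_Integration.integral_cong) auto
  moreover have "(\<integral>y. U \<mu> y \<partial>\<mu>) = (\<integral>y. U \<nu> y + \<delta> \<partial>\<mu>)"
    using d sets_eq_imp_space_eq[OF S(1)] by (intro Bochner_Integration.integral_cong) auto
  ultimately have "2 * (\<integral>x. U \<nu> x \<partial>\<mu>) - (\<integral>x. U \<mu> x \<partial>\<mu>) - (\<integral>x. U \<nu> x \<partial>\<nu>) = 0"
    using UB[OF S(1) P(1) int(1) S(2) P(2) int(2)] UB[OF S(2) P(2) int(2) S(2) P(2) int(2)]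
    by (simp add: \<mu>.prob_space \<nu>.prob_space)
  moreover have "finite_first_moment \<rho> m" if "sets m = sets B" "integrable m (\<rho> z)" for m
    unfolding finite_first_moment_def
    using that z sets_eq_imp_space_eq[OF that(1)]
    by (intro bexI[of _ z]) (simp_all add: nn_integral_eq_integral)
  ultimately show ?thesis using snt S P int unfolding strong_negative_type_def U_def by blast
qed

text \<open>Strong negative type applies to probability measures with a first moment, while
  \<open>\<mu>\<close> and \<open>\<nu>\<close> are merely finite. Weighting both by
  \<open>exp (- (t * \<rho> z x))\<close> enforces the moment, and this weight is itself one of the
  permitted exponentials. The differences \<open>\<rho> u x - \<rho> z x\<close> are bounded by the
  triangle inequality, so their expectations can be read off from the Laplace transform.\<close>

lemma gauss_determining_strong_negative_type:
  assumes met: "Metric_space (space B) \<rho>" and meas: "case_prod \<rho> \<in> borel_measurable (B \<Otimes>\<^sub>M B)"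
    and snt: "strong_negative_type B \<rho>" and t: "0 < t"
  shows "gauss_determining B (\<lambda>x y. t * \<rho> x y)"
  unfolding gauss_determining_def
proof (intro allI impI)
  fix \<mu> \<nu> assume S: "sets \<mu> = sets B" "sets \<nu> = sets B"
    and fin: "finite_measure \<mu>" "finite_measure \<nu>"
    and eq: "\<forall>f\<in>borel_measurable B. centre (space B) (\<lambda>x y. t * \<rho> x y) f \<longrightarrow>
      (\<integral>\<^sup>+x. ennreal (exp (- f x)) \<partial>\<mu>) = (\<integral>\<^sup>+x. ennreal (exp (- f x)) \<partial>\<nu>)"
  interpret Metric_space "space B" \<rho> by fact
  have sp: "space \<mu> = space B" "space \<nu> = space B"
    using S sets_eq_imp_space_eq by blast+
  have ms: "\<rho> u \<in> borel_measurable B" if "u \<in> space B" for u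
    using measurable_compose[OF measurable_Pair1'[OF that] meas] by simp
  have nt: "negative_type (space B) \<rho>" using snt by (simp add: strong_negative_type_def)
  have eq': "(\<integral>\<^sup>+x. ennreal (exp (- (t * \<rho> z x)) * exp (- (h * (\<rho> u x - \<rho> z x)))) \<partial>\<mu>)
      = (\<integral>\<^sup>+x. ennreal (exp (- (t * \<rho> z x)) * exp (- (h * (\<rho> u x - \<rho> z x)))) \<partial>\<nu>)"
    if z: "z \<in> space B" and u: "u \<in> space B" for z u h
  proof -
    \<comment> \<open>The weight \<open>h / t\<close> compensates the scaling of the distance by
      \<open>t\<close>, so the exponent contains exactly \<open>h\<close> times the
      difference.\<close>
    let ?f = "\<lambda>x. t * (\<rho> z x + h / t * (\<rho> u x - \<rho> z x))"
    have "centre (space B) (\<lambda>x y. t * \<rho> x y) ?f"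
      by (intro centre_scale negative_type_centre nt commute z u) (use t in auto)
    moreover have "?f \<in> borel_measurable B" using ms[OF z] ms[OF u] by measurable
    ultimately have "(\<integral>\<^sup>+x. ennreal (exp (- ?f x)) \<partial>\<mu>) = (\<integral>\<^sup>+x. ennreal (exp (- ?f x)) \<partial>\<nu>)"
      using eq by blast
    moreover have "exp (- ?f x) = exp (- (t * \<rho> z x)) * exp (- (h * (\<rho> u x - \<rho> z x)))" for x
      using t by (simp add: exp_add[symmetric] distrib_left)
    ultimately show ?thesis by simp
  qed
  show "\<mu> = \<nu>"
  proof (cases "emeasure \<mu> (space \<mu>) = 0 \<and> emeasure \<nu> (space \<nu>) = 0")
    case True
    then show ?thesis using S by (intro sets_null_measure_eqI) auto
  next
    case False
    then have "space B \<noteq> {}" using sp by auto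
    then obtain z where z: "z \<in> space B" by blast
    define w where "w x = exp (- (t * \<rho> z x))" for x
    have w: "0 < w x" "w x \<le> 1" for x using t by (auto simp: w_def)
    have wm: "w \<in> borel_measurable B" unfolding w_def using ms[OF z] by measurable
    define r where "r = (\<integral>x. w x \<partial>\<mu>)"
    have wint: "integrable n w" if "sets n = sets B" "finite_measure n" for n
      using that w wm by (intro finite_measure.integrable_const_bound[where B = 1])
        (auto simp: abs_of_pos cong: measurable_cong_sets)
    have r\<nu>: "(\<integral>x. w x \<partial>\<nu>) = r"
    proof -
      have "(\<integral>\<^sup>+x. ennreal (w x) \<partial>\<mu>) = (\<integral>\<^sup>+x. ennreal (w x) \<partial>\<nu>)"
        using eq'[OF z z, of 0] by (simp add: w_def)
      then show ?thesis
        using wint[OF S(1) fin(1)] wint[OF S(2) fin(2)] w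
        by (simp add: r_def integral_eq_nn_integral less_imp_le)
    qed
    have r0: "emeasure n (space n) = 0" if "sets n = sets B" "finite_measure n" "(\<integral>x. w x \<partial>n) = 0" for n
    proof -
      have "AE x in n. w x = 0"
        using integral_nonneg_eq_0_iff_AE[OF wint[OF that(1,2)]] that(3) w(1) by (simp add: less_imp_le)
      then have "AE x in n. False" by eventually_elim (use w(1) in \<open>simp add: less_imp_neq[symmetric]\<close>)
      then show ?thesis by (simp add: eventually_False ae_filter_eq_bot_iff)
    qed
    \<comment> \<open>As \<open>w\<close> is strictly positive, a zero integral would make both
      measures null, a case already settled.\<close>
    have "r \<noteq> 0" using r0[OF S(1) fin(1)] r0[OF S(2) fin(2)] r\<nu> False by (auto simp: r_def)
    moreover have "0 \<le> r" unfolding r_def using w(1) by (simp add: less_imp_le)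
    ultimately have r: "0 < r" by simp
    define N where "N n = density n (\<lambda>x. ennreal (w x / r))" for n
    have intN: "(\<integral>x. G x \<partial>N n) = (\<integral>x. w x / r * G x \<partial>n)"
      "integrable (N n) G \<longleftrightarrow> integrable n (\<lambda>x. w x / r * G x)"
      if n: "sets n = sets B" and G: "G \<in> borel_measurable B" for n and G :: "'a \<Rightarrow> real"
    proof -
      have [measurable]: "w \<in> borel_measurable n" "G \<in> borel_measurable n"
        using wm G n by (auto cong: measurable_cong_sets)
      show "(\<integral>x. G x \<partial>N n) = (\<integral>x. w x / r * G x \<partial>n)" "integrable (N n) G \<longleftrightarrow> integrable n (\<lambda>x. w x / r * G x)"
        unfolding N_def using w(1) r
        by (subst integral_density integrable_density; force intro: less_imp_le)+
    qed
    have PN: "prob_space (N n)" if n: "sets n = sets B" "finite_measure n" and rn: "(\<integral>x. w x \<partial>n) = r" for n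
    proof
      have [measurable]: "w \<in> borel_measurable n" using wm n by (auto cong: measurable_cong_sets)
      have "emeasure (N n) (space (N n)) = (\<integral>\<^sup>+x. ennreal (w x / r) \<partial>n)"
        by (simp add: N_def emeasure_density)
      also have "\<dots> = ennreal (\<integral>x. w x / r \<partial>n)"
        using wint[OF n] w(1) r by (intro nn_integral_eq_integral) (auto simp: less_imp_le)
      also have "\<dots> = 1" using rn r by simp
      finally show "emeasure (N n) (space (N n)) = 1" .
    qed
    have mom: "integrable (N n) (\<rho> z)" if n: "sets n = sets B" "finite_measure n" for n
      unfolding intN(2)[OF n(1) ms[OF z]]
    proof (rule finite_measure.integrable_const_bound[OF n(2), where B = "1 / (t * r)"])
      show "(\<lambda>x. w x / r * \<rho> z x) \<in> borel_measurable n"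
        using wm ms[OF z] n by (simp cong: measurable_cong_sets)
      \<comment> \<open>The function y exp (- y) is at most 1, taken at
        \<open>y = t * \<rho> z x\<close>; this is how the weight creates a finite first
        moment.\<close>
      have "w x * \<rho> z x * t \<le> 1" for x
      proof -
        have "t * \<rho> z x \<le> exp (t * \<rho> z x)" using exp_ge_add_one_self[of "t * \<rho> z x"] by linarith
        then show ?thesis by (simp add: w_def exp_minus field_simps)
      qed
      then show "AE x in n. norm (w x / r * \<rho> z x) \<le> 1 / (t * r)"
        using t r w(1) by (intro AE_I2) (simp add: abs_mult less_imp_le field_simps)
    qed
    have "N \<mu> = N \<nu>"
    proof (rule strong_negative_type_eqI[OF met meas snt _ _ PN PN z])
      fix u assume u: "u \<in> space B"
      have bm: "(\<lambda>x. \<rho> u x - \<rho> z x) \<in> borel_measurable B" using ms[OF z] ms[OF u] by measurable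
      show "(\<integral>x. \<rho> u x - \<rho> z x \<partial>N \<mu>) = (\<integral>x. \<rho> u x - \<rho> z x \<partial>N \<nu>)"
      proof (rule expectation_eqI_laplace[where B = B and c = "\<rho> u z"])
        show "\<bar>\<rho> u x - \<rho> z x\<bar> \<le> \<rho> u z" if "x \<in> space B" for x
          using triangle[OF u z that] triangle[OF z u that] commute[of u z] by linarith
        fix h
        have "(\<integral>x. w x * exp (- (h * (\<rho> u x - \<rho> z x))) \<partial>\<mu>) = (\<integral>x. w x * exp (- (h * (\<rho> u x - \<rho> z x))) \<partial>\<nu>)"
        proof -
          have "(\<lambda>x. w x * exp (- (h * (\<rho> u x - \<rho> z x)))) \<in> borel_measurable B" using wm bm by measurable
          then show ?thesis
            using eq'[OF z u, of h] S w(1)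
            by (simp add: integral_eq_nn_integral less_imp_le w_def cong: measurable_cong_sets)
        qed
        then show "(\<integral>x. exp (- (h * (\<rho> u x - \<rho> z x))) \<partial>N \<mu>) = (\<integral>x. exp (- (h * (\<rho> u x - \<rho> z x))) \<partial>N \<nu>)"
          using bm S by (simp add: intN)
      qed (use S fin PN r\<nu> bm in \<open>auto simp: N_def r_def\<close>)
    qed (use S fin r\<nu> mom in \<open>auto simp: N_def r_def\<close>)
    \<comment> \<open>The weight vanishes nowhere, so it can be divided out again.\<close>
    then have "density (N \<mu>) (\<lambda>x. ennreal (r / w x)) = density (N \<nu>) (\<lambda>x. ennreal (r / w x))" by simp
    moreover have "density (N n) (\<lambda>x. ennreal (r / w x)) = n" if n: "sets n = sets B" for n
    proof -
      have [measurable]: "w \<in> borel_measurable n" using wm n by (auto cong: measurable_cong_sets)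
      have "ennreal (w x / r) * ennreal (r / w x) = 1" for x
      proof -
        have "ennreal (w x / r) * ennreal (r / w x) = ennreal (w x / r * (r / w x))"
          using w(1)[of x] r by (intro ennreal_mult[symmetric]) (auto intro: less_imp_le)
        also have "w x / r * (r / w x) = 1" using w(1)[of x] r by simp
        finally show ?thesis by simp
      qed
      then show ?thesis unfolding N_def by (subst density_density_eq) (auto simp: density_1)
    qed
    ultimately show ?thesis using S by simp
  qed
qed

section \<open>Energy of a positive definite kernel\<close>

lemma distr_PiM_pair:
  fixes i j :: nat
  assumes "prob_space N" "i \<noteq> j"
  shows "distr (PiM UNIV (\<lambda>_::nat. N)) (N \<Otimes>\<^sub>M N) (\<lambda>w. (w i, w j)) = N \<Otimes>\<^sub>M N"
proof -
  interpret N: prob_space N by fact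
  interpret product_prob_space "\<lambda>_::nat. N" UNIV by (rule product_prob_spaceI) fact
  show ?thesis
  proof (rule pair_measure_eqI[symmetric])
    fix A B assume A: "A \<in> sets N" and B: "B \<in> sets N"
    have "emeasure (distr (PiM UNIV (\<lambda>_::nat. N)) (N \<Otimes>\<^sub>M N) (\<lambda>w. (w i, w j))) (A \<times> B)
        = emeasure (PiM UNIV (\<lambda>_::nat. N)) {w \<in> space (PiM UNIV (\<lambda>_::nat. N)). \<forall>k\<in>{i, j}. w k \<in> (if k = i then A else B)}"
      using A B assms(2) by (subst emeasure_distr) (auto intro!: arg_cong[where f = "emeasure _"])
    also have "\<dots> = (\<Prod>k\<in>{i, j}. emeasure N (if k = i then A else B))"
      using A B by (intro emeasure_PiM_Collect) auto
    also have "\<dots> = emeasure N A * emeasure N B" using assms(2) by simp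
    finally show "emeasure N A * emeasure N B
      = emeasure (distr (PiM UNIV (\<lambda>_::nat. N)) (N \<Otimes>\<^sub>M N) (\<lambda>w. (w i, w j))) (A \<times> B)" by simp
  qed (auto intro: N.sigma_finite_measure_axioms)
qed

text \<open>Averaging the quadratic form over an i.i.d. sample of size n: the diagonal contributes O(n),
  the n (n - 1) off-diagonal terms contribute the double integral each.\<close>

lemma integral_kernel_nonneg:
  fixes H :: "'a \<times> 'a \<Rightarrow> real"
  assumes N: "prob_space N" and H: "H \<in> borel_measurable (N \<Otimes>\<^sub>M N)"
    and bd: "\<And>z. z \<in> space (N \<Otimes>\<^sub>M N) \<Longrightarrow> \<bar>H z\<bar> \<le> C"
    and nn: "\<And>(n::nat) x. (\<And>i. i < n \<Longrightarrow> x i \<in> space N) \<Longrightarrow> 0 \<le> (\<Sum>i<n. \<Sum>j<n. H (x i, x j))"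
  shows "0 \<le> (\<integral>z. H z \<partial>(N \<Otimes>\<^sub>M N))"
proof -
  interpret N: prob_space N by fact
  interpret product_prob_space "\<lambda>_::nat. N" UNIV by (rule product_prob_spaceI) fact
  let ?P = "PiM UNIV (\<lambda>_::nat. N)"
  interpret P: prob_space ?P by (rule prob_space_PiM) (rule N)
  note H[measurable]
  define E where "E = (\<integral>z. H z \<partial>(N \<Otimes>\<^sub>M N))"
  have sp: "(w i, w j) \<in> space (N \<Otimes>\<^sub>M N)" if "w \<in> space ?P" for w i j
    using that by (auto simp: space_PiM space_pair_measure)
  have int: "integrable ?P (\<lambda>w. H (w i, w j))" for i j
    using bd sp by (intro P.integrable_const_bound[where B = C]) auto
  have off: "(\<integral>w. H (w i, w j) \<partial>?P) = E" if "i \<noteq> j" for i j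
    unfolding E_def by (subst distr_PiM_pair[OF N that, symmetric], subst integral_distr) auto
  have diag: "(\<integral>w. H (w i, w i) \<partial>?P) \<le> C" for i
  proof -
    have "(\<integral>w. H (w i, w i) \<partial>?P) \<le> (\<integral>w. C \<partial>?P)"
      using int bd[OF sp] by (intro integral_mono) (auto simp: abs_le_iff)
    then show ?thesis by (simp add: P.prob_space)
  qed
  \<comment> \<open>Sample size \<open>Suc n\<close>, so every row has exactly \<open>n\<close>
    off-diagonal terms. Dividing by the number of rows leaves a bound linear in \<open>n\<close>,
    which would fail for large \<open>n\<close> if \<open>E\<close> were negative.\<close>
  have bound: "0 \<le> C + real n * E" for n
  proof -
    have "0 \<le> (\<integral>w. (\<Sum>i<Suc n. \<Sum>j<Suc n. H (w i, w j)) \<partial>?P)"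
      by (intro Bochner_Integration.integral_nonneg nn) (auto simp: space_PiM)
    also have "\<dots> = (\<Sum>i<Suc n. \<Sum>j<Suc n. \<integral>w. H (w i, w j) \<partial>?P)"
      using int by (subst Bochner_Integration.integral_sum; auto intro!: sum.cong Bochner_Integration.integral_sum Bochner_Integration.integrable_sum)
    also have "\<dots> \<le> (\<Sum>i<Suc n. \<Sum>j<Suc n. if j = i then C else E)"
      using diag off by (intro sum_mono) auto
    also have "\<dots> = (\<Sum>i<Suc n. C + real n * E)"
    proof (intro sum.cong refl)
      fix i assume "i \<in> {..<Suc n}"
      then have "(\<Sum>j<Suc n. if j = i then C else E) = C + (\<Sum>j\<in>{..<Suc n} - {i}. E)"
        by (subst sum.remove[of _ i]) (auto intro!: sum.cong)
      also have "\<dots> = C + real n * E" using \<open>i \<in> {..<Suc n}\<close> by (simp add: card_Diff_singleton)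
      finally show "(\<Sum>j<Suc n. if j = i then C else E) = C + real n * E" .
    qed
    also have "\<dots> = real (Suc n) * (C + real n * E)" by simp
    finally show ?thesis by (simp add: zero_le_mult_iff del: of_nat_Suc)
  qed
  show ?thesis
  proof (rule ccontr)
    assume "\<not> ?thesis"
    then have "0 < - E" by (simp add: E_def)
    then obtain n where "C < real n * (- E)" using ex_less_of_nat_mult by blast
    then show False using bound[of n] by simp
  qed
qed

lemma sum_lessThan_add:
  fixes F :: "nat \<Rightarrow> 'a::comm_monoid_add"
  shows "(\<Sum>i<n + m. F i) = (\<Sum>i<n. F i) + (\<Sum>i<m. F (n + i))"
  by (induction m) (auto simp: add.assoc)

lemma pair_distr_fst_snd:
  assumes "prob_space P" "prob_space Q" "prob_space P'" "prob_space Q'"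
  shows "distr ((P \<Otimes>\<^sub>M Q) \<Otimes>\<^sub>M (P' \<Otimes>\<^sub>M Q')) (P \<Otimes>\<^sub>M P') (\<lambda>(x, y). (fst x, fst y)) = P \<Otimes>\<^sub>M P'"
    and "distr ((P \<Otimes>\<^sub>M Q) \<Otimes>\<^sub>M (P' \<Otimes>\<^sub>M Q')) (P \<Otimes>\<^sub>M Q') (\<lambda>(x, y). (fst x, snd y)) = P \<Otimes>\<^sub>M Q'"
    and "distr ((P \<Otimes>\<^sub>M Q) \<Otimes>\<^sub>M (P' \<Otimes>\<^sub>M Q')) (Q \<Otimes>\<^sub>M P') (\<lambda>(x, y). (snd x, fst y)) = Q \<Otimes>\<^sub>M P'"
    and "distr ((P \<Otimes>\<^sub>M Q) \<Otimes>\<^sub>M (P' \<Otimes>\<^sub>M Q')) (Q \<Otimes>\<^sub>M Q') (\<lambda>(x, y). (snd x, snd y)) = Q \<Otimes>\<^sub>M Q'"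
proof -
  interpret P: prob_space P by fact
  interpret Q: prob_space Q by fact
  interpret P': prob_space P' by fact
  interpret Q': prob_space Q' by fact
  have f: "distr (A \<Otimes>\<^sub>M B) A fst = A" if "prob_space B" for A :: "'x measure" and B :: "'y measure"
    by (rule prob_space.distr_pair_fst[OF that])
  have s: "distr (A \<Otimes>\<^sub>M B) B snd = B" if "prob_space A" "prob_space B" for A :: "'x measure" and B :: "'y measure"
  proof -
    interpret A: prob_space A by fact
    interpret B: prob_space B by fact
    interpret pair_sigma_finite A B ..
    have "distr (A \<Otimes>\<^sub>M B) B snd = distr (distr (B \<Otimes>\<^sub>M A) (A \<Otimes>\<^sub>M B) (\<lambda>(x, y). (y, x))) B snd"
      by (subst distr_pair_swap) simp
    also have "\<dots> = distr (B \<Otimes>\<^sub>M A) B fst"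
      by (subst distr_distr) (auto simp: comp_def case_prod_beta)
    finally show ?thesis using f[OF that(1), of B] by simp
  qed
  have sf: "sigma_finite_measure A" if "prob_space A" for A :: "'x measure"
    using that by (simp add: prob_space_imp_sigma_finite)
  show "distr ((P \<Otimes>\<^sub>M Q) \<Otimes>\<^sub>M (P' \<Otimes>\<^sub>M Q')) (P \<Otimes>\<^sub>M P') (\<lambda>(x, y). (fst x, fst y)) = P \<Otimes>\<^sub>M P'"
    using assms by (subst pair_measure_distr[symmetric]) (simp_all add: f s sf)
  show "distr ((P \<Otimes>\<^sub>M Q) \<Otimes>\<^sub>M (P' \<Otimes>\<^sub>M Q')) (P \<Otimes>\<^sub>M Q') (\<lambda>(x, y). (fst x, snd y)) = P \<Otimes>\<^sub>M Q'"
    using assms by (subst pair_measure_distr[symmetric]) (simp_all add: f s sf)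
  show "distr ((P \<Otimes>\<^sub>M Q) \<Otimes>\<^sub>M (P' \<Otimes>\<^sub>M Q')) (Q \<Otimes>\<^sub>M P') (\<lambda>(x, y). (snd x, fst y)) = Q \<Otimes>\<^sub>M P'"
    using assms by (subst pair_measure_distr[symmetric]) (simp_all add: f s sf)
  show "distr ((P \<Otimes>\<^sub>M Q) \<Otimes>\<^sub>M (P' \<Otimes>\<^sub>M Q')) (Q \<Otimes>\<^sub>M Q') (\<lambda>(x, y). (snd x, snd y)) = Q \<Otimes>\<^sub>M Q'"
    using assms by (subst pair_measure_distr[symmetric]) (simp_all add: f s sf)
qed

lemma integral_symmetric_swap:
  fixes k :: "'a \<Rightarrow> 'a \<Rightarrow> real"
  assumes P: "prob_space P" "prob_space Q" and S: "sets P = sets Z" "sets Q = sets Z"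
    and k: "case_prod k \<in> borel_measurable (Z \<Otimes>\<^sub>M Z)"
    and sym: "\<And>x y. x \<in> space Z \<Longrightarrow> y \<in> space Z \<Longrightarrow> k x y = k y x"
  shows "(\<integral>z. k (fst z) (snd z) \<partial>(Q \<Otimes>\<^sub>M P)) = (\<integral>z. k (fst z) (snd z) \<partial>(P \<Otimes>\<^sub>M Q))"
proof -
  interpret P: prob_space P by fact
  interpret Q: prob_space Q by fact
  interpret pair_sigma_finite P Q ..
  have m: "case_prod k \<in> borel_measurable (P \<Otimes>\<^sub>M Q)"
    using k sets_pair_measure_cong[OF S] by (simp cong: measurable_cong_sets)
  have "(\<integral>z. k (fst z) (snd z) \<partial>(Q \<Otimes>\<^sub>M P)) = (\<integral>(x, y). case_prod k (y, x) \<partial>(Q \<Otimes>\<^sub>M P))"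
    using sym sets_eq_imp_space_eq[OF S(1)] sets_eq_imp_space_eq[OF S(2)]
    by (intro Bochner_Integration.integral_cong) (auto simp: space_pair_measure)
  also have "\<dots> = integral\<^sup>L (P \<Otimes>\<^sub>M Q) (case_prod k)" by (rule integral_product_swap[OF m])
  finally show ?thesis by (simp add: case_prod_beta')
qed

text \<open>The form of \<open>k\<close> at the signed measure P - Q. Sampling from the product of
  \<open>P\<close> and \<open>Q\<close> turns it into the double integral of a kernel
  \<open>H\<close> on pairs under a single probability measure, to which
  \<open>integral_kernel_nonneg\<close> applies.\<close>

lemma psd_energy_nonneg:
  fixes k :: "'a \<Rightarrow> 'a \<Rightarrow> real"
  assumes P: "prob_space P" "prob_space Q" and S: "sets P = sets Z" "sets Q = sets Z"
    and k: "case_prod k \<in> borel_measurable (Z \<Otimes>\<^sub>M Z)" and psd: "psd (space Z) k"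
    and bd: "\<And>x y. x \<in> space Z \<Longrightarrow> y \<in> space Z \<Longrightarrow> \<bar>k x y\<bar> \<le> C"
  shows "0 \<le> (\<integral>z. k (fst z) (snd z) \<partial>(P \<Otimes>\<^sub>M P)) + (\<integral>z. k (fst z) (snd z) \<partial>(Q \<Otimes>\<^sub>M Q))
      - 2 * (\<integral>z. k (fst z) (snd z) \<partial>(P \<Otimes>\<^sub>M Q))"
proof -
  interpret P: prob_space P by fact
  interpret Q: prob_space Q by fact
  interpret PQ: pair_prob_space P Q ..
  interpret N2: pair_prob_space "P \<Otimes>\<^sub>M Q" "P \<Otimes>\<^sub>M Q" ..
  let ?N = "P \<Otimes>\<^sub>M Q"
  have sp: "space P = space Z" "space Q = space Z"
    using S sets_eq_imp_space_eq by blast+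
  have km[measurable]: "(\<lambda>z. k (fst z) (snd z)) \<in> borel_measurable (A \<Otimes>\<^sub>M B)" if "sets A = sets Z" "sets B = sets Z" for A B
    using k sets_pair_measure_cong[OF that] by (simp add: case_prod_beta' cong: measurable_cong_sets)
  define H where "H z = k (fst (fst z)) (fst (snd z)) - k (fst (fst z)) (snd (snd z))
      - k (snd (fst z)) (fst (snd z)) + k (snd (fst z)) (snd (snd z))" for z
  have comp: "(\<lambda>z. k (f z) (g z)) \<in> borel_measurable (?N \<Otimes>\<^sub>M ?N)"
    if "f \<in> measurable (?N \<Otimes>\<^sub>M ?N) Z" "g \<in> measurable (?N \<Otimes>\<^sub>M ?N) Z" for f g
    using measurable_compose[OF measurable_Pair[OF that] k] by simp
  have pr: "(\<lambda>z. fst (fst z)) \<in> measurable (?N \<Otimes>\<^sub>M ?N) Z" "(\<lambda>z. snd (fst z)) \<in> measurable (?N \<Otimes>\<^sub>M ?N) Z"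
    "(\<lambda>z. fst (snd z)) \<in> measurable (?N \<Otimes>\<^sub>M ?N) Z" "(\<lambda>z. snd (snd z)) \<in> measurable (?N \<Otimes>\<^sub>M ?N) Z"
    using S by (auto cong: measurable_cong_sets)
  note cm[measurable] = comp[OF pr(1) pr(3)] comp[OF pr(1) pr(4)] comp[OF pr(2) pr(3)] comp[OF pr(2) pr(4)]
  have int: "integrable (?N \<Otimes>\<^sub>M ?N) (\<lambda>z. k (fst (fst z)) (fst (snd z)))"
      "integrable (?N \<Otimes>\<^sub>M ?N) (\<lambda>z. k (fst (fst z)) (snd (snd z)))"
      "integrable (?N \<Otimes>\<^sub>M ?N) (\<lambda>z. k (snd (fst z)) (fst (snd z)))"
      "integrable (?N \<Otimes>\<^sub>M ?N) (\<lambda>z. k (snd (fst z)) (snd (snd z)))"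
    using bd sp by (auto intro!: N2.integrable_const_bound[where B = C] simp: space_pair_measure)
  have "0 \<le> (\<integral>z. H z \<partial>(?N \<Otimes>\<^sub>M ?N))"
  proof (rule integral_kernel_nonneg[where C = "4 * C"])
    show "prob_space ?N" by (rule PQ.prob_space_axioms)
    show "H \<in> borel_measurable (?N \<Otimes>\<^sub>M ?N)" unfolding H_def[abs_def] by measurable
    show "\<bar>H z\<bar> \<le> 4 * C" if "z \<in> space (?N \<Otimes>\<^sub>M ?N)" for z
    proof -
      have "fst (fst z) \<in> space Z" "snd (fst z) \<in> space Z" "fst (snd z) \<in> space Z" "snd (snd z) \<in> space Z"
        using that sp by (auto simp: space_pair_measure)
      then show ?thesis unfolding H_def
        using bd[of "fst (fst z)" "fst (snd z)"] bd[of "fst (fst z)" "snd (snd z)"]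
          bd[of "snd (fst z)" "fst (snd z)"] bd[of "snd (fst z)" "snd (snd z)"] by linarith
    qed
    fix n :: nat and x assume x: "\<And>i. i < n \<Longrightarrow> x i \<in> space ?N"
    \<comment> \<open>The \<open>n\<close> sampled pairs are unfolded into 2n points: first
      components with weight 1, then second components with weight -1.\<close>
    define y where "y i = (if i < n then fst (x i) else snd (x (i - n)))" for i
    define b :: "nat \<Rightarrow> real" where "b i = (if i < n then 1 else - 1)" for i
    have "0 \<le> (\<Sum>i<n + n. \<Sum>j<n + n. b i * b j * k (y i) (y j))"
      using x sp by (intro psdD[OF psd]) (auto simp: y_def space_pair_measure mem_Times_iff)
    also have "\<dots> = (\<Sum>i<n. \<Sum>j<n. H (x i, x j))"
      by (simp add: sum_lessThan_add y_def b_def H_def sum.distrib sum_subtractf sum_negf)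
    finally show "0 \<le> (\<Sum>i<n. \<Sum>j<n. H (x i, x j))" .
  qed
  also have "(\<integral>z. H z \<partial>(?N \<Otimes>\<^sub>M ?N)) = (\<integral>z. k (fst (fst z)) (fst (snd z)) \<partial>(?N \<Otimes>\<^sub>M ?N))
      - (\<integral>z. k (fst (fst z)) (snd (snd z)) \<partial>(?N \<Otimes>\<^sub>M ?N))
      - (\<integral>z. k (snd (fst z)) (fst (snd z)) \<partial>(?N \<Otimes>\<^sub>M ?N))
      + (\<integral>z. k (snd (fst z)) (snd (snd z)) \<partial>(?N \<Otimes>\<^sub>M ?N))"
    unfolding H_def using int by simp
  also have "(\<integral>z. k (fst (fst z)) (fst (snd z)) \<partial>(?N \<Otimes>\<^sub>M ?N)) = (\<integral>z. k (fst z) (snd z) \<partial>(P \<Otimes>\<^sub>M P))"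
    using km[OF S(1) S(1)]
    by (subst pair_distr_fst_snd(1)[OF P P, symmetric], subst integral_distr) (auto simp: case_prod_beta')
  also have "(\<integral>z. k (fst (fst z)) (snd (snd z)) \<partial>(?N \<Otimes>\<^sub>M ?N)) = (\<integral>z. k (fst z) (snd z) \<partial>(P \<Otimes>\<^sub>M Q))"
    using km[OF S(1) S(2)]
    by (subst (3) pair_distr_fst_snd(2)[OF P P, symmetric], subst integral_distr) (auto simp: case_prod_beta')
  also have "(\<integral>z. k (snd (fst z)) (fst (snd z)) \<partial>(?N \<Otimes>\<^sub>M ?N)) = (\<integral>z. k (fst z) (snd z) \<partial>(Q \<Otimes>\<^sub>M P))"
    using km[OF S(2) S(1)]
    by (subst pair_distr_fst_snd(3)[OF P P, symmetric], subst integral_distr) (auto simp: case_prod_beta')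
  also have "(\<integral>z. k (snd (fst z)) (snd (snd z)) \<partial>(?N \<Otimes>\<^sub>M ?N)) = (\<integral>z. k (fst z) (snd z) \<partial>(Q \<Otimes>\<^sub>M Q))"
    using km[OF S(2) S(2)]
    by (subst pair_distr_fst_snd(4)[OF P P, symmetric], subst integral_distr) (auto simp: case_prod_beta')
  also have "(\<integral>z. k (fst z) (snd z) \<partial>(Q \<Otimes>\<^sub>M P)) = (\<integral>z. k (fst z) (snd z) \<partial>(P \<Otimes>\<^sub>M Q))"
    by (rule integral_symmetric_swap[OF P S k psd_sym[OF psd]])
  finally show ?thesis by simp
qed

text \<open>Nonnegativity of the energy for the kernel of \<open>centre_exp_psd\<close>: the rank
  one part that was subtracted has as its energy exactly the left-hand side. A vanishing Gaussian
  energy therefore forces equal integrals of \<open>exp (- f)\<close>.\<close>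

lemma energy_lower_bound:
  fixes R :: "'a \<Rightarrow> 'a \<Rightarrow> real"
  assumes P: "prob_space P" "prob_space Q" and S: "sets P = sets Z" "sets Q = sets Z"
    and R: "case_prod R \<in> borel_measurable (Z \<Otimes>\<^sub>M Z)"
    and nonneg: "\<And>x y. x \<in> space Z \<Longrightarrow> y \<in> space Z \<Longrightarrow> 0 \<le> R x y"
    and zero: "\<And>x. x \<in> space Z \<Longrightarrow> R x x = 0"
    and f: "f \<in> borel_measurable Z" and psd: "psd (space Z) (\<lambda>x y. f x + f y - \<kappa> - R x y)"
  shows "exp \<kappa> * ((\<integral>x. exp (- f x) \<partial>P) - (\<integral>x. exp (- f x) \<partial>Q))\<^sup>2
    \<le> (\<integral>z. exp (- R (fst z) (snd z)) \<partial>(P \<Otimes>\<^sub>M P)) + (\<integral>z. exp (- R (fst z) (snd z)) \<partial>(Q \<Otimes>\<^sub>M Q))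
      - 2 * (\<integral>z. exp (- R (fst z) (snd z)) \<partial>(P \<Otimes>\<^sub>M Q))"
proof -
  have lb: "\<kappa> / 2 \<le> f x" if "x \<in> space Z" for x
    using psdD[OF psd, of "Suc 0" "\<lambda>_. x" "\<lambda>_. 1"] that zero by (simp add: lessThan_Suc)
  define k where "k x y = exp (- R x y) - exp \<kappa> * (exp (- f x) * exp (- f y))" for x y
  have kpsd: "psd (space Z) k" unfolding k_def[abs_def] by (rule centre_exp_psd[OF psd])
  have [measurable]: "(\<lambda>z. R (fst z) (snd z)) \<in> borel_measurable (Z \<Otimes>\<^sub>M Z)"
    using R by (simp add: case_prod_beta')
  note f[measurable]
  have km: "case_prod k \<in> borel_measurable (Z \<Otimes>\<^sub>M Z)" unfolding k_def case_prod_beta' by measurable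
  have b1: "exp (- f x) \<le> exp (- \<kappa> / 2)" if "x \<in> space Z" for x using lb[OF that] by simp
  have b2: "exp (- R x y) \<le> 1" if "x \<in> space Z" "y \<in> space Z" for x y using nonneg[OF that] by simp
  have b3: "exp \<kappa> * (exp (- f x) * exp (- f y)) \<le> 1" if "x \<in> space Z" "y \<in> space Z" for x y
    using lb[OF that(1)] lb[OF that(2)] by (simp add: mult_exp_exp)
  have expand: "(\<integral>z. k (fst z) (snd z) \<partial>(A \<Otimes>\<^sub>M B)) = (\<integral>z. exp (- R (fst z) (snd z)) \<partial>(A \<Otimes>\<^sub>M B))
      - exp \<kappa> * ((\<integral>x. exp (- f x) \<partial>A) * (\<integral>x. exp (- f x) \<partial>B))"
    if A: "prob_space A" "sets A = sets Z" and B: "prob_space B" "sets B = sets Z" for A B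
  proof -
    interpret A: prob_space A by fact
    interpret B: prob_space B by fact
    interpret pair_prob_space A B ..
    note [measurable_cong] = A(2) B(2) sets_pair_measure_cong[OF A(2) B(2)]
    have sp: "space A = space Z" "space B = space Z" using A B sets_eq_imp_space_eq by blast+
    have i1: "integrable (A \<Otimes>\<^sub>M B) (\<lambda>z. exp (- R (fst z) (snd z)))"
      using b2 sp by (intro integrable_const_bound[where B = 1]) (auto simp: space_pair_measure)
    have i2: "integrable (A \<Otimes>\<^sub>M B) (\<lambda>z. exp \<kappa> * (exp (- f (fst z)) * exp (- f (snd z))))"
      using b3 sp by (intro integrable_const_bound[where B = 1]) (auto simp: space_pair_measure abs_mult)
    have "(\<integral>z. exp \<kappa> * (exp (- f (fst z)) * exp (- f (snd z))) \<partial>(A \<Otimes>\<^sub>M B))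
        = (\<integral>x. \<integral>y. exp \<kappa> * (exp (- f x) * exp (- f y)) \<partial>B \<partial>A)"
      using integral_fst'[OF i2] by simp
    then show ?thesis unfolding k_def using i1 i2 by (simp add: mult_ac)
  qed
  have "0 \<le> (\<integral>z. k (fst z) (snd z) \<partial>(P \<Otimes>\<^sub>M P)) + (\<integral>z. k (fst z) (snd z) \<partial>(Q \<Otimes>\<^sub>M Q))
      - 2 * (\<integral>z. k (fst z) (snd z) \<partial>(P \<Otimes>\<^sub>M Q))"
  proof (rule psd_energy_nonneg[OF P S km kpsd, where C = 1])
    fix x y assume xy: "x \<in> space Z" "y \<in> space Z"
    have "0 < exp (- R x y)" "0 \<le> exp \<kappa> * (exp (- f x) * exp (- f y))" by simp_all
    then show "\<bar>k x y\<bar> \<le> 1" unfolding k_def using b2[OF xy] b3[OF xy] by linarith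
  qed
  then show ?thesis
    using P S by (simp add: expand power2_eq_square algebra_simps)
qed

section \<open>Square roots as mixtures\<close>

text \<open>The indicator cuts the scale down to u > 0 while integrals run over all of
  \<open>lborel\<close>. Values in \<open>ennreal\<close> let Tonelli apply even when the energies
  are infinite.\<close>

definition sqrt_mix :: "real \<Rightarrow> real \<Rightarrow> ennreal" where
  "sqrt_mix u r = indicator {0<..} u * ennreal ((1 - exp (- (u\<^sup>2 * r))) / u\<^sup>2)"

lemma sqrt_mix_measurable[measurable]:
  assumes [measurable]: "f \<in> borel_measurable M" "g \<in> borel_measurable M"
  shows "(\<lambda>x. sqrt_mix (f x) (g x)) \<in> borel_measurable M"
  unfolding sqrt_mix_def by measurable

text \<open>Rescaling u by \<open>sqrt r\<close> reduces every r > 0 to r = 1, so the constant is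
  the integral at 1. It is finite because the integrand is at most 2 / (1 + u^2), and positive
  because the integrand is positive on (0,1).\<close>

lemma sqrt_mixture:
  obtains c where "0 < c" "\<And>r. 0 \<le> r \<Longrightarrow> (\<integral>\<^sup>+u. sqrt_mix u r \<partial>lborel) = ennreal (c * sqrt r)"
proof -
  define c0 where "c0 = (\<integral>\<^sup>+u. sqrt_mix u 1 \<partial>lborel)"
  have "c0 \<le> (\<integral>\<^sup>+u. ennreal (2 * (indicator {0<..} u * (1 / (1 + u\<^sup>2)))) \<partial>lborel)"
    unfolding c0_def
  proof (rule nn_integral_mono)
    fix u :: real
    show "sqrt_mix u 1 \<le> ennreal (2 * (indicator {0<..} u * (1 / (1 + u\<^sup>2))))"
    proof (cases "0 < u")
      case True
      define y where "y = u\<^sup>2"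
      have y: "0 < y" using True by (simp add: y_def)
      have "1 - exp (- y) \<le> y" using exp_ge_add_one_self[of "- y"] by simp
      moreover have "y * (1 - exp (- y)) \<le> y * 1" using y by (intro mult_left_mono) auto
      ultimately have "(1 - exp (- y)) * (1 + y) \<le> 2 * y" by (simp add: algebra_simps)
      then have "(1 - exp (- y)) / y \<le> 2 / (1 + y)" using y by (simp add: field_simps)
      then show ?thesis using True by (simp add: sqrt_mix_def y_def[symmetric] ennreal_leI)
    qed (simp add: sqrt_mix_def)
  qed
  also have "\<dots> < \<infinity>"
  proof -
    have "set_integrable lborel {0<..} (\<lambda>u::real. 1 / (1 + u\<^sup>2))"
      using integrable_I0i_1_div_plus_square by (simp add: interval_lebesgue_integrable_def zero_ereal_def[symmetric] einterval_def greaterThan_def)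
    then have "integrable lborel (\<lambda>u::real. 2 * (indicator {0<..} u * (1 / (1 + u\<^sup>2))))"
      unfolding set_integrable_def real_scaleR_def by (rule integrable_mult_right)
    then show ?thesis
      using integrableD(2) by (subst nn_integral_eq_integral) (auto simp: indicator_def)
  qed
  finally have fin: "c0 < \<infinity>" .
  have "c0 \<noteq> 0"
  proof
    assume "c0 = 0"
    then have "AE u in lborel. sqrt_mix u 1 = 0"
      unfolding c0_def by (subst (asm) nn_integral_0_iff_AE) auto
    then have "AE u in lborel. u \<notin> {0<..<1::real}"
      by eventually_elim (auto simp: sqrt_mix_def ennreal_eq_0_iff divide_le_0_iff)
    then have "emeasure lborel {0<..<1::real} = 0"
      by (subst (asm) AE_iff_measurable[of "{0<..<1}"]) auto
    then show False by simp
  qed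
  define c where "c = enn2real c0"
  have c: "c0 = ennreal c" "0 < c"
    using fin \<open>c0 \<noteq> 0\<close> by (auto simp: c_def enn2real_positive_iff zero_less_iff_neq_zero)
  have "(\<integral>\<^sup>+u. sqrt_mix u r \<partial>lborel) = ennreal (c * sqrt r)" if "0 \<le> r" for r
  proof (cases "r = 0")
    case True
    then show ?thesis by (simp add: sqrt_mix_def)
  next
    case False
    then have r: "0 < r" using that by simp
    define s where "s = sqrt r"
    have s: "0 < s" "s * s = r" "s\<^sup>2 = r" using r by (auto simp: s_def)
    have scale: "sqrt_mix (0 + 1 / s * v) r = ennreal r * sqrt_mix v 1" for v
    proof (cases "0 < v")
      case True
      define w where "w = 0 + 1 / s * v"
      have w: "0 < w" "w\<^sup>2 = v\<^sup>2 / r" using s True by (auto simp: w_def power_divide)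
      have "sqrt_mix w r = ennreal ((1 - exp (- (w\<^sup>2 * r))) / w\<^sup>2)"
        using w(1) by (simp add: sqrt_mix_def)
      also have "(1 - exp (- (w\<^sup>2 * r))) / w\<^sup>2 = r * ((1 - exp (- (v\<^sup>2))) / v\<^sup>2)"
        unfolding w(2) using r True by simp
      also have "ennreal \<dots> = ennreal r * ennreal ((1 - exp (- (v\<^sup>2))) / v\<^sup>2)"
        by (rule ennreal_mult') (use r in simp)
      also have "\<dots> = ennreal r * sqrt_mix v 1" using True by (simp add: sqrt_mix_def)
      finally show ?thesis by (simp only: w_def)
    next
      case False
      then show ?thesis using s by (simp add: sqrt_mix_def zero_less_divide_iff)
    qed
    have "(\<integral>\<^sup>+u. sqrt_mix u r \<partial>lborel) = \<bar>1 / s\<bar> * (\<integral>\<^sup>+v. sqrt_mix (0 + 1 / s * v) r \<partial>lborel)"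
      using s by (intro nn_integral_real_affine) auto
    also have "\<dots> = ennreal (1 / s) * (ennreal r * c0)"
      unfolding scale using s by (simp add: nn_integral_cmult c0_def)
    also have "\<dots> = ennreal (1 / s * (r * c))"
      unfolding c(1) using s r by (simp only: ennreal_mult'[symmetric] less_imp_le zero_le_divide_1_iff)
    also have "1 / s * (r * c) = c * s" using s by (simp add: field_simps power2_eq_square)
    finally show ?thesis by (simp add: s_def)
  qed
  with c(2) that show ?thesis by blast
qed

text \<open>What the covariance argument needs from a distance, shared by both cases and stable
  under sums over blocks. The factors 2 in the triangle inequality accommodate squared distances, by
  (a + b)^2 <= 2 a^2 + 2 b^2. Every scale \<open>t > 0\<close> is included because the mixture
  multiplies the distances by u^2 and v^2.\<close>

definition admissible :: "'a measure \<Rightarrow> ('a \<Rightarrow> 'a \<Rightarrow> real) \<Rightarrow> bool" where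
  "admissible B \<rho> \<longleftrightarrow> case_prod \<rho> \<in> borel_measurable (B \<Otimes>\<^sub>M B) \<and>
     (\<forall>x\<in>space B. \<rho> x x = 0) \<and>
     (\<forall>x\<in>space B. \<forall>y\<in>space B. 0 \<le> \<rho> x y \<and> \<rho> x y = \<rho> y x) \<and>
     (\<forall>x\<in>space B. \<forall>y\<in>space B. \<forall>z\<in>space B. \<rho> x y \<le> 2 * \<rho> x z + 2 * \<rho> z y) \<and>
     (\<forall>z\<in>space B. centre (space B) \<rho> (\<rho> z)) \<and>
     (\<forall>t>0. gauss_determining B (\<lambda>x y. t * \<rho> x y))"

lemma admissibleD:
  assumes "admissible B \<rho>"
  shows "case_prod \<rho> \<in> borel_measurable (B \<Otimes>\<^sub>M B)"
    and "x \<in> space B \<Longrightarrow> \<rho> x x = 0"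
    and "x \<in> space B \<Longrightarrow> y \<in> space B \<Longrightarrow> 0 \<le> \<rho> x y"
    and "x \<in> space B \<Longrightarrow> y \<in> space B \<Longrightarrow> \<rho> x y = \<rho> y x"
    and "x \<in> space B \<Longrightarrow> y \<in> space B \<Longrightarrow> z \<in> space B \<Longrightarrow> \<rho> x y \<le> 2 * \<rho> x z + 2 * \<rho> z y"
    and "z \<in> space B \<Longrightarrow> centre (space B) \<rho> (\<rho> z)"
    and "0 < t \<Longrightarrow> gauss_determining B (\<lambda>x y. t * \<rho> x y)"
  using assms unfolding admissible_def by blast+

text \<open>\<open>case_S2\<close> prescribes the distance only for points of the space, so it has
  to be exchanged for the explicit formula.\<close>

lemma admissible_cong:
  assumes eq: "\<And>x y. x \<in> space B \<Longrightarrow> y \<in> space B \<Longrightarrow> R x y = R' x y" and R': "admissible B R'"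
  shows "admissible B R"
proof -
  have "case_prod R \<in> borel_measurable (B \<Otimes>\<^sub>M B)"
    using R' eq unfolding admissible_def
    by (subst measurable_cong[where g = "case_prod R'"]) (auto simp: space_pair_measure)
  moreover have "gauss_determining B (\<lambda>x y. t * R x y)" if "0 < t" for t
  proof -
    have "gauss_determining B (\<lambda>x y. t * R x y) \<longleftrightarrow> gauss_determining B (\<lambda>x y. t * R' x y)" by (rule gauss_determining_cong) (simp add: eq)
    then show ?thesis using R' that by (simp add: admissible_def)
  qed
  moreover have "centre (space B) R (R z)" if z: "z \<in> space B" for z
  proof -
    from R' z obtain \<kappa> where "psd (space B) (\<lambda>x y. R' z x + R' z y - \<kappa> - R' x y)"
      unfolding admissible_def centre_def by blast
    then have "psd (space B) (\<lambda>x y. R z x + R z y - \<kappa> - R x y)"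
      by (rule psd_cong[THEN iffD1, rotated]) (simp add: eq z)
    then show ?thesis unfolding centre_def by (rule exI)
  qed
  moreover have "R x y \<le> 2 * R x z + 2 * R z y" if "x \<in> space B" "y \<in> space B" "z \<in> space B" for x y z
    unfolding eq[OF that(1,2)] eq[OF that(1,3)] eq[OF that(3,2)]
    using R' that unfolding admissible_def by blast
  moreover have "R x y = R y x" if "x \<in> space B" "y \<in> space B" for x y
    unfolding eq[OF that] eq[OF that(2,1)] using R' that unfolding admissible_def by blast
  moreover have "R x x = 0" "0 \<le> R x y" if "x \<in> space B" "y \<in> space B" for x y
    unfolding eq[OF that] eq[OF that(1,1)] using R' that unfolding admissible_def by blast+
  ultimately show ?thesis unfolding admissible_def by blast
qed

text \<open>Used on two levels: real coordinates form a block with squared Euclidean distance, and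
  blocks form the whole vector.\<close>

lemma admissible_PiM:
  assumes I: "finite I" and adm: "\<And>i. i \<in> I \<Longrightarrow> admissible (B i) (R i)"
  shows "admissible (PiM I B) (\<lambda>x y. \<Sum>i\<in>I. R i (x i) (y i))"
  unfolding admissible_def
proof (intro conjI ballI allI impI)
  have sp: "x i \<in> space (B i)" if "x \<in> space (PiM I B)" "i \<in> I" for x i
    using that by (auto simp: space_PiM)
  show "(\<lambda>(x, y). \<Sum>i\<in>I. R i (x i) (y i)) \<in> borel_measurable (PiM I B \<Otimes>\<^sub>M PiM I B)"
    unfolding case_prod_beta'
  proof (rule borel_measurable_sum)
    fix i assume i: "i \<in> I"
    have "(\<lambda>z. (fst z i, snd z i)) \<in> measurable (PiM I B \<Otimes>\<^sub>M PiM I B) (B i \<Otimes>\<^sub>M B i)"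
      using i by measurable
    from measurable_compose[OF this admissibleD(1)[OF adm[OF i]]]
    show "(\<lambda>z. R i (fst z i) (snd z i)) \<in> borel_measurable (PiM I B \<Otimes>\<^sub>M PiM I B)" by simp
  qed
  show "(\<Sum>i\<in>I. R i (x i) (x i)) = 0" if "x \<in> space (PiM I B)" for x
    using sp[OF that] by (intro sum.neutral ballI admissibleD(2)[OF adm])
  show "0 \<le> (\<Sum>i\<in>I. R i (x i) (y i))" if "x \<in> space (PiM I B)" "y \<in> space (PiM I B)" for x y
    by (intro sum_nonneg admissibleD(3)[OF adm] sp[OF that(1)] sp[OF that(2)])
  show "(\<Sum>i\<in>I. R i (x i) (y i)) = (\<Sum>i\<in>I. R i (y i) (x i))"
    if "x \<in> space (PiM I B)" "y \<in> space (PiM I B)" for x y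
    by (intro sum.cong refl admissibleD(4)[OF adm] sp[OF that(1)] sp[OF that(2)])
  show "(\<Sum>i\<in>I. R i (x i) (y i)) \<le> 2 * (\<Sum>i\<in>I. R i (x i) (z i)) + 2 * (\<Sum>i\<in>I. R i (z i) (y i))"
    if "x \<in> space (PiM I B)" "y \<in> space (PiM I B)" "z \<in> space (PiM I B)" for x y z
    unfolding sum_distrib_left sum.distrib[symmetric]
    by (intro sum_mono admissibleD(5)[OF adm] sp[OF that(1)] sp[OF that(2)] sp[OF that(3)])
  show "centre (space (PiM I B)) (\<lambda>x y. \<Sum>i\<in>I. R i (x i) (y i)) (\<lambda>x. \<Sum>i\<in>I. R i (z i) (x i))"
    if "z \<in> space (PiM I B)" for z
  proof (rule centre_sum[where h = "\<lambda>i x. x i" and T = "\<lambda>i. space (B i)" and f = "\<lambda>i. R i (z i)"])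
    show "centre (space (B i)) (R i) (R i (z i))" if "i \<in> I" for i
      using admissibleD(6)[OF adm[OF that]] sp[OF \<open>z \<in> space (PiM I B)\<close> that] by simp
  qed (rule sp)
  show "gauss_determining (PiM I B) (\<lambda>x y. t * (\<Sum>i\<in>I. R i (x i) (y i)))" if "0 < t" for t
    unfolding sum_distrib_left
    by (rule gauss_determining_PiM[OF I, where R = "\<lambda>i x y. t * R i x y"])
       (use admissibleD(7)[OF adm that] admissibleD(2)[OF adm] in simp_all)
qed

lemma admissible_strong_negative_type:
  assumes met: "Metric_space (space B) \<rho>" and meas: "case_prod \<rho> \<in> borel_measurable (B \<Otimes>\<^sub>M B)"
    and snt: "strong_negative_type B \<rho>"
  shows "admissible B \<rho>"
proof -
  interpret Metric_space "space B" \<rho> by fact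
  have nt: "negative_type (space B) \<rho>" using snt by (simp add: strong_negative_type_def)
  \<comment> \<open>With \<open>h = 0\<close> the affine combination is the point \<open>z\<close>
    itself.\<close>
  have "centre (space B) \<rho> (\<rho> z)" if "z \<in> space B" for z
    using negative_type_centre[OF nt commute _ that that that, of 0] by simp
  moreover have "\<rho> x y \<le> 2 * \<rho> x z + 2 * \<rho> z y" if "x \<in> space B" "y \<in> space B" "z \<in> space B" for x y z
    using triangle[OF that(1,3,2)] nonneg[of x z] nonneg[of z y] by linarith
  ultimately show ?thesis
    unfolding admissible_def using meas gauss_determining_strong_negative_type[OF met meas snt] commute by auto
qed

lemma admissible_real: "admissible borel (\<lambda>x y :: real. (x - y)\<^sup>2)"
  unfolding admissible_def
proof (intro conjI ballI allI impI)
  show "(\<lambda>(x, y). (x - y)\<^sup>2) \<in> borel_measurable (borel \<Otimes>\<^sub>M borel :: (real \<times> real) measure)"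
    by measurable
  fix x y z :: real
  have "0 \<le> ((x - z) - (z - y))\<^sup>2" by simp
  then show "(x - y)\<^sup>2 \<le> 2 * (x - z)\<^sup>2 + 2 * (z - y)\<^sup>2"
    by (simp add: power2_eq_square algebra_simps)
  have "psd (space borel) (\<lambda>x y :: real. 2 * ((x - z) * (y - z)))"
    by (intro psd_scale psd_rank_one) simp
  then have "psd (space borel) (\<lambda>x y. (z - x)\<^sup>2 + (z - y)\<^sup>2 - 0 - (x - y)\<^sup>2)"
    by (rule psd_cong[THEN iffD1, rotated]) (simp add: power2_eq_square algebra_simps)
  then show "centre (space borel) (\<lambda>x y. (x - y)\<^sup>2) (\<lambda>x. (z - x)\<^sup>2)"
    unfolding centre_def by (rule exI)
qed (auto simp: gauss_determining_real power2_commute)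

section \<open>Distance covariance\<close>

lemma (in prob_space) AE_imp_ex:
  assumes "AE x in M. P x"
  obtains x where "x \<in> space M" "P x"
proof -
  have "\<exists>x\<in>space M. P x"
  proof (rule ccontr)
    assume no: "\<not> ?thesis"
    have "AE x in M. False" using assms by (rule AE_mp) (use no in auto)
    then show False by simp
  qed
  then show ?thesis using that by blast
qed

lemma sqrt_quasi_triangle:
  assumes "admissible B \<rho>" "x \<in> space B" "y \<in> space B" "z \<in> space B"
  shows "sqrt (\<rho> x y) \<le> 2 * (sqrt (\<rho> x z) + sqrt (\<rho> z y))"
proof -
  have nn: "0 \<le> \<rho> x z" "0 \<le> \<rho> z y"
    using admissibleD(3)[OF assms(1)] assms(2-) by auto
  have "sqrt (\<rho> x y) \<le> sqrt (2 * \<rho> x z + 2 * \<rho> z y)"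
    using admissibleD(5)[OF assms] by simp
  also have "\<dots> \<le> sqrt (4 * \<rho> x z) + sqrt (4 * \<rho> z y)"
    using nn by (intro order_trans[OF _ sqrt_add_le_add_sqrt]) auto
  also have "\<dots> = 2 * (sqrt (\<rho> x z) + sqrt (\<rho> z y))"
    by (simp add: real_sqrt_mult)
  finally show ?thesis .
qed

text \<open>Here \<open>P\<close> stands for the law of (X,Y) and the random vectors become the two
  projections. The base points \<open>oX\<close>, \<open>oY\<close> stand for the origins; the
  moment assumptions concern each component separately, never their product.\<close>

locale coupled_kernels = P: prob_space P
  for P :: "('a \<times> 'b) measure" +
  fixes BX :: "'a measure" and BY :: "'b measure"
    and \<rho>X :: "'a \<Rightarrow> 'a \<Rightarrow> real" and \<rho>Y :: "'b \<Rightarrow> 'b \<Rightarrow> real"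
    and oX :: 'a and oY :: 'b
  assumes sets_P: "sets P = sets (BX \<Otimes>\<^sub>M BY)"
    and admX: "admissible BX \<rho>X" and admY: "admissible BY \<rho>Y"
    and oX: "oX \<in> space BX" and oY: "oY \<in> space BY"
    and momX: "(\<integral>\<^sup>+z. ennreal (sqrt (\<rho>X (fst z) oX)) \<partial>P) < \<infinity>"
    and momY: "(\<integral>\<^sup>+z. ennreal (sqrt (\<rho>Y (snd z) oY)) \<partial>P) < \<infinity>"
begin

abbreviation "Z \<equiv> BX \<Otimes>\<^sub>M BY"

definition "PX = distr P BX fst"
definition "PY = distr P BY snd"
definition "Q = PX \<Otimes>\<^sub>M PY"

definition kern :: "('a \<times> 'b) \<times> ('a \<times> 'b) \<Rightarrow> real" where
  "kern z = sqrt (\<rho>X (fst (fst z)) (fst (snd z))) * sqrt (\<rho>Y (snd (fst z)) (snd (snd z)))"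

text \<open>The squared distance covariance is the energy of P - Q, with \<open>Q\<close> the
  product of the marginals: \<open>energy P P\<close> is its first term, \<open>energy Q Q\<close>
  the product of the two means, and \<open>energy P Q\<close> the expectation over three copies,
  since (X',Y'') has law \<open>Q\<close>.\<close>

definition energy :: "('a \<times> 'b) measure \<Rightarrow> ('a \<times> 'b) measure \<Rightarrow> ennreal" where
  "energy A B = (\<integral>\<^sup>+z. ennreal (kern z) \<partial>(A \<Otimes>\<^sub>M B))"

lemma fst_P: "fst \<in> measurable P BX" and snd_P: "snd \<in> measurable P BY"
  by (simp_all cong: measurable_cong_sets[OF sets_P refl])

sublocale PX: prob_space PX unfolding PX_def by (rule P.prob_space_distr[OF fst_P])
sublocale PY: prob_space PY unfolding PY_def by (rule P.prob_space_distr[OF snd_P])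
sublocale XY: pair_prob_space PX PY ..

lemma sets_marginal: "sets PX = sets BX" "sets PY = sets BY" "space PX = space BX" "space PY = space BY"
  by (simp_all add: PX_def PY_def)

lemma sets_Q: "sets Q = sets Z"
  unfolding Q_def by (rule sets_pair_measure_cong) (simp_all add: sets_marginal)

lemma prob_Q: "prob_space Q"
  unfolding Q_def by (rule XY.prob_space_axioms)

sublocale Q: prob_space Q by (rule prob_Q)

lemma space_PQ: "space P = space BX \<times> space BY" "space Q = space BX \<times> space BY"
  using sets_eq_imp_space_eq[OF sets_P] sets_eq_imp_space_eq[OF sets_Q] by (simp_all add: space_pair_measure)

lemma marginal_Q: "distr Q BX fst = PX" "distr Q BY snd = PY"
proof -
  have "distr Q BX fst = distr (PX \<Otimes>\<^sub>M PY) PX fst" unfolding Q_def by (rule distr_cong) (simp_all add: sets_marginal)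
  then show "distr Q BX fst = PX" using PY.distr_pair_fst[of PX] by simp
  have "distr Q BY snd = distr (distr (PY \<Otimes>\<^sub>M PX) (PX \<Otimes>\<^sub>M PY) (\<lambda>(x, y). (y, x))) PY snd"
    unfolding Q_def by (subst XY.distr_pair_swap) (rule distr_cong, simp_all add: sets_marginal)
  also have "\<dots> = distr (PY \<Otimes>\<^sub>M PX) PY fst"
    by (subst distr_distr) (auto simp: comp_def case_prod_beta)
  finally show "distr Q BY snd = PY" using PX.distr_pair_fst[of PY] by simp
qed

lemma measurable_\<rho>X: "(\<lambda>z. \<rho>X (fst (fst z)) (fst (snd z))) \<in> borel_measurable (Z \<Otimes>\<^sub>M Z)"
proof -
  have "(\<lambda>z. (fst (fst z), fst (snd z))) \<in> measurable (Z \<Otimes>\<^sub>M Z) (BX \<Otimes>\<^sub>M BX)" by measurable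
  from measurable_compose[OF this admissibleD(1)[OF admX]] show ?thesis by simp
qed

lemma measurable_\<rho>Y: "(\<lambda>z. \<rho>Y (snd (fst z)) (snd (snd z))) \<in> borel_measurable (Z \<Otimes>\<^sub>M Z)"
proof -
  have "(\<lambda>z. (snd (fst z), snd (snd z))) \<in> measurable (Z \<Otimes>\<^sub>M Z) (BY \<Otimes>\<^sub>M BY)" by measurable
  from measurable_compose[OF this admissibleD(1)[OF admY]] show ?thesis by simp
qed

lemma measurable_kern: "kern \<in> borel_measurable (Z \<Otimes>\<^sub>M Z)"
  using measurable_\<rho>X measurable_\<rho>Y unfolding kern_def[abs_def] by measurable

lemma \<rho>_nonneg:
  assumes "z \<in> space (Z \<Otimes>\<^sub>M Z)"
  shows "0 \<le> \<rho>X (fst (fst z)) (fst (snd z))" "0 \<le> \<rho>Y (snd (fst z)) (snd (snd z))"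
  using assms admissibleD(3)[OF admX] admissibleD(3)[OF admY] by (auto simp: space_pair_measure)

lemma kern_nonneg: "z \<in> space (Z \<Otimes>\<^sub>M Z) \<Longrightarrow> 0 \<le> kern z"
  unfolding kern_def using \<rho>_nonneg by simp

definition mixed :: "('a \<times> 'b) measure \<Rightarrow> ('a \<times> 'b) measure \<Rightarrow> real \<times> real \<Rightarrow> ennreal" where
  "mixed A B q = (\<integral>\<^sup>+z. sqrt_mix (fst q) (\<rho>X (fst (fst z)) (fst (snd z)))
      * sqrt_mix (snd q) (\<rho>Y (snd (fst z)) (snd (snd z))) \<partial>(A \<Otimes>\<^sub>M B))"

text \<open>Each square root in \<open>kern\<close> is replaced by its mixture, which costs one
  factor \<open>c\<close> apiece; Tonelli then moves the integral over the scales outside.\<close>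

lemma energy_mixture:
  assumes c: "0 < c" "\<And>r. 0 \<le> r \<Longrightarrow> (\<integral>\<^sup>+u. sqrt_mix u r \<partial>lborel) = ennreal (c * sqrt r)"
    and A: "prob_space A" "sets A = sets Z" and B: "prob_space B" "sets B = sets Z"
  shows "ennreal (c * c) * energy A B = (\<integral>\<^sup>+q. mixed A B q \<partial>(lborel \<Otimes>\<^sub>M lborel))"
    and "mixed A B \<in> borel_measurable (lborel \<Otimes>\<^sub>M lborel)"
proof -
  interpret A: prob_space A by fact
  interpret B: prob_space B by fact
  interpret AB: pair_prob_space A B ..
  interpret L: pair_sigma_finite "lborel :: real measure" "lborel :: real measure" ..
  interpret W: pair_sigma_finite "A \<Otimes>\<^sub>M B" "lborel \<Otimes>\<^sub>M lborel :: (real \<times> real) measure" ..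
  note S[measurable_cong] = sets_pair_measure_cong[OF A(2) B(2)]
  note [measurable] = measurable_\<rho>X measurable_\<rho>Y measurable_kern
  let ?w = "\<lambda>z q. sqrt_mix (fst q) (\<rho>X (fst (fst z)) (fst (snd z)))
      * sqrt_mix (snd q) (\<rho>Y (snd (fst z)) (snd (snd z)))"
  have wm[measurable]: "(\<lambda>(z, q). ?w z q) \<in> borel_measurable ((A \<Otimes>\<^sub>M B) \<Otimes>\<^sub>M (lborel \<Otimes>\<^sub>M lborel))"
    unfolding case_prod_beta' by measurable
  have "ennreal (c * c) * energy A B = (\<integral>\<^sup>+z. ennreal (c * c) * ennreal (kern z) \<partial>(A \<Otimes>\<^sub>M B))"
    unfolding energy_def by (subst nn_integral_cmult) auto
  also have "\<dots> = (\<integral>\<^sup>+z. (\<integral>\<^sup>+q. ?w z q \<partial>(lborel \<Otimes>\<^sub>M lborel)) \<partial>(A \<Otimes>\<^sub>M B))"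
  proof (rule nn_integral_cong)
    fix z assume "z \<in> space (A \<Otimes>\<^sub>M B)"
    then have "z \<in> space (Z \<Otimes>\<^sub>M Z)" using sets_eq_imp_space_eq[OF S] by simp
    note nn = \<rho>_nonneg[OF this]
    have "(\<integral>\<^sup>+q. ?w z q \<partial>(lborel \<Otimes>\<^sub>M lborel)) = (\<integral>\<^sup>+u. \<integral>\<^sup>+v. ?w z (u, v) \<partial>lborel \<partial>lborel)"
      by (rule lborel.nn_integral_fst[symmetric]) measurable
    also have "\<dots> = ennreal (c * sqrt (\<rho>X (fst (fst z)) (fst (snd z)))) * ennreal (c * sqrt (\<rho>Y (snd (fst z)) (snd (snd z))))"
      by (simp add: nn_integral_cmult nn_integral_multc c(2) nn)
    also have "\<dots> = ennreal (c * c) * ennreal (kern z)"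
      using c(1) nn by (simp add: kern_def ennreal_mult'[symmetric] mult_ac)
    finally show "ennreal (c * c) * ennreal (kern z) = (\<integral>\<^sup>+q. ?w z q \<partial>(lborel \<Otimes>\<^sub>M lborel))" by simp
  qed
  also have "\<dots> = (\<integral>\<^sup>+q. \<integral>\<^sup>+z. ?w z q \<partial>(A \<Otimes>\<^sub>M B) \<partial>(lborel \<Otimes>\<^sub>M lborel))"
    using W.Fubini[OF wm] by simp
  finally show "ennreal (c * c) * energy A B = (\<integral>\<^sup>+q. mixed A B q \<partial>(lborel \<Otimes>\<^sub>M lborel))"
    by (simp only: mixed_def)
  show "mixed A B \<in> borel_measurable (lborel \<Otimes>\<^sub>M lborel)"
    unfolding mixed_def[abs_def] by measurable
qed

section \<open>Comparison of \<open>P\<close> and \<open>Q\<close> at fixed scales\<close>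

definition gaussE :: "('a \<times> 'b) measure \<Rightarrow> ('a \<times> 'b) measure \<Rightarrow> real \<Rightarrow> real \<Rightarrow> real" where
  "gaussE A B u v = (\<integral>z. exp (- (u\<^sup>2 * \<rho>X (fst (fst z)) (fst (snd z)) + v\<^sup>2 * \<rho>Y (snd (fst z)) (snd (snd z)))) \<partial>(A \<Otimes>\<^sub>M B))"

text \<open>Expansion of (1 - f)(1 - g) for the Gaussian factors f, g of the two components. Each of
  f and g alone sees only one marginal, so \<open>a\<close> and \<open>b\<close> do not depend on
  whether \<open>A\<close>, \<open>B\<close> are \<open>P\<close> or \<open>Q\<close>; in PP + QQ -
  2 PQ only the joint terms \<open>gaussE\<close> survive.\<close>

lemma mixed_eq:
  assumes A: "prob_space A" "sets A = sets Z" "distr A BX fst = PX" "distr A BY snd = PY"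
    and B: "prob_space B" "sets B = sets Z" "distr B BX fst = PX" "distr B BY snd = PY"
    and uv: "0 < u" "0 < v"
  defines "a \<equiv> (\<integral>z. exp (- (u\<^sup>2 * \<rho>X (fst z) (snd z))) \<partial>(PX \<Otimes>\<^sub>M PX))"
    and "b \<equiv> (\<integral>z. exp (- (v\<^sup>2 * \<rho>Y (fst z) (snd z))) \<partial>(PY \<Otimes>\<^sub>M PY))"
  shows "mixed A B (u, v) = ennreal ((1 - a - b + gaussE A B u v) / (u\<^sup>2 * v\<^sup>2))"
    and "0 \<le> 1 - a - b + gaussE A B u v"
proof -
  interpret A: prob_space A by fact
  interpret B: prob_space B by fact
  interpret AB: pair_prob_space A B ..
  note S[measurable_cong] = sets_pair_measure_cong[OF A(2) B(2)]
  note SA[measurable_cong] = A(2) B(2)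
  note [measurable] = measurable_\<rho>X measurable_\<rho>Y
  define f where "f z = exp (- (u\<^sup>2 * \<rho>X (fst (fst z)) (fst (snd z))))" for z :: "('a \<times> 'b) \<times> ('a \<times> 'b)"
  define g where "g z = exp (- (v\<^sup>2 * \<rho>Y (snd (fst z)) (snd (snd z))))" for z :: "('a \<times> 'b) \<times> ('a \<times> 'b)"
  have [measurable]: "f \<in> borel_measurable (Z \<Otimes>\<^sub>M Z)" "g \<in> borel_measurable (Z \<Otimes>\<^sub>M Z)"
    unfolding f_def[abs_def] g_def[abs_def] by measurable
  have sp: "space (A \<Otimes>\<^sub>M B) = space (Z \<Otimes>\<^sub>M Z)" by (rule sets_eq_imp_space_eq[OF S])
  have fg: "f z \<le> 1" "g z \<le> 1" "0 < f z" "0 < g z" if "z \<in> space (A \<Otimes>\<^sub>M B)" for z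
    using \<rho>_nonneg[of z] that uv by (simp_all add: f_def g_def sp)
  have fgm: "f z * g z \<le> 1" if "z \<in> space (A \<Otimes>\<^sub>M B)" for z
    using fg[OF that] by (intro mult_le_one) auto
  have int: "integrable (A \<Otimes>\<^sub>M B) f" "integrable (A \<Otimes>\<^sub>M B) g" "integrable (A \<Otimes>\<^sub>M B) (\<lambda>z. f z * g z)"
    using fg fgm by (auto intro!: AB.integrable_const_bound[where B = 1] simp: abs_of_pos abs_mult)
  have fa: "(\<integral>z. f z \<partial>(A \<Otimes>\<^sub>M B)) = a"
  proof -
    have eq: "PX \<Otimes>\<^sub>M PX = distr (A \<Otimes>\<^sub>M B) (BX \<Otimes>\<^sub>M BX) (\<lambda>(x, y). (fst x, fst y))"
      unfolding A(3)[symmetric] by (subst (2) A(3), subst B(3)[symmetric], rule pair_measure_distr)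
        (use PX.sigma_finite_measure_axioms in \<open>simp_all add: B(3)\<close>)
    have "(\<lambda>z. \<rho>X (fst z) (snd z)) \<in> borel_measurable (BX \<Otimes>\<^sub>M BX)"
      using admissibleD(1)[OF admX] by (simp add: case_prod_beta')
    then show ?thesis unfolding a_def eq f_def
      by (subst integral_distr) (auto simp: case_prod_beta')
  qed
  have gb: "(\<integral>z. g z \<partial>(A \<Otimes>\<^sub>M B)) = b"
  proof -
    have eq: "PY \<Otimes>\<^sub>M PY = distr (A \<Otimes>\<^sub>M B) (BY \<Otimes>\<^sub>M BY) (\<lambda>(x, y). (snd x, snd y))"
      unfolding A(4)[symmetric] by (subst (2) A(4), subst B(4)[symmetric], rule pair_measure_distr)
        (use PY.sigma_finite_measure_axioms in \<open>simp_all add: B(4)\<close>)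
    have "(\<lambda>z. \<rho>Y (fst z) (snd z)) \<in> borel_measurable (BY \<Otimes>\<^sub>M BY)"
      using admissibleD(1)[OF admY] by (simp add: case_prod_beta')
    then show ?thesis unfolding b_def eq g_def
      by (subst integral_distr) (auto simp: case_prod_beta')
  qed
  have fgE: "(\<integral>z. f z * g z \<partial>(A \<Otimes>\<^sub>M B)) = gaussE A B u v"
    unfolding gaussE_def f_def g_def by (simp add: mult_exp_exp)
  have prod: "(1 - f z) * (1 - g z) = 1 - f z - g z + f z * g z" for z by algebra
  have intp: "integrable (A \<Otimes>\<^sub>M B) (\<lambda>z. (1 - f z) * (1 - g z))"
    unfolding prod using int by simp
  have I: "(\<integral>z. (1 - f z) * (1 - g z) \<partial>(A \<Otimes>\<^sub>M B)) = 1 - a - b + gaussE A B u v"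
    unfolding prod using int by (simp add: fa gb fgE AB.prob_space)
  have "0 \<le> (\<integral>z. (1 - f z) * (1 - g z) \<partial>(A \<Otimes>\<^sub>M B))"
    using fg by (intro Bochner_Integration.integral_nonneg mult_nonneg_nonneg) auto
  then show "0 \<le> 1 - a - b + gaussE A B u v" using I by simp
  have "mixed A B (u, v) = (\<integral>\<^sup>+z. ennreal ((1 - f z) * (1 - g z) / (u\<^sup>2 * v\<^sup>2)) \<partial>(A \<Otimes>\<^sub>M B))"
    unfolding mixed_def
  proof (rule nn_integral_cong)
    fix z assume z: "z \<in> space (A \<Otimes>\<^sub>M B)"
    have "sqrt_mix u (\<rho>X (fst (fst z)) (fst (snd z))) * sqrt_mix v (\<rho>Y (snd (fst z)) (snd (snd z)))
        = ennreal ((1 - f z) / u\<^sup>2) * ennreal ((1 - g z) / v\<^sup>2)"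
      using uv by (simp add: sqrt_mix_def f_def g_def)
    also have "\<dots> = ennreal ((1 - f z) / u\<^sup>2 * ((1 - g z) / v\<^sup>2))"
      using fg[OF z] by (intro ennreal_mult'[symmetric]) simp
    finally show "sqrt_mix (fst (u, v)) (\<rho>X (fst (fst z)) (fst (snd z))) * sqrt_mix (snd (u, v)) (\<rho>Y (snd (fst z)) (snd (snd z)))
        = ennreal ((1 - f z) * (1 - g z) / (u\<^sup>2 * v\<^sup>2))" by simp
  qed
  also have "\<dots> = ennreal (\<integral>z. (1 - f z) * (1 - g z) / (u\<^sup>2 * v\<^sup>2) \<partial>(A \<Otimes>\<^sub>M B))"
    using intp fg by (intro nn_integral_eq_integral AE_I2) (auto intro!: divide_nonneg_nonneg mult_nonneg_nonneg)
  finally show "mixed A B (u, v) = ennreal ((1 - a - b + gaussE A B u v) / (u\<^sup>2 * v\<^sup>2))"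
    by (simp add: I)
qed

abbreviation R :: "real \<Rightarrow> real \<Rightarrow> 'a \<times> 'b \<Rightarrow> 'a \<times> 'b \<Rightarrow> real" where
  "R u v \<equiv> \<lambda>z z'. u\<^sup>2 * \<rho>X (fst z) (fst z') + v\<^sup>2 * \<rho>Y (snd z) (snd z')"

lemma gaussE_bound:
  assumes "f \<in> borel_measurable Z" "psd (space Z) (\<lambda>x y. f x + f y - \<kappa> - R u v x y)"
  shows "exp \<kappa> * ((\<integral>z. exp (- f z) \<partial>P) - (\<integral>z. exp (- f z) \<partial>Q))\<^sup>2
      \<le> gaussE P P u v + gaussE Q Q u v - 2 * gaussE P Q u v"
  unfolding gaussE_def
proof (rule energy_lower_bound[where R = "R u v" and f = f and Z = Z])
  show "case_prod (R u v) \<in> borel_measurable (Z \<Otimes>\<^sub>M Z)"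
    using measurable_\<rho>X measurable_\<rho>Y unfolding case_prod_beta' by measurable
  show "0 \<le> R u v x y" if "x \<in> space Z" "y \<in> space Z" for x y
    using that admissibleD(3)[OF admX] admissibleD(3)[OF admY]
    by (auto simp: space_pair_measure intro!: add_nonneg_nonneg mult_nonneg_nonneg)
  show "R u v x x = 0" if "x \<in> space Z" for x
    using that admissibleD(2)[OF admX] admissibleD(2)[OF admY] by (auto simp: space_pair_measure)
qed (use assms in \<open>simp_all add: P.prob_space_axioms prob_Q sets_P sets_Q\<close>)

text \<open>Any centre yields this through \<open>gaussE_bound\<close>, whose left-hand side is a
  nonnegative multiple of a square; the base points provide one.\<close>

lemma gaussE_nonneg: "0 \<le> gaussE P P u v + gaussE Q Q u v - 2 * gaussE P Q u v"
proof -
  have "centre (space BX \<times> space BY) (R u v) (\<lambda>z. u\<^sup>2 * \<rho>X oX (fst z) + v\<^sup>2 * \<rho>Y oY (snd z))"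
    by (rule centre_add[OF centre_scale[OF admissibleD(6)[OF admX oX]] centre_scale[OF admissibleD(6)[OF admY oY]]]) auto
  then obtain \<kappa> where \<kappa>: "psd (space Z) (\<lambda>x y. (u\<^sup>2 * \<rho>X oX (fst x) + v\<^sup>2 * \<rho>Y oY (snd x))
      + (u\<^sup>2 * \<rho>X oX (fst y) + v\<^sup>2 * \<rho>Y oY (snd y)) - \<kappa> - R u v x y)"
    unfolding centre_def space_pair_measure by (rule exE)
  have m: "(\<lambda>z. u\<^sup>2 * \<rho>X oX (fst z) + v\<^sup>2 * \<rho>Y oY (snd z)) \<in> borel_measurable Z"
  proof -
    have [measurable]: "(\<lambda>z. \<rho>X oX (fst z)) \<in> borel_measurable Z"
      using measurable_compose[OF measurable_fst measurable_compose[OF measurable_Pair1'[OF oX] admissibleD(1)[OF admX]]] by simp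
    have [measurable]: "(\<lambda>z. \<rho>Y oY (snd z)) \<in> borel_measurable Z"
      using measurable_compose[OF measurable_snd measurable_compose[OF measurable_Pair1'[OF oY] admissibleD(1)[OF admY]]] by simp
    show ?thesis by measurable
  qed
  show ?thesis by (rule order_trans[OF _ gaussE_bound[OF m \<kappa>]]) simp
qed

text \<open>One pair of positive scales suffices: by \<open>gaussE_bound\<close> all integrals of
  \<open>exp (- f)\<close> over centres \<open>f\<close> agree at that scale, and these determine
  the measure.\<close>

lemma P_eq_Q_if_gaussE_eq:
  assumes uv: "0 < u" "0 < v" and eq: "gaussE P P u v + gaussE Q Q u v - 2 * gaussE P Q u v = 0"
  shows "P = Q"
proof -
  have zX: "\<rho>X x x = 0" if "x \<in> space BX" for x using admissibleD(2)[OF admX that] .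
  have zY: "\<rho>Y x x = 0" if "x \<in> space BY" for x using admissibleD(2)[OF admY that] .
  have det: "gauss_determining Z (R u v)"
    by (rule gauss_determining_pair[OF admissibleD(7)[OF admX] admissibleD(7)[OF admY]]) (use uv zX zY in auto)
  show ?thesis
  proof (rule gauss_determiningD[OF det sets_P sets_Q P.finite_measure_axioms Q.finite_measure_axioms])
    fix f assume f: "f \<in> borel_measurable Z" and c: "centre (space Z) (R u v) f"
    obtain \<kappa> where \<kappa>: "psd (space Z) (\<lambda>x y. f x + f y - \<kappa> - R u v x y)"
      using c unfolding centre_def by (rule exE)
    have "((\<integral>z. exp (- f z) \<partial>P) - (\<integral>z. exp (- f z) \<partial>Q))\<^sup>2 \<le> 0"
      using gaussE_bound[OF f \<kappa>] eq by (simp add: mult_le_0_iff)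
    then have e: "(\<integral>z. exp (- f z) \<partial>P) = (\<integral>z. exp (- f z) \<partial>Q)" by simp
    obtain l where l: "\<And>x. x \<in> space Z \<Longrightarrow> l \<le> f x"
    proof (rule centre_lower_bound[OF c])
      show "R u v x x = 0" if "x \<in> space Z" for x
        using that zX zY by (auto simp: space_pair_measure)
    qed blast
    have int: "integrable A (\<lambda>z. exp (- f z))" if "prob_space A" "sets A = sets Z" for A
    proof -
      interpret A: prob_space A by fact
      show ?thesis
        using f l that(2) sets_eq_imp_space_eq[OF that(2)]
        by (intro A.integrable_const_bound[where B = "exp (- l)"]) (auto cong: measurable_cong_sets)
    qed
    show "(\<integral>\<^sup>+x. ennreal (exp (- f x)) \<partial>P) = (\<integral>\<^sup>+x. ennreal (exp (- f x)) \<partial>Q)"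
      using int[OF P.prob_space_axioms sets_P] int[OF prob_Q sets_Q] e by (simp add: nn_integral_eq_integral)
  qed
qed

text \<open>At each scale everything is finite and real arithmetic is legitimate, although the
  integrals over all scales may diverge.\<close>

lemma mixed_PQ_props:
  shows "2 * mixed P Q q \<le> mixed P P q + mixed Q Q q"
    and "mixed P P q + mixed Q Q q < \<infinity>"
    and "0 < fst q \<Longrightarrow> 0 < snd q \<Longrightarrow> mixed P P q + mixed Q Q q = 2 * mixed P Q q \<Longrightarrow> P = Q"
proof -
  obtain u v where q: "q = (u, v)" by (cases q)
  have "2 * mixed P Q q \<le> mixed P P q + mixed Q Q q \<and> mixed P P q + mixed Q Q q < \<infinity> \<and>
     (0 < u \<longrightarrow> 0 < v \<longrightarrow> mixed P P q + mixed Q Q q = 2 * mixed P Q q \<longrightarrow> P = Q)"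
  proof (cases "0 < u \<and> 0 < v")
    case False
    \<comment> \<open>Outside the open quadrant \<open>sqrt_mix\<close> is zero by its
      indicator.\<close>
    then have "mixed A B q = 0" for A B unfolding mixed_def q by (auto simp: sqrt_mix_def)
    then show ?thesis using False by auto
  next
    case True
    then have uv: "0 < u" "0 < v" by auto
    note Pm = P.prob_space_axioms sets_P PX_def[symmetric] PY_def[symmetric]
    note Qm = prob_Q sets_Q marginal_Q
    define a where "a = (\<integral>z. exp (- (u\<^sup>2 * \<rho>X (fst z) (snd z))) \<partial>(PX \<Otimes>\<^sub>M PX))"
    define b where "b = (\<integral>z. exp (- (v\<^sup>2 * \<rho>Y (fst z) (snd z))) \<partial>(PY \<Otimes>\<^sub>M PY))"
    note m = mixed_eq[OF Pm Pm uv, folded a_def b_def] mixed_eq[OF Qm Qm uv, folded a_def b_def]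
      mixed_eq[OF Pm Qm uv, folded a_def b_def]
    have w: "0 < u\<^sup>2 * v\<^sup>2" using uv by simp
    define pp where "pp = (1 - a - b + gaussE P P u v) / (u\<^sup>2 * v\<^sup>2)"
    define qq where "qq = (1 - a - b + gaussE Q Q u v) / (u\<^sup>2 * v\<^sup>2)"
    define pq where "pq = (1 - a - b + gaussE P Q u v) / (u\<^sup>2 * v\<^sup>2)"
    have nn: "0 \<le> pp" "0 \<le> qq" "0 \<le> pq" using m w by (simp_all add: pp_def qq_def pq_def)
    have diff: "pp + qq - 2 * pq = (gaussE P P u v + gaussE Q Q u v - 2 * gaussE P Q u v) / (u\<^sup>2 * v\<^sup>2)"
      unfolding pp_def qq_def pq_def by (simp add: add_divide_distrib diff_divide_distrib)
    have "mixed P P q + mixed Q Q q = ennreal pp + ennreal qq"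
      unfolding q m(1) m(3) pp_def qq_def ..
    moreover have "2 * mixed P Q q = ennreal 2 * ennreal pq"
      unfolding q m(5) pq_def by simp
    ultimately have sums: "mixed P P q + mixed Q Q q = ennreal (pp + qq)" "2 * mixed P Q q = ennreal (2 * pq)"
      using nn by (simp_all only: ennreal_plus ennreal_mult')
    have "0 \<le> pp + qq - 2 * pq"
      unfolding diff using gaussE_nonneg w by (intro divide_nonneg_pos)
    then have "2 * pq \<le> pp + qq" by simp
    then have "2 * mixed P Q q \<le> mixed P P q + mixed Q Q q" unfolding sums by (rule ennreal_leI)
    moreover have "P = Q" if "mixed P P q + mixed Q Q q = 2 * mixed P Q q"
    proof -
      have "pp + qq = 2 * pq" using that nn unfolding sums by (subst (asm) ennreal_inj) auto
      then show ?thesis using diff w by (intro P_eq_Q_if_gaussE_eq[OF uv]) auto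
    qed
    ultimately show ?thesis by (simp add: sums)
  qed
  then show "2 * mixed P Q q \<le> mixed P P q + mixed Q Q q" "mixed P P q + mixed Q Q q < \<infinity>"
    "0 < fst q \<Longrightarrow> 0 < snd q \<Longrightarrow> mixed P P q + mixed Q Q q = 2 * mixed P Q q \<Longrightarrow> P = Q"
    by (auto simp: q)
qed

section \<open>Integration over the scales\<close>

lemma energy_mixtures:
  "\<exists>c>0. \<forall>A\<in>{P, Q}. \<forall>B\<in>{P, Q}. mixed A B \<in> borel_measurable (lborel \<Otimes>\<^sub>M lborel) \<and>
     ennreal c * energy A B = (\<integral>\<^sup>+q. mixed A B q \<partial>(lborel \<Otimes>\<^sub>M lborel))"
proof -
  obtain c where c: "0 < c" "\<And>r. 0 \<le> r \<Longrightarrow> (\<integral>\<^sup>+u. sqrt_mix u r \<partial>lborel) = ennreal (c * sqrt r)"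
    using sqrt_mixture by blast
  have PQ: "prob_space A" "sets A = sets Z" if "A \<in> {P, Q}" for A
    using that P.prob_space_axioms prob_Q sets_P sets_Q by auto
  show ?thesis
    using energy_mixture[OF c PQ PQ] c(1) by (intro exI[of _ "c * c"] conjI ballI) auto
qed

text \<open>The pointwise inequality integrated. Its additive form is valid for infinite energies
  too and later yields finiteness of \<open>energy P Q\<close>.\<close>

lemma energy_inequality: "2 * energy P Q \<le> energy P P + energy Q Q"
proof -
  obtain c where c: "0 < c" "\<And>A B. A \<in> {P, Q} \<Longrightarrow> B \<in> {P, Q} \<Longrightarrow>
     ennreal c * energy A B = (\<integral>\<^sup>+q. mixed A B q \<partial>(lborel \<Otimes>\<^sub>M lborel))"
    "\<And>A B. A \<in> {P, Q} \<Longrightarrow> B \<in> {P, Q} \<Longrightarrow> mixed A B \<in> borel_measurable (lborel \<Otimes>\<^sub>M lborel)"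
    using energy_mixtures by blast
  have "ennreal c * (2 * energy P Q) = 2 * (ennreal c * energy P Q)" by (simp add: mult_ac)
  also have "\<dots> = (\<integral>\<^sup>+q. 2 * mixed P Q q \<partial>(lborel \<Otimes>\<^sub>M lborel))"
    using c by (simp add: nn_integral_cmult)
  also have "\<dots> \<le> (\<integral>\<^sup>+q. mixed P P q + mixed Q Q q \<partial>(lborel \<Otimes>\<^sub>M lborel))"
    by (intro nn_integral_mono mixed_PQ_props)
  also have "\<dots> = ennreal c * (energy P P + energy Q Q)"
    using c by (simp add: nn_integral_add distrib_left)
  finally show ?thesis using c(1) by (subst (asm) ennreal_mult_le_mult_iff) auto
qed

text \<open>Two ordered functions with the same finite integral agree almost everywhere, so the
  equality case of \<open>mixed_PQ_props\<close> occurs at some scale.\<close>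

lemma P_eq_Q_if_energy_eq:
  assumes fin: "energy P P + energy Q Q < \<infinity>" and eq: "energy P P + energy Q Q = 2 * energy P Q"
  shows "P = Q"
proof -
  obtain c where c: "0 < c" "\<And>A B. A \<in> {P, Q} \<Longrightarrow> B \<in> {P, Q} \<Longrightarrow>
     ennreal c * energy A B = (\<integral>\<^sup>+q. mixed A B q \<partial>(lborel \<Otimes>\<^sub>M lborel))"
    "\<And>A B. A \<in> {P, Q} \<Longrightarrow> B \<in> {P, Q} \<Longrightarrow> mixed A B \<in> borel_measurable (lborel \<Otimes>\<^sub>M lborel)"
    using energy_mixtures by blast
  have [measurable]: "mixed P P \<in> borel_measurable (lborel \<Otimes>\<^sub>M lborel)"
    "mixed Q Q \<in> borel_measurable (lborel \<Otimes>\<^sub>M lborel)" "mixed P Q \<in> borel_measurable (lborel \<Otimes>\<^sub>M lborel)"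
    using c by auto
  define F where "F q = mixed P P q + mixed Q Q q" for q
  define G where "G q = 2 * mixed P Q q" for q
  have GF: "G q \<le> F q" for q unfolding F_def G_def by (rule mixed_PQ_props)
  have IG: "(\<integral>\<^sup>+q. G q \<partial>(lborel \<Otimes>\<^sub>M lborel)) = ennreal c * (2 * energy P Q)"
    unfolding G_def using c by (simp add: nn_integral_cmult mult.left_commute[of _ 2])
  have IF: "(\<integral>\<^sup>+q. F q \<partial>(lborel \<Otimes>\<^sub>M lborel)) = ennreal c * (energy P P + energy Q Q)"
    unfolding F_def using c by (simp add: nn_integral_add distrib_left)
  have "(\<integral>\<^sup>+q. F q - G q \<partial>(lborel \<Otimes>\<^sub>M lborel)) = (\<integral>\<^sup>+q. F q \<partial>(lborel \<Otimes>\<^sub>M lborel)) - (\<integral>\<^sup>+q. G q \<partial>(lborel \<Otimes>\<^sub>M lborel))"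
  proof (rule nn_integral_diff)
    show "(\<integral>\<^sup>+q. G q \<partial>(lborel \<Otimes>\<^sub>M lborel)) \<noteq> \<infinity>"
      unfolding IG using fin unfolding eq by (auto simp: ennreal_mult_eq_top_iff ennreal_mult_less_top)
  qed (auto simp: F_def[abs_def] G_def[abs_def] GF[unfolded F_def G_def])
  also have "\<dots> = 0"
    unfolding IF IG eq
    by (rule diff_eq_0_ennreal)
       (use fin in \<open>auto simp: eq ennreal_mult_less_top\<close>)
  finally have AE0: "AE q in lborel \<Otimes>\<^sub>M lborel. F q - G q = 0"
    by (subst (asm) nn_integral_0_iff_AE) (auto simp: F_def[abs_def] G_def[abs_def])
  \<comment> \<open>The open unit square has positive measure, so the null set of exceptional scales
    cannot cover it.\<close>
  have "\<exists>q. 0 < fst q \<and> 0 < snd q \<and> F q - G q = 0"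
  proof (rule ccontr)
    assume no: "\<not> ?thesis"
    have "AE q in lborel \<Otimes>\<^sub>M lborel. q \<notin> {0<..<1::real} \<times> {0<..<1::real}"
      using AE0 by eventually_elim (use no in auto)
    then have "emeasure (lborel \<Otimes>\<^sub>M lborel) ({0<..<1::real} \<times> {0<..<1::real}) = 0"
      by (subst (asm) AE_iff_measurable[of "{0<..<1} \<times> {0<..<1}"]) (auto simp: space_pair_measure)
    then show False by (simp add: lborel.emeasure_pair_measure_Times)
  qed
  then obtain q where q: "0 < fst q" "0 < snd q" "F q - G q = 0" by blast
  have "F q \<le> G q"
    using q(3) mixed_PQ_props(2)[of q] by (simp add: F_def diff_eq_0_iff_ennreal less_top)
  then show ?thesis using GF[of q] q by (intro mixed_PQ_props(3)[of q]) (auto simp: F_def G_def)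
qed

section \<open>Moments and finiteness of the energies\<close>

definition "\<alpha> z = ennreal (sqrt (\<rho>X (fst z) oX))"
definition "\<beta> z = ennreal (sqrt (\<rho>Y (snd z) oY))"
definition "meanX = (\<integral>\<^sup>+z. ennreal (sqrt (\<rho>X (fst z) (snd z))) \<partial>(PX \<Otimes>\<^sub>M PX))"
definition "meanY = (\<integral>\<^sup>+z. ennreal (sqrt (\<rho>Y (fst z) (snd z))) \<partial>(PY \<Otimes>\<^sub>M PY))"

lemma measurable_to_origin:
  "(\<lambda>x. \<rho>X x oX) \<in> borel_measurable BX" "(\<lambda>y. \<rho>Y y oY) \<in> borel_measurable BY"
  using measurable_compose[OF measurable_Pair2'[OF oX] admissibleD(1)[OF admX]]
    measurable_compose[OF measurable_Pair2'[OF oY] admissibleD(1)[OF admY]] by simp_all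

lemma measurable_\<alpha>\<beta>: "\<alpha> \<in> borel_measurable Z" "\<beta> \<in> borel_measurable Z"
proof -
  have [measurable]: "(\<lambda>z. \<rho>X (fst z) oX) \<in> borel_measurable Z" "(\<lambda>z. \<rho>Y (snd z) oY) \<in> borel_measurable Z"
    by (rule measurable_compose[OF measurable_fst measurable_to_origin(1)]
        measurable_compose[OF measurable_snd measurable_to_origin(2)])+
  show "\<alpha> \<in> borel_measurable Z" "\<beta> \<in> borel_measurable Z"
    unfolding \<alpha>_def[abs_def] \<beta>_def[abs_def] by measurable
qed

text \<open>The quasi-triangle inequality in both directions, a factor 2 per component. The first
  bound estimates the energy by distances to the base points; the second goes back, from distances
  to an arbitrary point \<open>z'\<close> to distances to the base points.\<close>

lemma kern_bounds:
  assumes z: "z \<in> space Z" "z' \<in> space Z"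
  shows "ennreal (kern (z, z')) \<le> 4 * ((\<alpha> z + \<alpha> z') * (\<beta> z + \<beta> z'))"
    and "\<alpha> z * \<beta> z \<le> 4 * ((ennreal (sqrt (\<rho>X (fst z) (fst z'))) + \<alpha> z') * (ennreal (sqrt (\<rho>Y (snd z) (snd z'))) + \<beta> z'))"
    and "ennreal (sqrt (\<rho>X (fst z) (fst z'))) \<le> 2 * (\<alpha> z + \<alpha> z')"
    and "ennreal (sqrt (\<rho>Y (snd z) (snd z'))) \<le> 2 * (\<beta> z + \<beta> z')"
proof -
  have x: "fst z \<in> space BX" "fst z' \<in> space BX" and y: "snd z \<in> space BY" "snd z' \<in> space BY"
    using z by (auto simp: space_pair_measure)
  define K where "K = sqrt (\<rho>X (fst z) (fst z'))"
  define L where "L = sqrt (\<rho>Y (snd z) (snd z'))"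
  define a where "a = sqrt (\<rho>X (fst z) oX)"
  define a' where "a' = sqrt (\<rho>X (fst z') oX)"
  define b where "b = sqrt (\<rho>Y (snd z) oY)"
  define b' where "b' = sqrt (\<rho>Y (snd z') oY)"
  have nn: "0 \<le> K" "0 \<le> L" "0 \<le> a" "0 \<le> a'" "0 \<le> b" "0 \<le> b'"
    using admissibleD(3)[OF admX] admissibleD(3)[OF admY] x y oX oY
    by (auto simp: K_def L_def a_def a'_def b_def b'_def)
  have ab: "\<alpha> z = ennreal a" "\<alpha> z' = ennreal a'" "\<beta> z = ennreal b" "\<beta> z' = ennreal b'"
    by (simp_all add: \<alpha>_def \<beta>_def a_def a'_def b_def b'_def)
  have K: "K \<le> 2 * (a + a')"
    using sqrt_quasi_triangle[OF admX x oX] admissibleD(4)[OF admX oX x(2)] by (simp add: K_def a_def a'_def)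
  have L: "L \<le> 2 * (b + b')"
    using sqrt_quasi_triangle[OF admY y oY] admissibleD(4)[OF admY oY y(2)] by (simp add: L_def b_def b'_def)
  have a: "a \<le> 2 * (K + a')"
    using sqrt_quasi_triangle[OF admX x(1) oX x(2)] by (simp add: K_def a_def a'_def)
  have b: "b \<le> 2 * (L + b')"
    using sqrt_quasi_triangle[OF admY y(1) oY y(2)] by (simp add: L_def b_def b'_def)
  have four: "4 * ((ennreal r + ennreal s) * (ennreal t + ennreal w)) = ennreal ((2 * (r + s)) * (2 * (t + w)))"
    if "0 \<le> r" "0 \<le> s" "0 \<le> t" "0 \<le> w" for r s t w
  proof -
    have "ennreal ((2 * (r + s)) * (2 * (t + w))) = ennreal (4 * ((r + s) * (t + w)))"
      by (rule arg_cong[where f = ennreal]) (simp add: algebra_simps)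
    also have "\<dots> = ennreal 4 * (ennreal (r + s) * ennreal (t + w))"
      using that by (simp add: ennreal_mult)
    finally show ?thesis using that by simp
  qed
  have "K * L \<le> (2 * (a + a')) * (2 * (b + b'))" using K L nn by (intro mult_mono) auto
  then show "ennreal (kern (z, z')) \<le> 4 * ((\<alpha> z + \<alpha> z') * (\<beta> z + \<beta> z'))"
    unfolding ab four[OF nn(3,4,5,6)] by (simp add: kern_def K_def L_def ennreal_leI)
  have "a * b \<le> (2 * (K + a')) * (2 * (L + b'))" using a b nn by (intro mult_mono) auto
  then show "\<alpha> z * \<beta> z \<le> 4 * ((ennreal (sqrt (\<rho>X (fst z) (fst z'))) + \<alpha> z') * (ennreal (sqrt (\<rho>Y (snd z) (snd z'))) + \<beta> z'))"
    unfolding ab K_def[symmetric] L_def[symmetric] four[OF nn(1,4,2,6)]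
    using nn by (simp only: ennreal_mult[symmetric] ennreal_leI)
  have two: "2 * (ennreal r + ennreal s) = ennreal (2 * (r + s))" if "0 \<le> r" "0 \<le> s" for r s
    using that by (simp only: ennreal_plus[symmetric] ennreal_mult' ennreal_numeral zero_le_numeral)
  show "ennreal (sqrt (\<rho>X (fst z) (fst z'))) \<le> 2 * (\<alpha> z + \<alpha> z')"
    unfolding ab K_def[symmetric] two[OF nn(3,4)] using K by (rule ennreal_leI)
  show "ennreal (sqrt (\<rho>Y (snd z) (snd z'))) \<le> 2 * (\<beta> z + \<beta> z')"
    unfolding ab L_def[symmetric] two[OF nn(5,6)] using L by (rule ennreal_leI)
qed

lemma energy_iterated:
  assumes "prob_space A" "sets A = sets Z" "prob_space B" "sets B = sets Z"
  shows "energy A B = (\<integral>\<^sup>+z. \<integral>\<^sup>+z'. ennreal (kern (z, z')) \<partial>B \<partial>A)"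
    and "energy A B = (\<integral>\<^sup>+z'. \<integral>\<^sup>+z. ennreal (kern (z, z')) \<partial>A \<partial>B)"
    and "(\<lambda>z'. \<integral>\<^sup>+z. ennreal (kern (z, z')) \<partial>A) \<in> borel_measurable B"
proof -
  interpret A: prob_space A by fact
  interpret B: prob_space B by fact
  interpret pair_sigma_finite A B ..
  have [measurable]: "kern \<in> borel_measurable (A \<Otimes>\<^sub>M B)"
    using measurable_kern sets_pair_measure_cong[OF assms(2,4)] by (simp cong: measurable_cong_sets)
  show "energy A B = (\<integral>\<^sup>+z. \<integral>\<^sup>+z'. ennreal (kern (z, z')) \<partial>B \<partial>A)"
    unfolding energy_def by (rule B.nn_integral_fst[symmetric]) measurable
  show "energy A B = (\<integral>\<^sup>+z'. \<integral>\<^sup>+z. ennreal (kern (z, z')) \<partial>A \<partial>B)"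
    unfolding energy_def by (rule nn_integral_snd[symmetric]) measurable
  show "(\<lambda>z'. \<integral>\<^sup>+z. ennreal (kern (z, z')) \<partial>A) \<in> borel_measurable B"
    by measurable
qed

text \<open>Both energies are finite precisely when E K(X,o) L(Y,o) is.\<close>

lemma energy_PP_finite:
  assumes fin: "energy P Q < \<infinity>"
  shows "energy P P < \<infinity>"
proof -
  note Pm = P.prob_space_axioms sets_P
  note Qm = prob_Q sets_Q
  have [measurable]: "\<alpha> \<in> borel_measurable P" "\<beta> \<in> borel_measurable P"
    using measurable_\<alpha>\<beta> sets_P by (simp_all cong: measurable_cong_sets)
  define kX where "kX = (\<integral>\<^sup>+z. \<alpha> z \<partial>P)"
  define kY where "kY = (\<integral>\<^sup>+z. \<beta> z \<partial>P)"
  define J where "J = (\<integral>\<^sup>+z. \<alpha> z * \<beta> z \<partial>P)"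
  have k: "kX < \<infinity>" "kY < \<infinity>" using momX momY by (simp_all add: kX_def kY_def \<alpha>_def \<beta>_def)
  have sp: "space P = space Z" "space Q = space Z"
    using sets_eq_imp_space_eq[OF sets_P] sets_eq_imp_space_eq[OF sets_Q] by simp_all
  have fab: "\<alpha> z < \<infinity>" "\<beta> z < \<infinity>" for z by (simp_all add: \<alpha>_def \<beta>_def)
  \<comment> \<open>Finiteness of \<open>energy P Q\<close> provides a point \<open>z'\<close> for
    which K(x,x') L(y,y') is integrable under \<open>P\<close>. It replaces the base points, for
    which this is not known beforehand.\<close>
  have "AE z' in Q. (\<integral>\<^sup>+z. ennreal (kern (z, z')) \<partial>P) \<noteq> \<infinity>"
    using energy_iterated(2,3)[OF Pm Qm] fin by (intro nn_integral_PInf_AE) auto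
  then obtain z' where z': "z' \<in> space Q" "(\<integral>\<^sup>+z. ennreal (kern (z, z')) \<partial>P) \<noteq> \<infinity>"
    by (rule Q.AE_imp_ex)
  have z'Z: "z' \<in> space Z" using z'(1) sp by simp
  define \<kappa>X where "\<kappa>X z = ennreal (sqrt (\<rho>X (fst z) (fst z')))" for z :: "'a \<times> 'b"
  define \<kappa>Y where "\<kappa>Y z = ennreal (sqrt (\<rho>Y (snd z) (snd z')))" for z :: "'a \<times> 'b"
  have sl: "(\<lambda>z. (z, z')) \<in> measurable P (Z \<Otimes>\<^sub>M Z)"
    using measurable_Pair2'[OF z'Z, of Z] sets_P by (simp cong: measurable_cong_sets)
  have [measurable]: "\<kappa>X \<in> borel_measurable P" "\<kappa>Y \<in> borel_measurable P"
    unfolding \<kappa>X_def[abs_def] \<kappa>Y_def[abs_def]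
    using measurable_compose[OF sl measurable_\<rho>X] measurable_compose[OF sl measurable_\<rho>Y] by simp_all
  have \<kappa>: "(\<integral>\<^sup>+z. \<kappa>X z \<partial>P) < \<infinity>" "(\<integral>\<^sup>+z. \<kappa>Y z \<partial>P) < \<infinity>"
  proof -
    have "(\<integral>\<^sup>+z. \<kappa>X z \<partial>P) \<le> (\<integral>\<^sup>+z. 2 * (\<alpha> z + \<alpha> z') \<partial>P)"
      unfolding \<kappa>X_def using kern_bounds(3)[OF _ z'Z] sp by (intro nn_integral_mono) simp
    also have "\<dots> = 2 * (kX + \<alpha> z')" by (simp add: nn_integral_cmult nn_integral_add kX_def P.emeasure_space_1)
    also have "\<dots> < \<infinity>" using k fab by (simp add: ennreal_mult_less_top)
    finally show "(\<integral>\<^sup>+z. \<kappa>X z \<partial>P) < \<infinity>" .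
    have "(\<integral>\<^sup>+z. \<kappa>Y z \<partial>P) \<le> (\<integral>\<^sup>+z. 2 * (\<beta> z + \<beta> z') \<partial>P)"
      unfolding \<kappa>Y_def using kern_bounds(4)[OF _ z'Z] sp by (intro nn_integral_mono) simp
    also have "\<dots> = 2 * (kY + \<beta> z')" by (simp add: nn_integral_cmult nn_integral_add kY_def P.emeasure_space_1)
    also have "\<dots> < \<infinity>" using k fab by (simp add: ennreal_mult_less_top)
    finally show "(\<integral>\<^sup>+z. \<kappa>Y z \<partial>P) < \<infinity>" .
  qed
  have \<kappa>\<kappa>: "(\<integral>\<^sup>+z. \<kappa>X z * \<kappa>Y z \<partial>P) < \<infinity>"
  proof -
    have "(\<integral>\<^sup>+z. \<kappa>X z * \<kappa>Y z \<partial>P) = (\<integral>\<^sup>+z. ennreal (kern (z, z')) \<partial>P)"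
    proof (rule nn_integral_cong)
      fix z assume "z \<in> space P"
      then have "0 \<le> \<rho>X (fst z) (fst z')" "0 \<le> \<rho>Y (snd z) (snd z')"
        using \<rho>_nonneg[of "(z, z')"] z'Z sp by (simp_all add: space_pair_measure)
      then show "\<kappa>X z * \<kappa>Y z = ennreal (kern (z, z'))"
        by (simp add: \<kappa>X_def \<kappa>Y_def kern_def ennreal_mult)
    qed
    then show ?thesis using z'(2) by (simp add: less_top)
  qed
  \<comment> \<open>Changing the base point from \<open>z'\<close> to the origins costs only terms
    with one factor at a time, controlled by the separate first moments.\<close>
  have "J \<le> (\<integral>\<^sup>+z. 4 * ((\<kappa>X z + \<alpha> z') * (\<kappa>Y z + \<beta> z')) \<partial>P)"
    unfolding J_def \<kappa>X_def \<kappa>Y_def using kern_bounds(2)[OF _ z'Z] sp by (intro nn_integral_mono) simp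
  also have "\<dots> = (\<integral>\<^sup>+z. 4 * (\<kappa>X z * \<kappa>Y z + \<beta> z' * \<kappa>X z + \<alpha> z' * \<kappa>Y z + \<alpha> z' * \<beta> z') \<partial>P)"
    by (intro nn_integral_cong) (simp add: algebra_simps)
  also have "\<dots> = 4 * ((\<integral>\<^sup>+z. \<kappa>X z * \<kappa>Y z \<partial>P) + \<beta> z' * (\<integral>\<^sup>+z. \<kappa>X z \<partial>P)
      + \<alpha> z' * (\<integral>\<^sup>+z. \<kappa>Y z \<partial>P) + \<alpha> z' * \<beta> z')"
    by (simp add: nn_integral_cmult nn_integral_add P.emeasure_space_1)
  also have "\<dots> < \<infinity>"
    using \<kappa> \<kappa>\<kappa> fab[of z'] by (simp add: ennreal_mult_less_top)
  finally have J: "J < \<infinity>" .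
  \<comment> \<open>With \<open>J\<close> finite, the four products split into \<open>J\<close>
    twice and the product of the separate moments twice.\<close>
  have "energy P P \<le> (\<integral>\<^sup>+z. \<integral>\<^sup>+z'. 4 * ((\<alpha> z + \<alpha> z') * (\<beta> z + \<beta> z')) \<partial>P \<partial>P)"
    unfolding energy_iterated(1)[OF Pm Pm] using kern_bounds(1) sp by (intro nn_integral_mono) simp
  also have "\<dots> = (\<integral>\<^sup>+z. \<integral>\<^sup>+z'. 4 * (\<alpha> z * \<beta> z + \<alpha> z * \<beta> z' + \<beta> z * \<alpha> z' + \<alpha> z' * \<beta> z') \<partial>P \<partial>P)"
    by (intro nn_integral_cong) (simp add: algebra_simps)
  also have "\<dots> = (\<integral>\<^sup>+z. 4 * (\<alpha> z * \<beta> z + \<alpha> z * kY + \<beta> z * kX + J) \<partial>P)"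
    by (simp add: nn_integral_cmult nn_integral_add P.emeasure_space_1 kX_def kY_def J_def)
  also have "\<dots> = 4 * (J + kX * kY + kY * kX + J)"
    by (simp add: nn_integral_cmult nn_integral_add nn_integral_multc P.emeasure_space_1 flip: kX_def kY_def J_def)
  also have "\<dots> < \<infinity>" using J k by (simp add: ennreal_mult_less_top)
  finally show ?thesis .
qed

lemma nn_integral_Q:
  assumes f: "f \<in> borel_measurable BX" and g: "g \<in> borel_measurable BY"
  shows "(\<integral>\<^sup>+z. f (fst z) * g (snd z) \<partial>Q) = (\<integral>\<^sup>+x. f x \<partial>PX) * (\<integral>\<^sup>+y. g y \<partial>PY)"
proof -
  have [measurable]: "f \<in> borel_measurable PX" "g \<in> borel_measurable PY"
    using f g sets_marginal by (simp_all cong: measurable_cong_sets)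
  have "(\<integral>\<^sup>+z. f (fst z) * g (snd z) \<partial>Q) = (\<integral>\<^sup>+x. \<integral>\<^sup>+y. f x * g y \<partial>PY \<partial>PX)"
    unfolding Q_def by (subst PY.nn_integral_fst[symmetric]) auto
  then show ?thesis by (simp add: nn_integral_cmult nn_integral_multc)
qed

lemma sqrt_measurable_section:
  "x \<in> space BX \<Longrightarrow> (\<lambda>x'. ennreal (sqrt (\<rho>X x x'))) \<in> borel_measurable BX"
  "y \<in> space BY \<Longrightarrow> (\<lambda>y'. ennreal (sqrt (\<rho>Y y y'))) \<in> borel_measurable BY"
  using measurable_compose[OF measurable_Pair1' admissibleD(1)[OF admX]]
    measurable_compose[OF measurable_Pair1' admissibleD(1)[OF admY]] by auto

lemma sqrt_measurable_pair:
  "(\<lambda>z. ennreal (sqrt (\<rho>X (fst z) (snd z)))) \<in> borel_measurable (BX \<Otimes>\<^sub>M BX)"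
  "(\<lambda>z. ennreal (sqrt (\<rho>Y (fst z) (snd z)))) \<in> borel_measurable (BY \<Otimes>\<^sub>M BY)"
  using admissibleD(1)[OF admX] admissibleD(1)[OF admY] by (auto simp: case_prod_beta')

lemma sqrt_measurable_marginal[measurable]:
  "(\<lambda>z. ennreal (sqrt (\<rho>X (fst z) (snd z)))) \<in> borel_measurable (PX \<Otimes>\<^sub>M PX)"
  "(\<lambda>z. ennreal (sqrt (\<rho>Y (fst z) (snd z)))) \<in> borel_measurable (PY \<Otimes>\<^sub>M PY)"
  using sqrt_measurable_pair sets_pair_measure_cong[OF sets_marginal(1) sets_marginal(1)]
    sets_pair_measure_cong[OF sets_marginal(2) sets_marginal(2)]
  by (simp_all cong: measurable_cong_sets)

lemma mean_iterated:
  "meanX = (\<integral>\<^sup>+x. \<integral>\<^sup>+x'. ennreal (sqrt (\<rho>X x x')) \<partial>PX \<partial>PX)"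
  "meanY = (\<integral>\<^sup>+y. \<integral>\<^sup>+y'. ennreal (sqrt (\<rho>Y y y')) \<partial>PY \<partial>PY)"
  unfolding meanX_def meanY_def
  using PX.nn_integral_fst[OF sqrt_measurable_marginal(1)] PY.nn_integral_fst[OF sqrt_measurable_marginal(2)]
  by simp_all

text \<open>Under \<open>Q\<close> the two components are independent, so the middle term of the
  distance covariance becomes an energy, and it is always finite.\<close>

lemma energy_QQ: "energy Q Q = meanX * meanY"
proof -
  have sp: "space Q = space Z" by (rule sets_eq_imp_space_eq[OF sets_Q])
  define F where "F x = (\<integral>\<^sup>+x'. ennreal (sqrt (\<rho>X x x')) \<partial>PX)" for x
  define G where "G y = (\<integral>\<^sup>+y'. ennreal (sqrt (\<rho>Y y y')) \<partial>PY)" for y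
  have "F \<in> borel_measurable PX" "G \<in> borel_measurable PY"
    using PX.borel_measurable_nn_integral_fst[OF sqrt_measurable_marginal(1)]
      PY.borel_measurable_nn_integral_fst[OF sqrt_measurable_marginal(2)]
    unfolding F_def[abs_def] G_def[abs_def] by simp_all
  then have mF: "F \<in> borel_measurable BX" and mG: "G \<in> borel_measurable BY"
    unfolding measurable_cong_sets[OF sets_marginal(1) refl] measurable_cong_sets[OF sets_marginal(2) refl] .
  have "energy Q Q = (\<integral>\<^sup>+z. F (fst z) * G (snd z) \<partial>Q)"
    unfolding energy_iterated(1)[OF prob_Q sets_Q prob_Q sets_Q]
  proof (rule nn_integral_cong)
    fix z assume "z \<in> space Q"
    then have z: "z \<in> space Z" "fst z \<in> space BX" "snd z \<in> space BY"
      unfolding space_PQ(2) space_pair_measure mem_Times_iff by simp_all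
    have "(\<integral>\<^sup>+z'. ennreal (kern (z, z')) \<partial>Q)
        = (\<integral>\<^sup>+z'. ennreal (sqrt (\<rho>X (fst z) (fst z'))) * ennreal (sqrt (\<rho>Y (snd z) (snd z'))) \<partial>Q)"
    proof (rule nn_integral_cong)
      fix z' assume "z' \<in> space Q"
      then have "0 \<le> \<rho>X (fst z) (fst z')" "0 \<le> \<rho>Y (snd z) (snd z')"
        using \<rho>_nonneg[of "(z, z')"] z sp by (simp_all add: space_pair_measure)
      then show "ennreal (kern (z, z')) = ennreal (sqrt (\<rho>X (fst z) (fst z'))) * ennreal (sqrt (\<rho>Y (snd z) (snd z')))"
        by (simp add: kern_def ennreal_mult)
    qed
    also have "\<dots> = F (fst z) * G (snd z)"
      unfolding F_def G_def by (rule nn_integral_Q[OF sqrt_measurable_section(1)[OF z(2)] sqrt_measurable_section(2)[OF z(3)]])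
    finally show "(\<integral>\<^sup>+z'. ennreal (kern (z, z')) \<partial>Q) = F (fst z) * G (snd z)" .
  qed
  also have "\<dots> = meanX * meanY"
    using nn_integral_Q[OF mF mG] unfolding mean_iterated F_def G_def .
  finally show ?thesis .
qed

lemma pair_marginal:
  "PX \<Otimes>\<^sub>M PX = distr (P \<Otimes>\<^sub>M P) (BX \<Otimes>\<^sub>M BX) (\<lambda>(x, y). (fst x, fst y))"
  "PY \<Otimes>\<^sub>M PY = distr (P \<Otimes>\<^sub>M P) (BY \<Otimes>\<^sub>M BY) (\<lambda>(x, y). (snd x, snd y))"
  using pair_measure_distr[OF fst_P fst_P] pair_measure_distr[OF snd_P snd_P]
    PX.sigma_finite_measure_axioms PY.sigma_finite_measure_axioms
  unfolding PX_def PY_def by auto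

lemma mean_P:
  "meanX = (\<integral>\<^sup>+z. ennreal (sqrt (\<rho>X (fst (fst z)) (fst (snd z)))) \<partial>(P \<Otimes>\<^sub>M P))"
  "meanY = (\<integral>\<^sup>+z. ennreal (sqrt (\<rho>Y (snd (fst z)) (snd (snd z)))) \<partial>(P \<Otimes>\<^sub>M P))"
proof -
  note [measurable] = fst_P snd_P sqrt_measurable_pair
  show "meanX = (\<integral>\<^sup>+z. ennreal (sqrt (\<rho>X (fst (fst z)) (fst (snd z)))) \<partial>(P \<Otimes>\<^sub>M P))"
    unfolding meanX_def pair_marginal by (subst nn_integral_distr) (auto simp: case_prod_beta')
  show "meanY = (\<integral>\<^sup>+z. ennreal (sqrt (\<rho>Y (snd (fst z)) (snd (snd z)))) \<partial>(P \<Otimes>\<^sub>M P))"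
    unfolding meanY_def pair_marginal by (subst nn_integral_distr) (auto simp: case_prod_beta')
qed

lemma measurable_PP:
  "(\<lambda>z. ennreal (sqrt (\<rho>X (fst (fst z)) (fst (snd z))))) \<in> borel_measurable (P \<Otimes>\<^sub>M P)"
  "(\<lambda>z. ennreal (sqrt (\<rho>Y (snd (fst z)) (snd (snd z))))) \<in> borel_measurable (P \<Otimes>\<^sub>M P)"
  using measurable_\<rho>X measurable_\<rho>Y sets_pair_measure_cong[OF sets_P sets_P]
  by (simp_all cong: measurable_cong_sets)

lemma mean_finite: "meanX < \<infinity>" "meanY < \<infinity>"
proof -
  have sp: "space P = space Z" by (rule sets_eq_imp_space_eq[OF sets_P])
  have [measurable]: "\<alpha> \<in> borel_measurable P" "\<beta> \<in> borel_measurable P"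
    using measurable_\<alpha>\<beta> sets_P by (simp_all cong: measurable_cong_sets)
  have k: "(\<integral>\<^sup>+z. \<alpha> z \<partial>P) < \<infinity>" "(\<integral>\<^sup>+z. \<beta> z \<partial>P) < \<infinity>" using momX momY by (simp_all add: \<alpha>_def \<beta>_def)
  have "meanX = (\<integral>\<^sup>+z. \<integral>\<^sup>+z'. ennreal (sqrt (\<rho>X (fst z) (fst z'))) \<partial>P \<partial>P)"
    unfolding mean_P using P.nn_integral_fst[OF measurable_PP(1)] by simp
  also have "\<dots> \<le> (\<integral>\<^sup>+z. \<integral>\<^sup>+z'. 2 * (\<alpha> z + \<alpha> z') \<partial>P \<partial>P)"
    using kern_bounds(3) sp by (intro nn_integral_mono) simp
  also have "\<dots> = 2 * ((\<integral>\<^sup>+z. \<alpha> z \<partial>P) + (\<integral>\<^sup>+z. \<alpha> z \<partial>P))"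
    by (simp add: nn_integral_cmult nn_integral_add P.emeasure_space_1)
  also have "\<dots> < \<infinity>" using k by (simp add: ennreal_mult_less_top)
  finally show "meanX < \<infinity>" .
  have "meanY = (\<integral>\<^sup>+z. \<integral>\<^sup>+z'. ennreal (sqrt (\<rho>Y (snd z) (snd z'))) \<partial>P \<partial>P)"
    unfolding mean_P using P.nn_integral_fst[OF measurable_PP(2)] by simp
  also have "\<dots> \<le> (\<integral>\<^sup>+z. \<integral>\<^sup>+z'. 2 * (\<beta> z + \<beta> z') \<partial>P \<partial>P)"
    using kern_bounds(4) sp by (intro nn_integral_mono) simp
  also have "\<dots> = 2 * ((\<integral>\<^sup>+z. \<beta> z \<partial>P) + (\<integral>\<^sup>+z. \<beta> z \<partial>P))"
    by (simp add: nn_integral_cmult nn_integral_add P.emeasure_space_1)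
  also have "\<dots> < \<infinity>" using k by (simp add: ennreal_mult_less_top)
  finally show "meanY < \<infinity>" .
qed

text \<open>If one mean distance is zero, that distance vanishes almost surely between two
  independent copies, and \<open>kern\<close> with it. This excludes infinite energies, read as 0,
  balancing against a zero product of means.\<close>

lemma energy_PP_zero:
  assumes "meanX * meanY = 0"
  shows "energy P P = 0"
proof -
  note [measurable] = measurable_PP
  have sp: "space (P \<Otimes>\<^sub>M P) = space (Z \<Otimes>\<^sub>M Z)"
    by (rule sets_eq_imp_space_eq[OF sets_pair_measure_cong[OF sets_P sets_P]])
  have "AE z in P \<Otimes>\<^sub>M P. kern z = 0"
  proof (cases "meanX = 0")
    case True
    then have "AE z in P \<Otimes>\<^sub>M P. ennreal (sqrt (\<rho>X (fst (fst z)) (fst (snd z)))) = 0"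
      unfolding mean_P by (subst (asm) nn_integral_0_iff_AE) auto
    then show ?thesis using AE_space
      by eventually_elim (use \<rho>_nonneg(1) sp in \<open>force simp: kern_def ennreal_eq_0_iff\<close>)
  next
    case False
    then have "meanY = 0" using assms by simp
    then have "AE z in P \<Otimes>\<^sub>M P. ennreal (sqrt (\<rho>Y (snd (fst z)) (snd (snd z)))) = 0"
      unfolding mean_P by (subst (asm) nn_integral_0_iff_AE) auto
    then show ?thesis using AE_space
      by eventually_elim (use \<rho>_nonneg(2) sp in \<open>force simp: kern_def ennreal_eq_0_iff\<close>)
  qed
  then have "AE z in P \<Otimes>\<^sub>M P. ennreal (kern z) = 0" by eventually_elim simp
  then show ?thesis unfolding energy_def by (simp cong: nn_integral_cong_AE)
qed

text \<open>Correct for infinite energies as well: \<open>enn2real\<close> sends infinity to 0, the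
  value of the Bochner integral of a non-integrable function.\<close>

lemma integral_kern:
  assumes "A \<in> {P, Q}" "B \<in> {P, Q}"
  shows "(\<integral>z. kern z \<partial>(A \<Otimes>\<^sub>M B)) = enn2real (energy A B)"
proof -
  have S: "sets (A \<Otimes>\<^sub>M B) = sets (Z \<Otimes>\<^sub>M Z)"
    using assms sets_P sets_Q by (intro sets_pair_measure_cong) auto
  have "AE z in A \<Otimes>\<^sub>M B. 0 \<le> kern z"
    using kern_nonneg unfolding sets_eq_imp_space_eq[OF S, symmetric] by (rule AE_I2)
  then show ?thesis
    unfolding energy_def using measurable_kern S
    by (intro integral_eq_nn_integral) (simp_all cong: measurable_cong_sets)
qed

lemma integral_mean:
  "(\<integral>z. sqrt (\<rho>X (fst (fst z)) (fst (snd z))) \<partial>(P \<Otimes>\<^sub>M P)) = enn2real meanX"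
  "(\<integral>z. sqrt (\<rho>Y (snd (fst z)) (snd (snd z))) \<partial>(P \<Otimes>\<^sub>M P)) = enn2real meanY"
proof -
  have S: "sets (P \<Otimes>\<^sub>M P) = sets (Z \<Otimes>\<^sub>M Z)"
    using sets_P by (intro sets_pair_measure_cong)
  have AE: "AE z in P \<Otimes>\<^sub>M P. 0 \<le> sqrt (\<rho>X (fst (fst z)) (fst (snd z)))"
    "AE z in P \<Otimes>\<^sub>M P. 0 \<le> sqrt (\<rho>Y (snd (fst z)) (snd (snd z)))"
    using \<rho>_nonneg unfolding sets_eq_imp_space_eq[OF S, symmetric] by (auto intro: AE_I2)
  have m: "(\<lambda>z. sqrt (\<rho>X (fst (fst z)) (fst (snd z)))) \<in> borel_measurable (P \<Otimes>\<^sub>M P)"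
    "(\<lambda>z. sqrt (\<rho>Y (snd (fst z)) (snd (snd z)))) \<in> borel_measurable (P \<Otimes>\<^sub>M P)"
    using measurable_\<rho>X measurable_\<rho>Y S by (simp_all cong: measurable_cong_sets)
  show "(\<integral>z. sqrt (\<rho>X (fst (fst z)) (fst (snd z))) \<partial>(P \<Otimes>\<^sub>M P)) = enn2real meanX"
    unfolding mean_P by (rule integral_eq_nn_integral[OF m(1) AE(1)])
  show "(\<integral>z. sqrt (\<rho>Y (snd (fst z)) (snd (snd z))) \<partial>(P \<Otimes>\<^sub>M P)) = enn2real meanY"
    unfolding mean_P by (rule integral_eq_nn_integral[OF m(2) AE(2)])
qed

lemma energy_balance_zero_iff:
  "enn2real (energy P P) + enn2real meanX * enn2real meanY - 2 * enn2real (energy P Q) = 0 \<longleftrightarrow> P = Q"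
proof
  assume PQ: "P = Q"
  have "energy P P = energy Q Q" "energy P Q = energy Q Q" by (simp_all flip: PQ)
  then show "enn2real (energy P P) + enn2real meanX * enn2real meanY - 2 * enn2real (energy P Q) = 0"
    by (simp add: energy_QQ enn2real_mult)
next
  assume eq: "enn2real (energy P P) + enn2real meanX * enn2real meanY - 2 * enn2real (energy P Q) = 0"
  have QQ: "enn2real meanX * enn2real meanY = enn2real (energy Q Q)" by (simp add: energy_QQ enn2real_mult)
  have QQf: "energy Q Q < \<infinity>" using mean_finite by (simp add: energy_QQ ennreal_mult_less_top)
  \<comment> \<open>If \<open>energy P P\<close> is infinite, so is \<open>energy P Q\<close>; both
    are read as 0, the balance gives \<open>energy Q Q = 0\<close>, and
    \<open>energy_PP_zero\<close> contradicts the assumption.\<close>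
  have PPf: "energy P P < \<infinity>"
  proof (rule ccontr)
    assume "\<not> ?thesis"
    then have "\<not> energy P Q < \<infinity>" using energy_PP_finite by blast
    with \<open>\<not> energy P P < \<infinity>\<close> have top: "energy P P = \<infinity>" "energy P Q = \<infinity>"
      by (simp_all add: less_top[symmetric])
    then have "enn2real (energy Q Q) = 0" using eq QQ by simp
    then have "energy Q Q = 0" using QQf by (auto simp: enn2real_eq_0_iff)
    then show False using energy_PP_zero top by (simp add: energy_QQ)
  qed
  have PQf: "energy P Q < \<infinity>"
  proof -
    have "2 * energy P Q < \<infinity>" using energy_inequality PPf QQf by (auto intro: le_less_trans)
    then show ?thesis by (auto simp: ennreal_mult_less_top)
  qed
  obtain a b c where abc: "energy P P = ennreal a" "energy Q Q = ennreal b" "energy P Q = ennreal c"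
      "0 \<le> a" "0 \<le> b" "0 \<le> c"
    using PPf QQf PQf by (metis ennreal_cases less_irrefl infinity_ennreal_def)
  have "a + b = 2 * c" using eq abc by (simp add: QQ)
  then have "energy P P + energy Q Q = ennreal (2 * c)"
    unfolding abc(1,2) using ennreal_plus[OF abc(4,5)] by simp
  also have "\<dots> = 2 * energy P Q" using abc by (simp add: ennreal_mult)
  finally have "energy P P + energy Q Q = 2 * energy P Q" .
  moreover have "energy P P + energy Q Q < \<infinity>" using PPf QQf by simp
  ultimately show "P = Q" by (intro P_eq_Q_if_energy_eq)
qed

end

text \<open>Change of variables to the law of (X,Y), where independence means that this law equals
  the product of its marginals.\<close>

lemma dcov_sq_eq_0_iff_indep_var:
  assumes M: "prob_space M" and X: "X \<in> measurable M BX" and Y: "Y \<in> measurable M BY"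
    and adm: "admissible BX \<rho>X" "admissible BY \<rho>Y" and o: "oX \<in> space BX" "oY \<in> space BY"
    and mom: "(\<integral>\<^sup>+w. ennreal (sqrt (\<rho>X (X w) oX)) \<partial>M) < \<infinity>" "(\<integral>\<^sup>+w. ennreal (sqrt (\<rho>Y (Y w) oY)) \<partial>M) < \<infinity>"
  shows "dcov_sq M (\<lambda>x x'. sqrt (\<rho>X x x')) (\<lambda>y y'. sqrt (\<rho>Y y y')) X Y = 0
    \<longleftrightarrow> prob_space.indep_var M BX X BY Y"
proof -
  interpret M: prob_space M by fact
  note [measurable] = X Y
  let ?Z = "BX \<Otimes>\<^sub>M BY"
  define XY where "XY w = (X w, Y w)" for w
  have XY[measurable]: "XY \<in> measurable M ?Z" unfolding XY_def[abs_def] by measurable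
  define P where "P = distr M ?Z XY"
  have oX: "(\<lambda>x. \<rho>X x oX) \<in> borel_measurable BX" and oY: "(\<lambda>y. \<rho>Y y oY) \<in> borel_measurable BY"
    using measurable_compose[OF measurable_Pair2'[OF o(1)] admissibleD(1)[OF adm(1)]]
      measurable_compose[OF measurable_Pair2'[OF o(2)] admissibleD(1)[OF adm(2)]] by simp_all
  interpret P: prob_space P unfolding P_def by (rule M.prob_space_distr[OF XY])
  interpret C: coupled_kernels P BX BY \<rho>X \<rho>Y oX oY
  proof
    have "(\<integral>\<^sup>+z. ennreal (sqrt (\<rho>X (fst z) oX)) \<partial>P) = (\<integral>\<^sup>+w. ennreal (sqrt (\<rho>X (X w) oX)) \<partial>M)"
      unfolding P_def using measurable_compose[OF measurable_fst oX, of BY]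
      by (subst nn_integral_distr) (simp_all add: XY_def)
    then show "(\<integral>\<^sup>+z. ennreal (sqrt (\<rho>X (fst z) oX)) \<partial>P) < \<infinity>" using mom(1) by simp
    have "(\<integral>\<^sup>+z. ennreal (sqrt (\<rho>Y (snd z) oY)) \<partial>P) = (\<integral>\<^sup>+w. ennreal (sqrt (\<rho>Y (Y w) oY)) \<partial>M)"
      unfolding P_def using measurable_compose[OF measurable_snd oY, of BX]
      by (subst nn_integral_distr) (simp_all add: XY_def)
    then show "(\<integral>\<^sup>+z. ennreal (sqrt (\<rho>Y (snd z) oY)) \<partial>P) < \<infinity>" using mom(2) by simp
  qed (use adm o in \<open>simp_all add: P_def\<close>)
  have PX: "C.PX = distr M BX X" "C.PY = distr M BY Y"
    unfolding C.PX_def C.PY_def unfolding P_def by (simp_all add: distr_distr comp_def XY_def)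
  have sf: "sigma_finite_measure P" "sigma_finite_measure C.Q" "sigma_finite_measure C.PY"
    using P.sigma_finite_measure_axioms C.Q.sigma_finite_measure_axioms C.PY.sigma_finite_measure_axioms by auto
  have PP: "P \<Otimes>\<^sub>M P = distr (M \<Otimes>\<^sub>M M) (?Z \<Otimes>\<^sub>M ?Z) (\<lambda>(w, w'). (XY w, XY w'))"
    using pair_measure_distr[OF XY XY] sf(1) unfolding P_def by simp
  \<comment> \<open>The second and third copy together: X taken at \<open>w'\<close> and Y at
    \<open>w''\<close> has the product law.\<close>
  have Q: "C.Q = distr (M \<Otimes>\<^sub>M M) ?Z (\<lambda>(w', w''). (X w', Y w''))"
    using pair_measure_distr[OF X Y] sf(3) unfolding C.Q_def PX by simp
  have QXY: "C.Q = distr M BX X \<Otimes>\<^sub>M distr M BY Y" unfolding C.Q_def PX ..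
  have mQ: "(\<lambda>(w', w''). (X w', Y w'')) \<in> measurable (M \<Otimes>\<^sub>M M) ?Z" by measurable
  have PQ: "P \<Otimes>\<^sub>M C.Q = distr (M \<Otimes>\<^sub>M (M \<Otimes>\<^sub>M M)) (?Z \<Otimes>\<^sub>M ?Z) (\<lambda>(w, y). (XY w, case y of (w', w'') \<Rightarrow> (X w', Y w'')))"
    using pair_measure_distr[OF XY mQ] sf(2) unfolding Q unfolding P_def by simp
  note [measurable] = C.measurable_kern C.measurable_\<rho>X C.measurable_\<rho>Y mQ
  have 1: "(\<integral>(w, w'). sqrt (\<rho>X (X w) (X w')) * sqrt (\<rho>Y (Y w) (Y w')) \<partial>(M \<Otimes>\<^sub>M M)) = enn2real (C.energy P P)"
  proof -
    have "(\<integral>z. C.kern z \<partial>(P \<Otimes>\<^sub>M P)) = (\<integral>(w, w'). sqrt (\<rho>X (X w) (X w')) * sqrt (\<rho>Y (Y w) (Y w')) \<partial>(M \<Otimes>\<^sub>M M))"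
      unfolding PP by (subst integral_distr) (simp_all add: C.kern_def XY_def case_prod_beta')
    then show ?thesis using C.integral_kern[of P P] by simp
  qed
  have 2: "(\<integral>(w, w'). sqrt (\<rho>X (X w) (X w')) \<partial>(M \<Otimes>\<^sub>M M)) = enn2real C.meanX"
    unfolding C.integral_mean(1)[symmetric] unfolding PP
    by (subst integral_distr) (simp_all add: XY_def case_prod_beta')
  have 3: "(\<integral>(w, w'). sqrt (\<rho>Y (Y w) (Y w')) \<partial>(M \<Otimes>\<^sub>M M)) = enn2real C.meanY"
    unfolding C.integral_mean(2)[symmetric] unfolding PP
    by (subst integral_distr) (simp_all add: XY_def case_prod_beta')
  have 4: "(\<integral>(w, w', w''). sqrt (\<rho>X (X w) (X w')) * sqrt (\<rho>Y (Y w) (Y w'')) \<partial>(M \<Otimes>\<^sub>M (M \<Otimes>\<^sub>M M))) = enn2real (C.energy P C.Q)"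
  proof -
    have "(\<integral>z. C.kern z \<partial>(P \<Otimes>\<^sub>M C.Q)) = (\<integral>(w, w', w''). sqrt (\<rho>X (X w) (X w')) * sqrt (\<rho>Y (Y w) (Y w'')) \<partial>(M \<Otimes>\<^sub>M (M \<Otimes>\<^sub>M M)))"
      unfolding PQ by (subst integral_distr) (simp_all add: C.kern_def XY_def case_prod_beta')
    then show ?thesis using C.integral_kern[of P C.Q] by simp
  qed
  have "dcov_sq M (\<lambda>x x'. sqrt (\<rho>X x x')) (\<lambda>y y'. sqrt (\<rho>Y y y')) X Y = 0 \<longleftrightarrow> P = C.Q"
    unfolding dcov_sq_def 1 2 3 4 by (rule C.energy_balance_zero_iff)
  also have "\<dots> \<longleftrightarrow> M.indep_var BX X BY Y"
    unfolding M.indep_var_distribution_eq QXY unfolding P_def XY_def[abs_def] using X Y by auto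
  finally show ?thesis .
qed

section \<open>Blocks, groups and their moments\<close>

lemma admissible_blocks:
  assumes "case_S1 n d \<rho> \<or> case_S2 n d \<rho>" "i \<in> {1..n}"
  shows "admissible (borel_Rn (d i)) (\<rho> i)"
  using assms(1)
proof
  assume "case_S1 n d \<rho>"
  then show ?thesis using assms(2) unfolding case_S1_def by (intro admissible_strong_negative_type) blast+
next
  assume S2: "case_S2 n d \<rho>"
  \<comment> \<open>Squared Euclidean distance is the sum of the squared distances of the real
    coordinates.\<close>
  have "admissible (borel_Rn (d i)) (\<lambda>x y. \<Sum>k<d i. (x k - y k)\<^sup>2)"
    unfolding borel_Rn_def by (rule admissible_PiM[OF finite_lessThan admissible_real])
  then show ?thesis
    by (rule admissible_cong[rotated]) (use S2 assms(2) in \<open>simp add: case_S2_def\<close>)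
qed

lemma admissible_groups:
  assumes "case_S1 n d \<rho> \<or> case_S2 n d \<rho>"
  shows "admissible (borel_groups n d) (\<lambda>x y. \<Sum>i=1..n. \<rho> i (x i) (y i))"
  unfolding borel_groups_def by (rule admissible_PiM[OF finite_atLeastAtMost admissible_blocks[OF assms]])

lemma origin_in_space: "origin d \<in> Rn d"
  by (simp add: origin_def borel_Rn_def space_PiM)

lemma sqrt_sum_le:
  assumes "\<And>i. i \<in> I \<Longrightarrow> 0 \<le> (a i :: real)"
  shows "sqrt (\<Sum>i\<in>I. a i) \<le> (\<Sum>i\<in>I. sqrt (a i))"
  using assms
proof (induction I rule: infinite_finite_induct)
  case (insert i I)
  then have "sqrt (a i + sum a I) \<le> sqrt (a i) + sqrt (sum a I)"
    by (intro sqrt_add_le_add_sqrt sum_nonneg) auto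
  with insert show ?case by (auto intro: order_trans)
qed auto

text \<open>The square root is subadditive and there are finitely many blocks, so a finite supremum
  of the block moments bounds the moment of K.\<close>

lemma group_moment_finite:
  assumes S: "case_S1 n d \<rho> \<or> case_S2 n d \<rho>" and X: "X \<in> measurable M (borel_groups n d)"
    and fin: "(SUP i\<in>{1..n}. \<integral>\<^sup>+w. ennreal (sqrt (\<rho> i (X w i) (origin (d i)))) \<partial>M) < \<infinity>"
  shows "(\<integral>\<^sup>+w. ennreal (sqrt (\<Sum>i=1..n. \<rho> i (X w i) ((\<lambda>i\<in>{1..n}. origin (d i)) i))) \<partial>M) < \<infinity>"
proof -
  have Xi: "(\<lambda>w. X w i) \<in> measurable M (borel_Rn (d i))" if "i \<in> {1..n}" for i
    using measurable_compose[OF X[unfolded borel_groups_def] measurable_component_singleton[OF that]] .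
  have m: "(\<lambda>w. ennreal (sqrt (\<rho> i (X w i) (origin (d i))))) \<in> borel_measurable M" if i: "i \<in> {1..n}" for i
    using measurable_compose[OF Xi[OF i] measurable_compose[OF measurable_Pair2'[OF origin_in_space]
        admissibleD(1)[OF admissible_blocks[OF S i]]]] by simp
  have "(\<integral>\<^sup>+w. ennreal (sqrt (\<Sum>i=1..n. \<rho> i (X w i) ((\<lambda>i\<in>{1..n}. origin (d i)) i))) \<partial>M)
      \<le> (\<integral>\<^sup>+w. (\<Sum>i=1..n. ennreal (sqrt (\<rho> i (X w i) (origin (d i))))) \<partial>M)"
  proof (rule nn_integral_mono)
    fix w assume w: "w \<in> space M"
    have nn: "0 \<le> \<rho> i (X w i) (origin (d i))" if i: "i \<in> {1..n}" for i
      by (rule admissibleD(3)[OF admissible_blocks[OF S i] measurable_space[OF Xi[OF i] w] origin_in_space])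
    have "sqrt (\<Sum>i=1..n. \<rho> i (X w i) ((\<lambda>i\<in>{1..n}. origin (d i)) i)) = sqrt (\<Sum>i=1..n. \<rho> i (X w i) (origin (d i)))"
      by (intro arg_cong[where f = sqrt] sum.cong) auto
    also have "\<dots> \<le> (\<Sum>i=1..n. sqrt (\<rho> i (X w i) (origin (d i))))" by (rule sqrt_sum_le[OF nn])
    finally show "ennreal (sqrt (\<Sum>i=1..n. \<rho> i (X w i) ((\<lambda>i\<in>{1..n}. origin (d i)) i)))
        \<le> (\<Sum>i=1..n. ennreal (sqrt (\<rho> i (X w i) (origin (d i)))))"
      using nn by (subst sum_ennreal) (auto intro: ennreal_leI)
  qed
  also have "\<dots> = (\<Sum>i=1..n. \<integral>\<^sup>+w. ennreal (sqrt (\<rho> i (X w i) (origin (d i)))) \<partial>M)"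
    using m by (intro nn_integral_sum) auto
  also have "\<dots> < \<infinity>"
  proof -
    have "(\<integral>\<^sup>+w. ennreal (sqrt (\<rho> i (X w i) (origin (d i)))) \<partial>M) < \<infinity>" if "i \<in> {1..n}" for i
      by (rule le_less_trans[OF SUP_upper[OF that] fin])
    then show ?thesis by simp
  qed
  finally show ?thesis .
qed

theorem theoremA3:
  fixes M :: "'w measure"
    and p q :: nat
    and d g :: "nat \<Rightarrow> nat"
    and X Y :: "'w \<Rightarrow> nat \<Rightarrow> nat \<Rightarrow> real"
    and \<rho>X \<rho>Y :: "nat \<Rightarrow> (nat \<Rightarrow> real) \<Rightarrow> (nat \<Rightarrow> real) \<Rightarrow> real"
  assumes "prob_space M"
    and "p \<ge> 1" and "q \<ge> 1"
    and "\<forall>i\<in>{1..p}. d i \<ge> 1" and "\<forall>j\<in>{1..q}. g j \<ge> 1"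
    and "X \<in> measurable M (borel_groups p d)"
    and "Y \<in> measurable M (borel_groups q g)"
    and "case_S1 p d \<rho>X \<or> case_S2 p d \<rho>X"
    and "case_S1 q g \<rho>Y \<or> case_S2 q g \<rho>Y"
    and "(SUP i\<in>{1..p}. \<integral>\<^sup>+ w. ennreal (sqrt (\<rho>X i (X w i) (origin (d i)))) \<partial>M) < \<infinity>"
    and "(SUP j\<in>{1..q}. \<integral>\<^sup>+ w. ennreal (sqrt (\<rho>Y j (Y w j) (origin (g j)))) \<partial>M) < \<infinity>"
  shows "dcov M (group_dist p \<rho>X) (group_dist q \<rho>Y) X Y = 0 \<longleftrightarrow>
         prob_space.indep_var M (borel_groups p d) X (borel_groups q g) Y"
proof -
  have origins: "(\<lambda>i\<in>{1..n}. origin (e i)) \<in> space (borel_groups n e)" for n e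
    by (auto simp: borel_groups_def space_PiM origin_in_space)
  have "dcov_sq M (group_dist p \<rho>X) (group_dist q \<rho>Y) X Y = 0 \<longleftrightarrow>
      prob_space.indep_var M (borel_groups p d) X (borel_groups q g) Y"
    unfolding group_dist_def[abs_def]
  proof (rule dcov_sq_eq_0_iff_indep_var[OF assms(1,6,7) admissible_groups[OF assms(8)] admissible_groups[OF assms(9)]])
    show "(\<lambda>i\<in>{1..p}. origin (d i)) \<in> space (borel_groups p d)" by (rule origins)
    show "(\<lambda>j\<in>{1..q}. origin (g j)) \<in> space (borel_groups q g)" by (rule origins)
  qed (rule group_moment_finite[OF assms(8,6,10)], rule group_moment_finite[OF assms(9,7,11)])
  \<comment> \<open>\<open>sqrt\<close> is defined on all reals and vanishes only at 0.\<close>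
  then show ?thesis by (simp add: dcov_def)
qed

end
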